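(* Let $K$ be a positive integer and $x_1,\ldots,x_K\in\mathbb{R}^2$. Then: (1) (Well-posedness) There exists a unique $\sigma^{\rm TF}$ minimizing $\mathcal{E}^{\rm TF}$ over $\mathcal{M}^{\rm TF}$. (2) (Potential and variational inequalities) The potential $\Phi^{\rm TF}:=V_{\rm nuc}+\sigma^{\rm TF}*\log|\cdot|$ is continuous and once continuously differentiable away from the points $x_i$, and tends to zero at infinity. Moreover, for almost all $x$: $\Phi^{\rm TF}(x)>0$ if $\sigma^{\rm TF}(x)>0$, and $\Phi^{\rm TF}(x)=0$ if $\sigma^{\rm TF}(x)=0$. (3) (Values of the density) The set $\{x:0<\sigma^{\rm TF}(x)<1\}$ has zero Lebesgue measure, so $\sigma^{\rm TF}$ takes only the values $0$ or $1$ almost everywhere. (4) (Support of the density) (i) For any $R>\max_i|x_i|$, up to a set of measure zero, $\{x:\sigma^{\rm TF}(x)>0\}\subset D(0,R+\sqrt{M_R})$, where $M_R:=\frac1\pi\sup_{|x|=R}\Phi^{\rm TF}(x)$ and $D(0,r)$ is the disk of radius $r$ centered at $0$. (ii) Up to a set of measure zero, $\{x:\sigma^{\rm TF}(x)>0\}$ equals the open set $\Sigma^{\rm TF}(x_1,\ldots,x_K):=\{x:\Phi^{\rm TF}(x)>0\}$, and the area of $\Sigma^{\rm TF}(x_1,\ldots,x_K)$ equals $K$. (iii) The points $x_1,\ldots,x_K$ lie in $\Sigma^{\rm TF}(x_1,\ldots,x_K)$, and every connected component of this set contains at least one $x_j$. (iv) $\Sigma^{\rm TF}(x_1,\ldots,x_{K-1})\subset\Sigma^{\rm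 TF}(x_1,\ldots,x_K)$. (v) For a single point, $\Sigma^{\rm TF}(x_1)=\{x:|x-x_1|<1/\sqrt{\pi}\}$.
   Context: Given points ("nuclei") $x_1,\ldots,x_K\in\mathbb{R}^2$, set $V_{\rm nuc}(x)=-\sum_{i=1}^K\log|x-x_i|$, and $$D(\sigma,\sigma)=-\frac12\iint_{\mathbb{R}^2\times\mathbb{R}^2}\sigma(x)\log|x-y|\sigma(y)\,dx\,dy,\qquad \mathcal{E}^{\rm TF}[\sigma]=-\int_{\mathbb{R}^2}V_{\rm nuc}\sigma+D(\sigma,\sigma).$$ The variational set is $$\mathcal{M}^{\rm TF}=\Big\{\sigma\in L^\infty(\mathbb{R}^2)\cap L^1(\mathbb{R}^2,\log(2+|x|)dx):\ 0\leq\sigma\leq1,\ \int_{\mathbb{R}^2}\sigma=K\Big\}.$$ In (iv), the set $\Sigma^{\rm TF}(x_1,\ldots,x_{K-1})$ is defined by the same construction with only the nuclei $x_1,\ldots,x_{K-1}$ (and $K-1$ in place of $K$ in the mass constraint). *)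

theory Defs
  imports "HOL-Analysis.Analysis"
begin

text \<open>The plane R^2 is modelled by the type complex (a 2-dimensional euclidean space);
  Lebesgue measure is lborel on complex. Nuclei are given as a list xs of points.\<close>

definition Vnuc :: "complex list \<Rightarrow> complex \<Rightarrow> real" where
  "Vnuc xs x = - (\<Sum>i<length xs. ln (norm (x - xs ! i)))"

definition Dcoul :: "(complex \<Rightarrow> real) \<Rightarrow> real" where
  "Dcoul \<sigma> = - (1/2) * integral\<^sup>L (lborel \<Otimes>\<^sub>M lborel)
      (\<lambda>(x, y). \<sigma> x * ln (norm (x - y)) * \<sigma> y)"

definition E_TF :: "complex list \<Rightarrow> (complex \<Rightarrow> real) \<Rightarrow> real" where
  "E_TF xs \<sigma> = - (LINT x|lborel. Vnuc xs x * \<sigma> x) + Dcoul \<sigma>"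

definition M_TF :: "complex list \<Rightarrow> (complex \<Rightarrow> real) set" where
  "M_TF xs = {\<sigma>. \<sigma> \<in> borel_measurable lborel
      \<and> (\<forall>x. 0 \<le> \<sigma> x \<and> \<sigma> x \<le> 1)
      \<and> integrable lborel (\<lambda>x. \<sigma> x * ln (2 + norm x))
      \<and> (LINT x|lborel. \<sigma> x) = real (length xs)}"

definition is_TF_min :: "complex list \<Rightarrow> (complex \<Rightarrow> real) \<Rightarrow> bool" where
  "is_TF_min xs \<sigma> \<longleftrightarrow> \<sigma> \<in> M_TF xs \<and> (\<forall>\<tau>\<in>M_TF xs. E_TF xs \<sigma> \<le> E_TF xs \<tau>)"

text \<open>The TF potential, real-valued version (meaningful away from the nuclei).\<close>
definition PhiR :: "complex list \<Rightarrow> (complex \<Rightarrow> real) \<Rightarrow> complex \<Rightarrow> real" where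
  "PhiR xs \<sigma> x = Vnuc xs x + (LINT y|lborel. \<sigma> y * ln (norm (x - y)))"

text \<open>The TF potential as an extended real valued function, equal to +infinity at the
  nuclei (where V_nuc = +infinity).\<close>
definition PhiTF :: "complex list \<Rightarrow> (complex \<Rightarrow> real) \<Rightarrow> complex \<Rightarrow> ereal" where
  "PhiTF xs \<sigma> x = (if x \<in> set xs then \<infinity> else ereal (PhiR xs \<sigma> x))"

definition SigmaTF :: "complex list \<Rightarrow> (complex \<Rightarrow> real) \<Rightarrow> complex set" where
  "SigmaTF xs \<sigma> = {x. 0 < PhiTF xs \<sigma> x}"

end

theory Submission
  imports Defs
begin

text \<open>Write \<open>\<Phi>\<close> for the Thomas-Fermi potential. The minimizer is found as the indicator of the
  noncontact set of an obstacle problem. Smearing each nucleus over a disc of radius \<open>\<rho>\<close> with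
  \<open>\<pi> \<rho>\<^sup>2 < 1\<close> turns \<open>V\<close> into a Lipschitz obstacle \<open>p\<close>. Let \<open>v\<close> be the largest continuous minorant of
  \<open>p\<close> with \<open>\<Delta>v \<ge> -2\<pi>\<close> and \<open>S = {v < p}\<close>. Perron lifting gives \<open>\<Delta>v = -2\<pi>\<close> on \<open>S\<close>, while off \<open>S\<close> the function
  \<open>v\<close> agrees with \<open>p\<close>, which is harmonic there. Hence \<open>v + log * 1\<^sub>S\<close> satisfies the mean value property
  off a null set, and therefore everywhere; by its logarithmic growth it vanishes, so that
  \<open>|S| = K\<close> and \<open>\<Phi> = p - v + (V - p)\<close> is positive exactly on \<open>S\<close>.

  Conversely, an indicator whose potential is positive on \<open>S\<close> and zero off \<open>S\<close> is the only
  minimizer, as the logarithmic energy is nonnegative on neutral densities: by Frullani's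
  integral, \<open>- log\<close> is up to constants a positive mixture of Gaussians. This also settles the case of
  one nucleus, where Newton's theorem computes the potential of a disc. The remaining assertions
  on \<open>S\<close> compare \<open>v\<close> with other minorants: minorants of fewer charges, or \<open>v\<close> altered on a
  component of \<open>S\<close> or outside a disc.

  Throughout, \<open>\<Delta>u \<ge> -2\<pi>\<close> is expressed by \<open>u(x) \<le> (mean of u over ball x r) + \<pi>/4 r\<^sup>2\<close>, because the
  mean of \<open>|y - x|\<^sup>2\<close>, whose Laplacian is 4, is \<open>r\<^sup>2/2\<close>.\<close>

text \<open>Smearing is needed because \<open>Vnuc\<close> is infinite at the nuclei. The threshold
  \<open>pi * \<rho>\<^sup>2 < 1\<close> says that a smeared nucleus has density greater than 1, the
  largest value allowed to the electrons: its disc is then swallowed by \<open>S\<close>, and off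
  \<open>S\<close> the smearing is invisible. The radius stays a parameter because the support bound
  needs discs adapted to \<open>R\<close>; uniqueness of the minimizer shows that \<open>S\<close>
  does not depend on it. The obstacle that shapes the proof is the free boundary: \<open>v\<close>
  is only known to be Lipschitz, and a priori the boundary of \<open>S\<close> may have positive
  area, so \<open>\<Delta>v\<close> cannot be read off there. However, \<open>S\<close> has density
  zero at almost every point off \<open>S\<close>, and there \<open>p - v\<close>, which grows at
  most quadratically, has disc means of order \<open>o(r\<^sup>2)\<close>. Such an error is
  harmless, because sub-mean value properties may be checked up to \<open>e * r\<^sup>2\<close>.
  Disc means are area integrals, so that Fubini and rotation invariance suffice to handle them, and
  no second derivatives occur.\<close>

section \<open>Symmetries of planar Lebesgue measure and integrals of radial functions\<close>

lemma nn_integral_lborel_translate: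
  fixes f :: "complex \<Rightarrow> ennreal" and a :: complex
  assumes [measurable]: "f \<in> borel_measurable borel"
  shows "(\<integral>\<^sup>+x. f (a + x) \<partial>lborel) = (\<integral>\<^sup>+x. f x \<partial>lborel)"
proof -
  have "(\<integral>\<^sup>+x. f x \<partial>lborel) = (\<integral>\<^sup>+x. f x \<partial>(distr lborel borel ((+) a)))"
    by (simp add: lborel_distr_plus)
  also have "\<dots> = (\<integral>\<^sup>+x. f (a + x) \<partial>lborel)"
    by (subst nn_integral_distr) auto
  finally show ?thesis by simp
qed

lemma nn_integral_lborel_reflect:
  fixes f :: "complex \<Rightarrow> ennreal" and a :: complex
  assumes [measurable]: "f \<in> borel_measurable borel"
  shows "(\<integral>\<^sup>+x. f (a - x) \<partial>lborel) = (\<integral>\<^sup>+x. f x \<partial>lborel)"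
proof -
  have "(\<integral>\<^sup>+x. f x \<partial>lborel) = (\<integral>\<^sup>+x. f x \<partial>(density (distr lborel borel (\<lambda>x. a + (-1) *\<^sub>R x)) (\<lambda>_. 1)))"
    using lborel_affine[of "-1" a] by simp
  also have "\<dots> = (\<integral>\<^sup>+x. f (a - x) \<partial>lborel)"
    by (subst density_1, subst nn_integral_distr) auto
  finally show ?thesis by simp
qed

lemma emeasure_ball_complex: "r \<ge> 0 \<Longrightarrow> emeasure lborel (ball (a::complex) r) = ennreal (pi * r\<^sup>2)"
  by (simp add: emeasure_ball DIM_complex unit_ball_vol_2)

text \<open>Uniqueness of translation-invariant measures: both products
  \<open>\<mu> A * \<lambda> B\<close> and \<open>\<mu> B * \<lambda> A\<close> count the pairs \<open>(x, y)\<close> with \<open>x \<in> A\<close>, \<open>x + y \<in> B\<close>.\<close>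
lemma lborel_distr_rotate:
  fixes c :: complex
  assumes c: "norm c = 1"
  shows "distr lborel borel ((*) c) = lborel"
proof (rule measure_eqI)
  define M where "M = distr lborel (borel :: complex measure) ((*) c)"
  have sM[measurable_cong, simp]: "sets M = sets borel" by (simp add: M_def)
  have c0: "c \<noteq> 0" using c by auto
  have nnM: "(\<integral>\<^sup>+x. f x \<partial>M) = (\<integral>\<^sup>+x. f (c * x) \<partial>lborel)" if [measurable]: "f \<in> borel_measurable borel" for f :: "complex \<Rightarrow> ennreal"
    unfolding M_def by (subst nn_integral_distr) auto
  have trM: "(\<integral>\<^sup>+x. f (a + x) \<partial>M) = (\<integral>\<^sup>+x. f x \<partial>M)" if [measurable]: "f \<in> borel_measurable borel"
    for f :: "complex \<Rightarrow> ennreal" and a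
  proof -
    have "(\<integral>\<^sup>+x. f (a + x) \<partial>M) = (\<integral>\<^sup>+x. f (c * (a / c + x)) \<partial>lborel)"
      using c0 by (subst nnM) (auto simp: distrib_left)
    also have "\<dots> = (\<integral>\<^sup>+x. f (c * x) \<partial>lborel)"
      using nn_integral_lborel_translate[of "\<lambda>x. f (c * x)" "a / c"] by simp
    finally show ?thesis by (simp add: nnM)
  qed
  have vb: "(*) c -` ball 0 r = ball 0 r" for r
    using c by (auto simp: norm_mult)
  have MB: "emeasure M (ball 0 r) = emeasure lborel (ball (0::complex) r)" for r
    unfolding M_def by (subst emeasure_distr) (auto simp: vb)
  interpret M: sigma_finite_measure M
  proof
    show "\<exists>A. countable A \<and> A \<subseteq> sets M \<and> \<Union> A = space M \<and> (\<forall>a\<in>A. emeasure M a \<noteq> \<infinity>)"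
    proof (intro exI conjI ballI)
      show "countable (range (\<lambda>n::nat. ball (0::complex) (real n)))" by simp
      show "range (\<lambda>n::nat. ball (0::complex) (real n)) \<subseteq> sets M" by auto
      show "\<Union> (range (\<lambda>n::nat. ball (0::complex) (real n))) = space M"
        by (auto simp: M_def reals_Archimedean2)
      fix a assume "a \<in> range (\<lambda>n::nat. ball (0::complex) (real n))"
      then show "emeasure M a \<noteq> \<infinity>" by (auto simp: MB emeasure_ball_complex)
    qed
  qed
  interpret P: pair_sigma_finite M lborel ..
  show "sets (distr lborel borel ((*) c)) = sets lborel" by simp
  fix A assume "A \<in> sets (distr lborel borel ((*) c))"
  then have [measurable]: "A \<in> sets borel" by simp
  \<comment> \<open>The rotation maps the unit disc to itself, so both measures give it the mass
    \<open>pi\<close>; this fixes the constant of proportionality.\<close>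
  define B where "B = ball (0::complex) 1"
  have [measurable]: "B \<in> sets borel" by (simp add: B_def)
  have [simp]: "indicator A x * indicator B y * (1::ennreal) = indicator A x * indicator B y" for x y by simp
  have "emeasure M A * emeasure lborel B = (\<integral>\<^sup>+x. (\<integral>\<^sup>+y. indicator A x * indicator B (x + y) \<partial>lborel) \<partial>M)"
    by (simp add: nn_integral_cmult nn_integral_lborel_translate nn_integral_multc)
  also have "\<dots> = (\<integral>\<^sup>+y. (\<integral>\<^sup>+x. indicator A x * indicator B (x + y) \<partial>M) \<partial>lborel)"
    by (rule P.Fubini'[symmetric]) simp
  also have "\<dots> = (\<integral>\<^sup>+y. (\<integral>\<^sup>+x. indicator A (x - y) * indicator B x \<partial>M) \<partial>lborel)"
  proof (rule nn_integral_cong)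
    fix y
    show "(\<integral>\<^sup>+x. indicator A x * indicator B (x + y) \<partial>M) = (\<integral>\<^sup>+x. indicator A (x - y) * indicator B x \<partial>M)"
      using trM[of "\<lambda>x. indicator A (x - y) * indicator B x" y] by (simp add: add.commute)
  qed
  also have "\<dots> = (\<integral>\<^sup>+x. (\<integral>\<^sup>+y. indicator A (x - y) * indicator B x \<partial>lborel) \<partial>M)"
    by (rule P.Fubini') simp
  also have "\<dots> = emeasure lborel A * emeasure M B"
    by (simp add: nn_integral_cmult nn_integral_multc nn_integral_lborel_reflect)
  finally have "emeasure M A * ennreal pi = emeasure lborel A * ennreal pi"
    by (simp add: B_def MB emeasure_ball_complex)
  then show "emeasure (distr lborel borel ((*) c)) A = emeasure lborel A"
    unfolding M_def[symmetric] by (auto simp: ennreal_mult_cancel_left mult.commute[of _ "ennreal pi"])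
qed

lemma integral_lborel_rotate:
  fixes f :: "complex \<Rightarrow> 'b::{banach, second_countable_topology}"
  assumes "norm c = 1" and [measurable]: "f \<in> borel_measurable borel"
  shows "(LINT z|lborel. f (c * z)) = (LINT z|lborel. f z)"
  by (subst (2) lborel_distr_rotate[OF assms(1), symmetric], subst integral_distr) auto

lemma integral_lborel_translate:
  fixes f :: "complex \<Rightarrow> 'b::{banach, second_countable_topology}"
  assumes [measurable]: "f \<in> borel_measurable borel"
  shows "(LINT z|lborel. f (a + z)) = (LINT z|lborel. f z)"
  by (subst (2) lborel_distr_plus[of a, symmetric], subst integral_distr) auto

lemma integrable_lborel_translate:
  fixes f :: "complex \<Rightarrow> 'b::{banach, second_countable_topology}"
  assumes "integrable lborel f"
  shows "integrable lborel (\<lambda>z. f (a + z))"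
proof -
  have [measurable]: "f \<in> borel_measurable borel" using assms by auto
  show ?thesis
    using assms by (subst (asm) lborel_distr_plus[of a, symmetric], subst (asm) integrable_distr_eq) auto
qed

lemma distr_lborel_reflect: "distr lborel borel (\<lambda>x. a - x) = (lborel :: complex measure)"
  using lborel_affine[of "-1" a] by (simp add: density_1)

lemma integral_lborel_reflect:
  fixes f :: "complex \<Rightarrow> 'b::{banach, second_countable_topology}"
  assumes [measurable]: "f \<in> borel_measurable borel"
  shows "(LINT z|lborel. f (a - z)) = (LINT z|lborel. f z)"
  by (subst (2) distr_lborel_reflect[of a, symmetric], subst integral_distr) auto

lemma integrable_lborel_reflect:
  fixes f :: "complex \<Rightarrow> 'b::{banach, second_countable_topology}"
  assumes "integrable lborel f"
  shows "integrable lborel (\<lambda>z. f (a - z))"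
proof -
  have [measurable]: "f \<in> borel_measurable borel" using assms by auto
  show ?thesis
    using assms by (subst (asm) distr_lborel_reflect[of a, symmetric], subst (asm) integrable_distr_eq) auto
qed

text \<open>The mass of \<open>{..t}\<close> is on both sides the area of the closed disc of radius
  \<open>t\<close>, whose derivative in \<open>t\<close> is the density, and these half-lines
  generate the Borel sets. Polar coordinates are used for radial functions only; elsewhere rotation
  invariance takes care of the angle.\<close>

lemma distr_norm_lborel:
  "distr lborel borel (norm :: complex \<Rightarrow> real) = density lborel (\<lambda>t. ennreal (2 * pi * t) * indicator {0..} t)"
proof (rule measure_eqI_generator_eq[where E="range atMost" and \<Omega>=UNIV and A="\<lambda>n. {..real n}"])
  show "Int_stable (range (atMost :: real \<Rightarrow> _))"
    by (auto simp: Int_stable_def)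
  show "\<And>X. X \<in> range atMost \<Longrightarrow> emeasure (distr lborel borel (norm :: complex \<Rightarrow> real)) X
     = emeasure (density lborel (\<lambda>t. ennreal (2 * pi * t) * indicator {0..} t)) X"
  proof -
    fix X :: "real set" assume "X \<in> range atMost"
    then obtain t where X: "X = {..t}" by auto
    have pre: "norm -` {..t} = cball (0::complex) t" by auto
    show "emeasure (distr lborel borel (norm :: complex \<Rightarrow> real)) X
     = emeasure (density lborel (\<lambda>t. ennreal (2 * pi * t) * indicator {0..} t)) X"
    proof (cases "t \<ge> 0")
      case True
      have "(\<integral>\<^sup>+s. ennreal (2 * pi * s) * indicator {0..t} s \<partial>lborel) = pi * t\<^sup>2 - pi * 0\<^sup>2"
        using True by (intro nn_integral_FTC_Icc) (auto intro!: derivative_eq_intros)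
      moreover have "(\<integral>\<^sup>+s. ennreal (2 * pi * s) * indicator {0..} s * indicator X s \<partial>lborel)
          = (\<integral>\<^sup>+s. ennreal (2 * pi * s) * indicator {0..t} s \<partial>lborel)"
        by (intro nn_integral_cong) (auto simp: X split: split_indicator)
      ultimately show ?thesis
        using True by (simp add: X emeasure_distr pre emeasure_density emeasure_cball DIM_complex unit_ball_vol_2)
    next
      case False
      have "(\<integral>\<^sup>+s. ennreal (2 * pi * s) * indicator {0..} s * indicator X s \<partial>lborel) = (\<integral>\<^sup>+(s::real). 0 \<partial>lborel)"
        using False by (intro nn_integral_cong) (auto simp: X split: split_indicator)
      then show ?thesis
        using False by (simp add: X emeasure_distr pre emeasure_density)
    qed
  qed
  show "sets (distr lborel borel (norm :: complex \<Rightarrow> real)) = sigma_sets UNIV (range atMost)"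
    by (simp add: borel_eq_atMost)
  show "sets (density lborel (\<lambda>t. ennreal (2 * pi * t) * indicator {0..} t)) = sigma_sets UNIV (range atMost)"
    by (simp add: borel_eq_atMost)
  show "(\<Union>i. {..real i}) = UNIV" using real_arch_simple by auto
  fix i :: nat
  have pre: "norm -` {..real i} = cball (0::complex) i" by auto
  show "emeasure (distr lborel borel (norm :: complex \<Rightarrow> real)) {..real i} \<noteq> \<infinity>"
    by (simp add: emeasure_distr pre emeasure_cball DIM_complex)
qed auto

lemma integral_radial:
  fixes f :: "real \<Rightarrow> real"
  assumes [measurable]: "f \<in> borel_measurable borel"
  shows "(LINT z|lborel. f (norm (z::complex))) = (LINT t|lborel. indicator {0..} t * (2 * pi * t) * f t)"
    and "integrable lborel (\<lambda>z::complex. f (norm z)) \<longleftrightarrow> integrable lborel (\<lambda>t. indicator {0..} t * (2 * pi * t) * f t)"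
proof -
  have d: "density lborel (\<lambda>t. ennreal (2 * pi * t) * indicator {0..} t) = density lborel (\<lambda>t. ennreal (indicator {0..} t * (2 * pi * t)))"
    by (intro density_cong) (auto split: split_indicator)
  have "(LINT z|lborel. f (norm (z::complex))) = (LINT t|distr lborel borel (norm :: complex \<Rightarrow> real). f t)"
    by (subst integral_distr) auto
  also have "\<dots> = (LINT t|lborel. indicator {0..} t * (2 * pi * t) * f t)"
    unfolding distr_norm_lborel d by (subst integral_density) (auto split: split_indicator)
  finally show "(LINT z|lborel. f (norm (z::complex))) = (LINT t|lborel. indicator {0..} t * (2 * pi * t) * f t)" .
  have "integrable lborel (\<lambda>z::complex. f (norm z)) \<longleftrightarrow> integrable (distr lborel borel (norm :: complex \<Rightarrow> real)) f"
    by (subst integrable_distr_eq) auto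
  also have "\<dots> \<longleftrightarrow> integrable lborel (\<lambda>t. indicator {0..} t * (2 * pi * t) * f t)"
    unfolding distr_norm_lborel d by (subst integrable_density) (auto split: split_indicator)
  finally show "integrable lborel (\<lambda>z::complex. f (norm z)) \<longleftrightarrow> integrable lborel (\<lambda>t. indicator {0..} t * (2 * pi * t) * f t)" .
qed

text \<open>A gauge integrable function that is nonnegative is absolutely integrable, so the
  fundamental theorem alone yields Lebesgue integrability, even for \<open>1 / t\<close> or
  \<open>- ln t\<close> near 0. The finite set \<open>S\<close> allows antiderivatives defined
  piecewise.\<close>

lemma radial_ball_nonneg:
  fixes f F :: "real \<Rightarrow> real"
  assumes r: "0 \<le> r" and [measurable]: "f \<in> borel_measurable borel"
    and nonneg: "\<And>t. 0 < t \<Longrightarrow> t \<le> r \<Longrightarrow> 0 \<le> f t"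
    and S: "finite S" and F: "continuous_on {0..r} F"
    and deriv: "\<And>t. t \<in> {0<..<r} - S \<Longrightarrow> (F has_real_derivative 2 * pi * t * f t) (at t)"
  shows "integrable lborel (\<lambda>z::complex. indicator (ball 0 r) z * f (norm z))"
    and "(LINT z|lborel. indicator (ball 0 r) z * f (norm (z::complex))) = F r - F 0"
proof -
  let ?g = "\<lambda>t. 2 * pi * t * f t"
  have hi: "(?g has_integral (F r - F 0)) {0..r}"
    using fundamental_theorem_of_calculus_interior_strong[OF S r _ F] deriv
    by (simp add: has_real_derivative_iff_has_vector_derivative)
  have ab: "?g absolutely_integrable_on {0..r}"
  proof (rule nonnegative_absolutely_integrable_1)
    show "?g integrable_on {0..r}" using hi by (rule has_integral_integrable)
    show "0 \<le> ?g t" if "t \<in> {0..r}" for t using nonneg[of t] that by (cases "t = 0") auto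
  qed
  have si: "set_integrable lborel {0..r} ?g"
    using ab unfolding set_integrable_def by (subst (asm) integrable_completion) auto
  have li: "(LINT t:{0..r}|lborel. ?g t) = F r - F 0"
    using set_borel_integral_eq_integral(2)[OF si] hi by (simp add: integral_unique)
  have [measurable]: "ball (0::complex) r \<in> sets borel" by simp
  have sp: "AE z in lborel. indicator (ball 0 r) z * f (norm z) = indicator {0..r} (norm z) * f (norm (z::complex))"
  proof -
    have "AE z in lborel. z \<notin> sphere (0::complex) r"
      using negligible_sphere[of 0 r] by (intro AE_not_in) (auto simp: negligible_iff_null_sets null_sets_completion_iff)
    then show ?thesis by eventually_elim (auto split: split_indicator)
  qed
  have eq: "indicator {0..} t * (2 * pi * t) * (indicator {0..r} t * f t) = indicator {0..r} t *\<^sub>R ?g t" for t :: real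
    by (auto split: split_indicator)
  have meas: "(\<lambda>t. indicator {0..r} t * f t) \<in> borel_measurable borel" by measurable
  have "integrable lborel (\<lambda>z::complex. indicator {0..r} (norm z) * f (norm z))"
    using integral_radial(2)[OF meas] si unfolding eq set_integrable_def by simp
  then show "integrable lborel (\<lambda>z::complex. indicator (ball 0 r) z * f (norm z))"
    by (rule integrable_cong_AE_imp) (use sp in \<open>auto intro!: borel_measurable_times\<close>)
  have "(LINT z|lborel. indicator (ball 0 r) z * f (norm (z::complex))) = (LINT z|lborel. indicator {0..r} (norm z) * f (norm (z::complex)))"
    using sp by (intro integral_cong_AE) auto
  also have "\<dots> = F r - F 0"
    using integral_radial(1)[OF meas] li unfolding eq set_lebesgue_integral_def by simp
  finally show "(LINT z|lborel. indicator (ball 0 r) z * f (norm (z::complex))) = F r - F 0" .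
qed

section \<open>Ball means\<close>

definition ball_mean :: "real \<Rightarrow> (complex \<Rightarrow> real) \<Rightarrow> complex \<Rightarrow> real" where
  "ball_mean r u x = (LINT z|lborel. indicator (ball 0 r) z * u (x + z)) / (pi * r\<^sup>2)"

definition mean_integrable :: "real \<Rightarrow> (complex \<Rightarrow> real) \<Rightarrow> complex \<Rightarrow> bool" where
  "mean_integrable r u x \<longleftrightarrow> integrable lborel (\<lambda>z. indicator (ball 0 r) z * u (x + z))"

lemma mean_integrable_cball:
  assumes "continuous_on (cball x r) u"
  shows "mean_integrable r u x"
proof -
  have "continuous_on (cball 0 r) (\<lambda>z. u (x + z))"
    by (rule continuous_on_compose2[OF assms]) (auto intro!: continuous_intros simp: dist_norm)
  then have "integrable lborel (\<lambda>z. indicator (cball 0 r) z *\<^sub>R u (x + z))"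
    by (intro borel_integrable_compact) auto
  then have "integrable lborel (\<lambda>z. indicator (ball 0 r) z *\<^sub>R (indicator (cball 0 r) z *\<^sub>R u (x + z)))"
    by (rule integrable_mult_indicator[rotated]) simp
  moreover have "indicator (ball 0 r) z *\<^sub>R (indicator (cball 0 r) z *\<^sub>R u (x + z)) = indicator (ball 0 r) z * u (x + z)" for z
    by (auto split: split_indicator)
  ultimately show ?thesis by (simp only: mean_integrable_def)
qed

lemma mean_integrable_cont: "continuous_on UNIV u \<Longrightarrow> mean_integrable r u x"
  by (rule mean_integrable_cball) (rule continuous_on_subset, auto)

lemma mean_integrable_const [simp]: "mean_integrable r (\<lambda>_. c) x"
  by (rule mean_integrable_cont) auto

lemma mean_integrable_add: "mean_integrable r u x \<Longrightarrow> mean_integrable r w x \<Longrightarrow> mean_integrable r (\<lambda>y. u y + w y) x"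
  unfolding mean_integrable_def by (simp add: distrib_left)

lemma mean_integrable_cmult: "mean_integrable r u x \<Longrightarrow> mean_integrable r (\<lambda>y. c * u y) x"
proof -
  assume "mean_integrable r u x"
  then have "integrable lborel (\<lambda>z. c * (indicator (ball 0 r) z * u (x + z)))"
    by (simp add: mean_integrable_def)
  moreover have "c * (indicator (ball 0 r) z * u (x + z)) = indicator (ball 0 r) z * (c * u (x + z))" for z
    by (rule mult.left_commute)
  ultimately show ?thesis by (simp only: mean_integrable_def)
qed

lemma mean_integrable_uminus: "mean_integrable r u x \<Longrightarrow> mean_integrable r (\<lambda>y. - u y) x"
  using mean_integrable_cmult[of r u x "-1"] by simp

lemma ball_mean_add: "mean_integrable r u x \<Longrightarrow> mean_integrable r w x \<Longrightarrow> ball_mean r (\<lambda>y. u y + w y) x = ball_mean r u x + ball_mean r w x"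
  unfolding mean_integrable_def ball_mean_def by (simp add: distrib_left add_divide_distrib)

lemma ball_mean_diff: "mean_integrable r u x \<Longrightarrow> mean_integrable r w x \<Longrightarrow> ball_mean r (\<lambda>y. u y - w y) x = ball_mean r u x - ball_mean r w x"
  unfolding mean_integrable_def ball_mean_def by (simp add: right_diff_distrib diff_divide_distrib)

lemma ball_mean_cmult: "ball_mean r (\<lambda>y. c * u y) x = c * ball_mean r u x"
  unfolding ball_mean_def by (simp add: mult.left_commute[of _ c])

lemma ball_mean_uminus: "ball_mean r (\<lambda>y. - u y) x = - ball_mean r u x"
  using ball_mean_cmult[of r "-1" u x] by simp

lemma ball_mean_sum: "(\<And>i. i \<in> I \<Longrightarrow> mean_integrable r (u i) x) \<Longrightarrow> ball_mean r (\<lambda>y. \<Sum>i\<in>I. u i y) x = (\<Sum>i\<in>I. ball_mean r (u i) x)"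
  unfolding mean_integrable_def ball_mean_def by (simp add: sum_distrib_left sum_divide_distrib)

lemma ball_mean_const: "0 < r \<Longrightarrow> ball_mean r (\<lambda>_. c) x = c"
  unfolding ball_mean_def by (simp add: measure_def emeasure_ball_complex)

lemma ball_mean_cong: "(\<And>y. y \<in> ball x r \<Longrightarrow> u y = w y) \<Longrightarrow> ball_mean r u x = ball_mean r w x"
  unfolding ball_mean_def
  by (intro arg_cong2[where f="(/)"] Bochner_Integration.integral_cong) (auto simp: dist_norm split: split_indicator)

lemma ball_mean_mono:
  assumes "mean_integrable r u x" "mean_integrable r w x" "\<And>y. y \<in> ball x r \<Longrightarrow> u y \<le> w y"
  shows "ball_mean r u x \<le> ball_mean r w x"
  using assms unfolding mean_integrable_def ball_mean_def
  by (intro divide_right_mono integral_mono) (auto simp: dist_norm split: split_indicator)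

lemma ball_mean_translate: "ball_mean r (\<lambda>y. u (a + y)) x = ball_mean r u (a + x)"
  by (simp add: ball_mean_def add.assoc)

text \<open>Rotation by \<open>c\<close> preserves the disc and the measure and turns the integral
  into its negative. With \<open>c ^ n = -1\<close> this annihilates the integral of
  \<open>z ^ n\<close> without any integration over the angle.\<close>

lemma integral_ball_antiperiodic:
  fixes g :: "complex \<Rightarrow> complex"
  assumes c: "norm c = 1" and [measurable]: "g \<in> borel_measurable borel" and g: "\<And>z. g (c * z) = - g z"
  shows "(LINT z|lborel. indicator (ball 0 r) z *\<^sub>R g z) = 0"
proof -
  let ?I = "LINT z|lborel. indicator (ball 0 r) z *\<^sub>R g z"
  have "?I = (LINT z|lborel. indicator (ball 0 r) (c * z) *\<^sub>R g (c * z))"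
    by (rule integral_lborel_rotate[symmetric, OF c])
      (intro borel_measurable_scaleR borel_measurable_indicator assms, auto)
  also have "\<dots> = (LINT z|lborel. - (indicator (ball 0 r) z *\<^sub>R g z))"
    using c by (intro Bochner_Integration.integral_cong) (auto simp: g norm_mult split: split_indicator)
  also have "\<dots> = - ?I" by simp
  finally have "?I + ?I = 0" by (simp only: eq_neg_iff_add_eq_0)
  then show ?thesis by (simp only: mult_2[symmetric]) simp
qed

lemma root_of_minus_one:
  assumes "0 < n"
  shows "\<exists>c. norm c = 1 \<and> c ^ n = (-1::complex)"
proof -
  have "cis (pi / real n) ^ n = cis pi" using assms by (subst Complex.DeMoivre) simp
  then show ?thesis by (intro exI[of _ "cis (pi / real n)"]) simp
qed

lemma integral_ball_power:
  assumes "0 < n"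
  shows "(LINT z|lborel. indicator (ball 0 r) z *\<^sub>R (z::complex) ^ n) = 0"
proof -
  obtain c :: complex where "norm c = 1" "c ^ n = -1" using root_of_minus_one[OF assms] by auto
  then show ?thesis by (intro integral_ball_antiperiodic[of c]) (auto simp: power_mult_distrib)
qed

lemma integrable_ball_poly: "integrable lborel (\<lambda>z. indicator (ball 0 r) z *\<^sub>R poly (p :: complex poly) z)"
proof -
  have "integrable lborel (\<lambda>z. indicator (cball 0 r) z *\<^sub>R poly p z)"
    by (intro borel_integrable_compact) (auto intro!: continuous_intros)
  then have "integrable lborel (\<lambda>z. indicator (ball 0 r) z *\<^sub>R (indicator (cball 0 r) z *\<^sub>R poly p z))"
    by (rule integrable_mult_indicator[rotated]) simp
  moreover have "indicator (ball 0 r) z *\<^sub>R (indicator (cball 0 r) z *\<^sub>R poly p z) = indicator (ball 0 r) z *\<^sub>R poly p z" for z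
    by (auto split: split_indicator)
  ultimately show ?thesis by (simp only:)
qed

lemma integral_ball_poly:
  assumes "0 \<le> r"
  shows "(LINT z|lborel. indicator (ball 0 r) z *\<^sub>R poly p z) = of_real (pi * r\<^sup>2) * poly (p :: complex poly) 0"
proof (induction p)
  case 0
  show ?case by simp
next
  case (pCons a p)
  have e: "indicator (ball 0 r) z *\<^sub>R poly (pCons 0 p) z = (\<Sum>i\<le>degree p. coeff p i * (indicator (ball 0 r) z *\<^sub>R z ^ Suc i))" for z
    by (simp add: poly_altdef[of p] sum_distrib_left scaleR_conv_of_real mult_ac)
  have int: "integrable lborel (\<lambda>z. indicator (ball 0 r) z *\<^sub>R (z::complex) ^ Suc i)" for i
    using integrable_ball_poly[of r "monom 1 (Suc i)"] by (simp add: poly_monom)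
  have "(LINT z|lborel. indicator (ball 0 r) z *\<^sub>R poly (pCons 0 p) z) = 0"
    unfolding e by (subst Bochner_Integration.integral_sum)
      (use int integral_ball_power[of "Suc _" r] in \<open>auto simp del: power_Suc mult_scaleR_right\<close>)
  moreover have "poly (pCons a p) z = a + poly (pCons 0 p) z" for z by simp
  moreover have "integrable lborel (\<lambda>z::complex. indicator (ball 0 r) z *\<^sub>R a)"
    using integrable_ball_poly[of r "[:a:]"] by simp
  ultimately show ?case
    using integrable_ball_poly[of r "pCons 0 p"] assms
    by (simp add: scaleR_add_right measure_def emeasure_ball_complex del: poly_pCons) (simp add: scaleR_conv_of_real)
qed

text \<open>After recentring the polynomial at \<open>x\<close> only its constant term survives.
  Real parts of complex polynomials are the explicit harmonic functions used to solve Dirichlet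
  problems approximately.\<close>

lemma ball_mean_Re_poly:
  assumes "0 < r"
  shows "ball_mean r (\<lambda>z. Re (poly p z)) x = Re (poly p x)"
proof -
  let ?q = "pcompose p [:x, 1:]"
  have q: "poly ?q z = poly p (x + z)" for z by (simp add: poly_pcompose)
  have "(LINT z|lborel. indicator (ball 0 r) z * Re (poly p (x + z))) = Re (LINT z|lborel. indicator (ball 0 r) z *\<^sub>R poly ?q z)"
    by (subst integral_Re[OF integrable_ball_poly, symmetric]) (simp add: q)
  also have "\<dots> = pi * r\<^sup>2 * Re (poly p x)"
    using assms by (subst integral_ball_poly) (auto simp: q simp flip: of_real_mult of_real_power)
  finally show ?thesis using assms by (simp add: ball_mean_def)
qed

lemma ball_mean_Re_poly_norm_sq:
  assumes "0 < r"
  shows "ball_mean r (\<lambda>z. Re (poly p z) + b * (norm (z - x))\<^sup>2) x = Re (poly p x) + b * r\<^sup>2 / 2"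
proof -
  have "(LINT z|lborel. indicator (ball 0 r) z * (norm (z::complex))\<^sup>2) = pi / 2 * r ^ 4 - pi / 2 * 0 ^ 4"
    by (rule radial_ball_nonneg(2)[where S="{}"])
       (use assms in \<open>auto intro!: derivative_eq_intros continuous_intros simp: power2_eq_square power3_eq_cube\<close>)
  then have "ball_mean r (\<lambda>z. (norm (z - x))\<^sup>2) x = r\<^sup>2 / 2"
    using assms by (simp add: ball_mean_def power2_eq_square power4_eq_xxxx)
  moreover have "ball_mean r (\<lambda>z. Re (poly p z) + b * (norm (z - x))\<^sup>2) x = ball_mean r (\<lambda>z. Re (poly p z)) x + ball_mean r (\<lambda>z. b * (norm (z - x))\<^sup>2) x"
    by (intro ball_mean_add mean_integrable_cont continuous_intros)
  ultimately show ?thesis by (simp add: ball_mean_cmult ball_mean_Re_poly[OF assms])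
qed

lemma ball_mean_norm_sq:
  assumes "0 < r"
  shows "ball_mean r (\<lambda>z. (norm (z - a))\<^sup>2) x = (norm (x - a))\<^sup>2 + r\<^sup>2 / 2"
proof -
  \<comment> \<open>The real part of \<open>?p\<close> is the affine Taylor part of
    \<open>(norm (z - a))\<^sup>2\<close> at \<open>x\<close>; what remains is exactly
    \<open>(norm (z - x))\<^sup>2\<close>.\<close>
  let ?p = "[:of_real ((norm (x - a))\<^sup>2) - 2 * cnj (x - a) * x, 2 * cnj (x - a):]"
  have "(norm (z - a))\<^sup>2 = Re (poly ?p z) + 1 * (norm (z - x))\<^sup>2" for z
    unfolding cmod_power2 by (simp add: power2_eq_square algebra_simps)
  then have "ball_mean r (\<lambda>z. (norm (z - a))\<^sup>2) x = ball_mean r (\<lambda>z. Re (poly ?p z) + 1 * (norm (z - x))\<^sup>2) x"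
    by (intro ball_mean_cong)
  also have "\<dots> = Re (poly ?p x) + 1 * r\<^sup>2 / 2" by (rule ball_mean_Re_poly_norm_sq[OF assms])
  finally show ?thesis by simp
qed

text \<open>The function \<open>(t - w)\<^sup>2\<close> with \<open>w = Re (e * (z - x))\<close>
  dominates the left integrand and equals it at \<open>x\<close>, and it is quadratic, so its disc
  mean is explicit. Multiplied by \<open>pi\<close>, the function has Laplacian
  \<open>2 * pi\<close> on a half plane and 0 beyond: it is the barrier that confines the
  support.\<close>

lemma ball_mean_halfplane_sq_le:
  assumes r: "0 < r" and e: "norm e = 1"
  shows "ball_mean r (\<lambda>z. (max 0 (s - Re (e * z)))\<^sup>2) x \<le> (max 0 (s - Re (e * x)))\<^sup>2 + r\<^sup>2 / 4"
proof -
  define t where "t = max 0 (s - Re (e * x))"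
  \<comment> \<open>The identity \<open>sq\<close> splits \<open>w\<^sup>2\<close> into a harmonic
    part, absorbed in \<open>?p\<close>, and half of \<open>(norm (z - x))\<^sup>2\<close>.\<close>
  let ?p = "pcompose [:of_real (t\<^sup>2), - 2 * of_real t * e, e\<^sup>2 / 2:] [:- x, 1:]"
  have p: "Re (poly ?p z) = t\<^sup>2 - 2 * t * Re (e * (z - x)) + Re ((e * (z - x))\<^sup>2) / 2" for z
    by (simp add: poly_pcompose power2_eq_square algebra_simps)
  have sq: "(Re u)\<^sup>2 = (Re (u\<^sup>2) + (norm u)\<^sup>2) / 2" for u :: complex
    by (simp add: cmod_power2 Re_power2)
  have "(max 0 (s - Re (e * z)))\<^sup>2 \<le> Re (poly ?p z) + 1 / 2 * (norm (z - x))\<^sup>2" for z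
  proof -
    define w where "w = Re (e * (z - x))"
    have "max 0 (s - Re (e * z)) \<le> \<bar>t - w\<bar>" unfolding t_def w_def by (auto simp: algebra_simps)
    then have "(max 0 (s - Re (e * z)))\<^sup>2 \<le> (t - w)\<^sup>2"
      using power_mono[of "max 0 (s - Re (e * z))" "\<bar>t - w\<bar>" 2] by (simp only: power2_abs)
    also have "\<dots> = t\<^sup>2 - 2 * t * w + w\<^sup>2" by (simp add: power2_eq_square algebra_simps)
    also have "w\<^sup>2 = (Re ((e * (z - x))\<^sup>2) + (norm (z - x))\<^sup>2) / 2"
      unfolding w_def sq by (simp add: norm_mult e)
    finally show ?thesis unfolding p w_def by (simp add: algebra_simps add_divide_distrib)
  qed
  then have "ball_mean r (\<lambda>z. (max 0 (s - Re (e * z)))\<^sup>2) x \<le> ball_mean r (\<lambda>z. Re (poly ?p z) + 1 / 2 * (norm (z - x))\<^sup>2) x"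
    by (intro ball_mean_mono mean_integrable_cont continuous_intros) auto
  also have "\<dots> = t\<^sup>2 + r\<^sup>2 / 4"
    by (subst ball_mean_Re_poly_norm_sq[OF r]) (simp only: p, simp)
  finally show ?thesis by (simp add: t_def)
qed

section \<open>Logarithmic potentials of bounded sets\<close>

text \<open>Both bounds are \<open>ln s \<le> s - 1\<close>, for \<open>s = t\<close> and
  \<open>s = 1 / t\<close>. The default values \<open>ln 0 = 0\<close> and \<open>1 / 0 = 0\<close>
  extend the estimate to 0, so the diagonal needs no separate case in later integrals.\<close>

lemma abs_ln_le: "0 \<le> t \<Longrightarrow> \<bar>ln t\<bar> \<le> 1 / t + (t::real)"
proof -
  assume t: "0 \<le> t"
  show ?thesis
  proof (cases "t = 0")
    case False
    then have t: "0 < t" using t by simp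
    have "ln t \<le> t - 1" using t by (rule ln_le_minus_one)
    moreover have "ln (1 / t) \<le> 1 / t - 1" using t by (intro ln_le_minus_one) auto
    ultimately show ?thesis using t by (auto simp: ln_div abs_if)
      (smt (verit) divide_pos_pos)
  qed auto
qed

text \<open>Antiderivatives of \<open>t * ln t\<close> contain this term, and the fundamental
  theorem is applied up to the endpoint 0.\<close>

lemma sq_ln_continuous: "continuous_on {0..r} (\<lambda>t::real. t\<^sup>2 * ln t)"
proof (rule continuous_at_imp_continuous_on, rule ballI)
  fix x :: real assume "x \<in> {0..r}"
  show "isCont (\<lambda>t::real. t\<^sup>2 * ln t) x"
  proof (cases "x = 0")
    case False
    then show ?thesis by (intro continuous_intros) auto
  next
    case True
    have "((\<lambda>t::real. t\<^sup>2 * ln t) \<longlongrightarrow> 0) (at 0)"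
    proof (rule Lim_null_comparison)
      have b: "norm (t\<^sup>2 * ln t) \<le> \<bar>t\<bar> + \<bar>t\<bar> ^ 3" for t :: real
      proof -
        have "\<bar>t\<bar>\<^sup>2 * \<bar>ln \<bar>t\<bar>\<bar> \<le> \<bar>t\<bar>\<^sup>2 * (1 / \<bar>t\<bar> + \<bar>t\<bar>)"
          by (intro mult_left_mono abs_ln_le) auto
        also have "\<dots> = \<bar>t\<bar> + \<bar>t\<bar> ^ 3" by (cases "t = 0") (auto simp: field_simps power2_eq_square power3_eq_cube)
        finally show ?thesis by (cases "0 \<le> t") (auto simp: abs_mult ln_minus)
      qed
      show "\<forall>\<^sub>F t in at 0. norm (t\<^sup>2 * ln t) \<le> \<bar>t\<bar> + \<bar>t\<bar> ^ 3" using b by simp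
      show "((\<lambda>t::real. \<bar>t\<bar> + \<bar>t\<bar> ^ 3) \<longlongrightarrow> 0) (at 0)"
        by (auto intro!: tendsto_eq_intros)
    qed
    then show ?thesis by (simp add: True isCont_def)
  qed
qed

lemma integrable_inverse_norm_ball:
  assumes "0 \<le> r"
  shows "integrable lborel (\<lambda>z::complex. indicator (ball 0 r) z * (1 / norm z))"
    and "(LINT z|lborel. indicator (ball 0 r) z * (1 / norm (z::complex))) = 2 * pi * r"
proof -
  have 1: "continuous_on {0..r} (\<lambda>t. 2 * pi * t)" by (intro continuous_intros)
  have 2: "((\<lambda>t. 2 * pi * t) has_real_derivative 2 * pi * t * (1 / t)) (at t)" if "t \<in> {0<..<r} - {}" for t
    using that by (auto intro!: derivative_eq_intros)
  show "integrable lborel (\<lambda>z::complex. indicator (ball 0 r) z * (1 / norm z))"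
    by (rule radial_ball_nonneg(1)[OF assms _ _ _ 1 2]) auto
  show "(LINT z|lborel. indicator (ball 0 r) z * (1 / norm (z::complex))) = 2 * pi * r"
    by (subst radial_ball_nonneg(2)[OF assms _ _ _ 1 2]) auto
qed

text \<open>Splitting the kernel at distance 1 from \<open>x\<close>, the near part is at most
  \<open>2 * pi\<close> and the far part at most the measure of \<open>H\<close>. The bound is
  uniform in \<open>x\<close>, which later makes logarithmic potentials Lipschitz.\<close>

lemma inverse_norm_bound:
  fixes H :: "complex set"
  assumes [measurable]: "H \<in> sets borel" and fin: "emeasure lborel H < \<infinity>"
  shows "integrable lborel (\<lambda>y. indicator H y * (1 / norm (x - y)))"
    and "(LINT y|lborel. indicator H y * (1 / norm (x - y))) \<le> 2 * pi + measure lborel H"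
proof -
  let ?k = "\<lambda>z::complex. indicator (ball 0 1) z * (1 / norm z)"
  have k: "integrable lborel ?k" "integral\<^sup>L lborel ?k = 2 * pi"
    using integrable_inverse_norm_ball[of 1] by auto
  have k': "integrable lborel (\<lambda>y. ?k (x - y))" by (rule integrable_lborel_reflect[OF k(1)])
  have i: "(LINT y|lborel. ?k (x - y)) = 2 * pi"
    unfolding k(2)[symmetric] by (rule integral_lborel_reflect) (use k(1) in auto)
  have H: "integrable lborel (indicator H :: complex \<Rightarrow> real)" using fin by (auto simp: less_top)
  have b: "indicator H y * (1 / norm (x - y)) \<le> ?k (x - y) + indicator H y" for y
    by (auto split: split_indicator simp: divide_simps)
  show int: "integrable lborel (\<lambda>y. indicator H y * (1 / norm (x - y)))"
  proof (rule Bochner_Integration.integrable_bound[OF Bochner_Integration.integrable_add[OF k' H]])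
    show "AE y in lborel. norm (indicator H y * (1 / norm (x - y))) \<le> norm (?k (x - y) + indicator H y)"
    proof (rule AE_I2)
      fix y
      have "0 \<le> ?k (x - y) + indicator H y" "0 \<le> indicator H y * (1 / norm (x - y))"
        by (auto split: split_indicator)
      then show "norm (indicator H y * (1 / norm (x - y))) \<le> norm (?k (x - y) + indicator H y)"
        using b[of y] by (simp only: real_norm_def abs_of_nonneg)
    qed
  qed measurable
  have "(LINT y|lborel. indicator H y * (1 / norm (x - y))) \<le> (LINT y|lborel. ?k (x - y) + indicator H y)"
    by (rule integral_mono[OF int _ b]) (use k' H in auto)
  also have "\<dots> = 2 * pi + measure lborel H"
    by (subst Bochner_Integration.integral_add[OF k' H]) (simp only: i, simp)
  finally show "(LINT y|lborel. indicator H y * (1 / norm (x - y))) \<le> 2 * pi + measure lborel H" .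
qed

lemma bounded_finite_measure: "bounded H \<Longrightarrow> H \<in> sets borel \<Longrightarrow> emeasure lborel (H :: complex set) < \<infinity>"
  using emeasure_bounded_finite by auto

lemma ln_bound:
  fixes H :: "complex set"
  assumes [measurable]: "H \<in> sets borel" and H: "H \<subseteq> ball 0 R"
  shows "integrable lborel (\<lambda>y. indicator H y * ln (norm (x - y)))"
    and "(LINT y|lborel. indicator H y * \<bar>ln (norm (x - y))\<bar>) \<le> 2 * pi + measure lborel H * (1 + norm x + R)"
proof -
  have fin: "emeasure lborel H < \<infinity>" using H by (intro bounded_finite_measure) (auto intro: bounded_subset)
  then have iH: "integrable lborel (indicator H :: complex \<Rightarrow> real)" by (auto simp: less_top)
  let ?b = "\<lambda>y. indicator H y * (1 / norm (x - y)) + indicator H y * (norm x + R)"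
  have ib: "integrable lborel ?b"
    by (intro Bochner_Integration.integrable_add inverse_norm_bound(1)[OF _ fin] integrable_mult_left iH) auto
  have le: "indicator H y * \<bar>ln (norm (x - y))\<bar> \<le> ?b y" for y
  proof (cases "y \<in> H")
    case True
    have "norm (x - y) \<le> norm x + R" using norm_triangle_ineq4[of x y] H True by (force simp: dist_norm)
    then show ?thesis using abs_ln_le[of "norm (x - y)"] True by simp
  qed auto
  show i: "integrable lborel (\<lambda>y. indicator H y * ln (norm (x - y)))"
  proof (rule Bochner_Integration.integrable_bound[OF ib])
    show "AE y in lborel. norm (indicator H y * ln (norm (x - y))) \<le> norm (?b y)"
    proof (rule AE_I2)
      fix y
      have "norm (indicator H y * ln (norm (x - y))) = indicator H y * \<bar>ln (norm (x - y))\<bar>"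
        by (simp add: abs_mult)
      also have "\<dots> \<le> ?b y" by (rule le)
      also have "\<dots> \<le> norm (?b y)" by simp
      finally show "norm (indicator H y * ln (norm (x - y))) \<le> norm (?b y)" .
    qed
  qed measurable
  have i': "integrable lborel (\<lambda>y. indicator H y * \<bar>ln (norm (x - y))\<bar>)"
    using integrable_abs[OF i] by (simp add: abs_mult)
  have "(LINT y|lborel. indicator H y * \<bar>ln (norm (x - y))\<bar>) \<le> integral\<^sup>L lborel ?b"
    by (rule integral_mono[OF i' ib le])
  also have "\<dots> = (LINT y|lborel. indicator H y * (1 / norm (x - y))) + measure lborel H * (norm x + R)"
    by (subst Bochner_Integration.integral_add) (use inverse_norm_bound(1)[OF _ fin] iH in auto)
  also have "\<dots> \<le> (2 * pi + measure lborel H) + measure lborel H * (norm x + R)"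
    by (intro add_right_mono inverse_norm_bound(2) fin) auto
  finally show "(LINT y|lborel. indicator H y * \<bar>ln (norm (x - y))\<bar>) \<le> 2 * pi + measure lborel H * (1 + norm x + R)"
    by (simp add: algebra_simps)
qed

section \<open>Newton's theorem: disc means of the logarithm\<close>

lemma mean_integrable_ln: "mean_integrable r (\<lambda>z. ln (norm z)) x"
  using ln_bound(1)[of "ball 0 r" r "- x"]
  by (simp add: mean_integrable_def norm_minus_commute[of "- x"] add.commute)

text \<open>Closed form of the mean of the logarithm over the disc of radius \<open>r\<close> about
  \<open>y\<close> (\<open>ball_mean_ln\<close>); equally the potential of a unit charge spread
  evenly over the disc of radius \<open>r\<close> about 0 (\<open>ln_mean_log_pot\<close>).\<close>

definition ln_mean :: "real \<Rightarrow> complex \<Rightarrow> real" where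
  "ln_mean r y = (if r \<le> norm y then ln (norm y) else ln r - (1 - (norm y)\<^sup>2 / r\<^sup>2) / 2)"

lemma integral_ball_ln_max:
  assumes "0 \<le> \<rho>" "\<rho> < r"
  shows "integrable lborel (\<lambda>z::complex. indicator (ball 0 r) z * (ln r - ln (max (norm z) \<rho>)))"
    and "(LINT z|lborel. indicator (ball 0 r) z * (ln r - ln (max (norm (z::complex)) \<rho>))) = pi * (r\<^sup>2 - \<rho>\<^sup>2) / 2"
proof -
  \<comment> \<open>For \<open>t > \<rho>\<close> this is an antiderivative of
    \<open>2 * pi * t * (ln r - ln t)\<close>; the terms with \<open>max t \<rho>\<close> continue
    it to \<open>pi * t\<^sup>2 * (ln r - ln \<rho>)\<close> below the kink. Subtracting from
    \<open>ln r\<close> keeps the integrand nonnegative.\<close>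
  define F where "F t = pi * t\<^sup>2 * (ln r - ln (max t \<rho>)) + pi * (max t \<rho>)\<^sup>2 / 2 - pi * \<rho>\<^sup>2 / 2" for t
  have r: "0 \<le> r" using assms by simp
  have nn: "0 \<le> ln r - ln (max t \<rho>)" if "0 < t" "t \<le> r" for t using that assms by auto
  have c: "continuous_on {0..r} F"
  proof (cases "\<rho> = 0")
    case True
    have "continuous_on {0..r} (\<lambda>t. pi * t\<^sup>2 * ln r - pi * (t\<^sup>2 * ln t) + pi * t\<^sup>2 / 2)"
      by (intro continuous_intros sq_ln_continuous) auto
    then show ?thesis by (rule continuous_on_eq) (auto simp: F_def True algebra_simps max_def)
  next
    case False
    then show ?thesis unfolding F_def using assms by (intro continuous_intros) (auto simp: max_def)
  qed
  have d: "(F has_real_derivative 2 * pi * t * (ln r - ln (max t \<rho>))) (at t)" if "t \<in> {0<..<r} - {\<rho>}" for t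
  proof (cases "t < \<rho>")
    case True
    have "((\<lambda>t. pi * t\<^sup>2 * (ln r - ln \<rho>)) has_real_derivative 2 * pi * t * (ln r - ln (max t \<rho>))) (at t)"
      using True by (auto intro!: derivative_eq_intros simp: max_def)
    then show ?thesis
      by (rule has_field_derivative_transform_within_open[of _ _ _ "{..<\<rho>}"]) (use True in \<open>auto simp: F_def max_def\<close>)
  next
    case False
    then have t: "\<rho> < t" "0 < t" using that by auto
    have "((\<lambda>t. pi * t\<^sup>2 * (ln r - ln t) + pi * t\<^sup>2 / 2 - pi * \<rho>\<^sup>2 / 2) has_real_derivative 2 * pi * t * (ln r - ln (max t \<rho>))) (at t)"
      using t by (auto intro!: derivative_eq_intros simp: max_def field_simps power2_eq_square)
    then show ?thesis
      by (rule has_field_derivative_transform_within_open[of _ _ _ "{\<rho><..}"]) (use t in \<open>auto simp: F_def max_def\<close>)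
  qed
  show "integrable lborel (\<lambda>z::complex. indicator (ball 0 r) z * (ln r - ln (max (norm z) \<rho>)))"
    by (rule radial_ball_nonneg(1)[where S="{\<rho>}" and F=F and f="\<lambda>t. ln r - ln (max t \<rho>)", OF r _ nn]) (use c d in auto)
  have "F r - F 0 = pi * (r\<^sup>2 - \<rho>\<^sup>2) / 2" using assms by (simp add: F_def max_def algebra_simps diff_divide_distrib)
  then show "(LINT z|lborel. indicator (ball 0 r) z * (ln r - ln (max (norm (z::complex)) \<rho>))) = pi * (r\<^sup>2 - \<rho>\<^sup>2) / 2"
    using radial_ball_nonneg(2)[where S="{\<rho>}" and F=F and f="\<lambda>t. ln r - ln (max t \<rho>)", OF r _ nn] c d by simp
qed

text \<open>Writing \<open>ln |y + z| = ln (max |y| |z|) + ln |1 + w|\<close> with \<open>w = z / y\<close> or \<open>w = y / z\<close>,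
  \<open>|w| \<le> 1\<close>, the second term integrates to zero over discs: this follows termwise from the
  power series of \<open>Ln (1 + s w)\<close> for \<open>s < 1\<close>, since rotations annihilate the integrals of \<open>w ^ n\<close>.\<close>
definition lratio :: "complex \<Rightarrow> complex \<Rightarrow> complex" where
  "lratio y z = (if norm z < norm y then z / y else y / z)"

lemma lratio_measurable [measurable]: "lratio y \<in> borel_measurable borel"
  unfolding lratio_def[abs_def] by measurable

lemma norm_lratio_le: "norm (lratio y z) \<le> 1"
  by (auto simp: lratio_def norm_divide divide_simps)

lemma ln_norm_add_lratio:
  assumes "y + z \<noteq> 0" "z \<noteq> 0"
  shows "1 + lratio y z \<noteq> 0" and "ln (norm (y + z)) = ln (max (norm z) (norm y)) + ln (norm (1 + lratio y z))"
proof -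
  have "y + z = (if norm z < norm y then y else z) * (1 + lratio y z)"
    using assms by (auto simp: lratio_def field_simps)
  then have n: "norm (y + z) = max (norm z) (norm y) * norm (1 + lratio y z)"
    by (auto simp: norm_mult max_def)
  show "1 + lratio y z \<noteq> 0" using n assms by auto
  then show "ln (norm (y + z)) = ln (max (norm z) (norm y)) + ln (norm (1 + lratio y z))"
    unfolding n using assms by (subst ln_mult) (auto simp: max_def)
qed

lemma integral_ball_lratio_power:
  assumes "0 < n"
  shows "(LINT z|lborel. indicator (ball 0 r) z *\<^sub>R (lratio y z) ^ n) = 0"
proof -
  obtain c :: complex where c: "norm c = 1" "c ^ n = -1" using root_of_minus_one[OF assms] by auto
  have "(lratio y (c * z)) ^ n = - ((lratio y z) ^ n)" for z
    using c by (auto simp: lratio_def norm_mult power_mult_distrib power_divide)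
  then show ?thesis by (intro integral_ball_antiperiodic[OF c(1)]) auto
qed

lemma integral_ball_lratio_abel:
  assumes "0 < s" "s < 1" "0 \<le> r"
  shows "(LINT z|lborel. indicator (ball 0 r) z * ln (norm (1 + of_real s * lratio y z))) = 0"
proof -
  \<comment> \<open>These are the terms of the series of \<open>Ln (1 + s w)\<close>; division by
    zero makes the term \<open>n = 0\<close> vanish, so the sum may start there.\<close>
  define f where "f n z = indicator (ball 0 r) z *\<^sub>R (- ((of_real (- s) * lratio y z) ^ n) / of_nat n)" for n z
  have [measurable]: "ball (0::complex) r \<in> sets borel" by simp
  have ib: "integrable lborel (indicator (ball (0::complex) r) :: complex \<Rightarrow> real)"
    using assms by (simp add: emeasure_ball_complex)
  have nf: "norm (f n z) \<le> s ^ n * indicator (ball 0 r) z" for n z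
  proof -
    have "norm ((of_real (- s) * lratio y z) ^ n / of_nat n) \<le> s ^ n"
    proof (cases "n = 0")
      case False
      have "norm (of_real (- s) * lratio y z) \<le> s"
        using norm_lratio_le[of y z] assms by (simp add: norm_mult mult_left_le)
      then have "norm (of_real (- s) * lratio y z) ^ n \<le> s ^ n" by (intro power_mono) auto
      moreover have "a / real n \<le> a" if "0 \<le> a" for a
        using divide_left_mono[of 1 "real n" a] False that by simp
      ultimately show ?thesis unfolding norm_divide norm_power norm_of_nat
        by (meson norm_ge_zero order_trans zero_le_power)
    qed (use assms in auto)
    then show ?thesis by (auto simp: f_def norm_minus_cancel split: split_indicator)
  qed
  have fi: "integrable lborel (f n)" for n
  proof (rule Bochner_Integration.integrable_bound[OF integrable_mult_right[of "s ^ n", OF ib]])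
    show "f n \<in> borel_measurable lborel" unfolding f_def[abs_def] by measurable
    show "AE z in lborel. norm (f n z) \<le> norm (s ^ n * indicator (ball 0 r) z)"
      using nf[of n] assms by (intro AE_I2) (auto split: split_indicator)
  qed
  have gs: "summable (\<lambda>n. s ^ n * c)" for c using assms by (intro summable_mult2 summable_geometric) auto
  have sm1: "AE z in lborel. summable (\<lambda>n. norm (f n z))"
    by (intro AE_I2 summable_comparison_test'[OF gs]) (use nf in auto)
  have sm2: "summable (\<lambda>n. LINT z|lborel. norm (f n z))"
  proof (rule summable_comparison_test'[OF gs])
    fix n :: nat
    have "(LINT z|lborel. norm (f n z)) \<le> (LINT z|lborel. s ^ n * indicator (ball 0 r) (z::complex))"
    proof (rule integral_mono)
      show "integrable lborel (\<lambda>z. norm (f n z))" by (rule integrable_norm[OF fi])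
      show "integrable lborel (\<lambda>z. s ^ n * indicator (ball 0 r) (z::complex))" by (rule integrable_mult_right[OF ib])
      show "\<And>z. norm (f n z) \<le> s ^ n * indicator (ball 0 r) z" by (rule nf)
    qed
    then show "norm (LINT z|lborel. norm (f n z)) \<le> s ^ n * (LINT z|lborel. indicator (ball 0 r) (z::complex))"
      by (simp add: integral_nonneg_AE)
  qed
  have "(\<lambda>n. integral\<^sup>L lborel (f n)) sums (LINT z|lborel. (\<Sum>n. f n z))"
    by (rule sums_integral[OF fi sm1 sm2])
  moreover have "integral\<^sup>L lborel (f n) = 0" for n
  proof (cases "n = 0")
    case True then show ?thesis by (simp add: f_def[abs_def])
  next
    case False
    have "f n z = - ((- of_real s) ^ n / of_nat n) * (indicator (ball 0 r) z *\<^sub>R (lratio y z) ^ n)" for z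
    proof -
      have "(of_real (- s) * lratio y z) ^ n = (- of_real s) ^ n * lratio y z ^ n"
        by (simp only: of_real_minus power_mult_distrib)
      then show ?thesis unfolding f_def by simp
    qed
    then have "f n = (\<lambda>z. - ((- of_real s) ^ n / of_nat n) * (indicator (ball 0 r) z *\<^sub>R (lratio y z) ^ n))"
      by (rule ext)
    then have "integral\<^sup>L lborel (f n) = - ((- of_real s) ^ n / of_nat n) * (LINT z|lborel. indicator (ball 0 r) z *\<^sub>R (lratio y z) ^ n)"
      by (simp only: Bochner_Integration.integral_mult_right_zero)
    then show ?thesis using False by (simp only: integral_ball_lratio_power) simp
  qed
  ultimately have "(LINT z|lborel. (\<Sum>n. f n z)) = 0" by (simp add: sums_iff)
  moreover have sf: "(\<Sum>n. f n z) = indicator (ball 0 r) z *\<^sub>R Ln (1 + of_real s * lratio y z)" for z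
  proof -
    have "norm (of_real s * lratio y z) = s * norm (lratio y z)" using assms by (simp add: norm_mult)
    also have "\<dots> \<le> s * 1" using assms by (intro mult_left_mono norm_lratio_le) auto
    finally have "norm (of_real s * lratio y z) < 1" using assms by simp
    from Ln_series'[OF this]
    have "(\<lambda>n. indicator (ball 0 r) z *\<^sub>R (- ((- (of_real s * lratio y z)) ^ n) / of_nat n)) sums (indicator (ball 0 r) z *\<^sub>R Ln (1 + of_real s * lratio y z))"
      by (rule sums_scaleR_right)
    then show ?thesis by (simp add: f_def sums_iff)
  qed
  have "integrable lborel (\<lambda>z. \<Sum>n. f n z)"
    by (rule integrable_suminf[OF fi sm1 sm2])
  then have "(LINT z|lborel. Re (\<Sum>n. f n z)) = Re (LINT z|lborel. (\<Sum>n. f n z))"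
    by (rule integral_Re)
  moreover have "Re (\<Sum>n. f n z) = indicator (ball 0 r) z * ln (norm (1 + of_real s * lratio y z))" for z
  proof -
    have "norm (of_real s * lratio y z) = s * norm (lratio y z)" using assms by (simp add: norm_mult)
    also have "\<dots> \<le> s * 1" using assms by (intro mult_left_mono norm_lratio_le) auto
    finally have "norm (of_real s * lratio y z) < 1" using assms by simp
    moreover have "norm u = 1" if "1 + u = 0" for u :: complex
      using that by (simp only: add_eq_0_iff norm_minus_cancel norm_one)
    ultimately have "1 + of_real s * lratio y z \<noteq> 0" by force
    then show ?thesis unfolding sf by simp
  qed
  ultimately show ?thesis by simp
qed

lemma AE_neq_complex: "AE z in lborel. z \<noteq> (c::complex)"
  by (rule AE_lborel_singleton)

text \<open>This is the limit \<open>s -> 1\<close>. The danger is the zero of \<open>1 + w\<close>,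
  and it is met by \<open>norm (1 + w) \<le> 2 * norm (1 + s * w)\<close> for
  \<open>norm w \<le> 1\<close>: the logarithms for \<open>s < 1\<close> are dominated by the one
  for \<open>s = 1\<close> up to \<open>ln 2\<close>.\<close>

lemma integral_ball_ln_lratio:
  assumes "0 < r"
  shows "integrable lborel (\<lambda>z. indicator (ball 0 r) z * ln (norm (1 + lratio y z)))"
    and "(LINT z|lborel. indicator (ball 0 r) z * ln (norm (1 + lratio y z))) = 0"
proof -
  have [measurable]: "ball (0::complex) r \<in> sets borel" by simp
  have ib: "integrable lborel (indicator (ball (0::complex) r) :: complex \<Rightarrow> real)"
    using assms by (simp add: emeasure_ball_complex)
  have nz: "AE z in lborel. y + z \<noteq> 0 \<and> z \<noteq> 0"
    using AE_neq_complex[of "- y"] AE_neq_complex[of 0] by eventually_elim (auto simp: add_eq_0_iff)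
  have "integrable lborel (\<lambda>z::complex. indicator (ball 0 r) z * ln (max (norm z) (norm y)))"
  proof (rule Bochner_Integration.integrable_bound)
    show "integrable lborel (\<lambda>z::complex. indicator (ball 0 r) z * (1 / norm z) + indicator (ball 0 r) z * (\<bar>ln (norm y)\<bar> + r))"
      by (intro Bochner_Integration.integrable_add integrable_inverse_norm_ball(1) integrable_mult_left ib) (use assms in auto)
    show "AE z::complex in lborel. norm (indicator (ball 0 r) z * ln (max (norm z) (norm y))) \<le>
        norm (indicator (ball 0 r) z * (1 / norm z) + indicator (ball 0 r) z * (\<bar>ln (norm y)\<bar> + r))"
    proof (rule AE_I2)
      fix z :: complex
      have "0 \<le> 1 / norm z" by simp
      then show "norm (indicator (ball 0 r) z * ln (max (norm z) (norm y))) \<le>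
        norm (indicator (ball 0 r) z * (1 / norm z) + indicator (ball 0 r) z * (\<bar>ln (norm y)\<bar> + r))"
        using abs_ln_le[of "norm z"] by (auto simp: max_def split: split_indicator)
    qed
  qed measurable
  moreover have "integrable lborel (\<lambda>z. indicator (ball 0 r) z * ln (norm (y + z)))"
    using mean_integrable_ln[of r y] by (simp add: mean_integrable_def)
  ultimately have "integrable lborel (\<lambda>z. indicator (ball 0 r) z * ln (norm (y + z)) - indicator (ball 0 r) z * ln (max (norm z) (norm y)))"
    by (rule Bochner_Integration.integrable_diff[rotated])
  then show int: "integrable lborel (\<lambda>z. indicator (ball 0 r) z * ln (norm (1 + lratio y z)))"
  proof (rule integrable_cong_AE_imp)
    show "AE z in lborel. indicator (ball 0 r) z * ln (norm (y + z)) - indicator (ball 0 r) z * ln (max (norm z) (norm y))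
      = indicator (ball 0 r) z * ln (norm (1 + lratio y z))"
      using nz by eventually_elim (auto simp: ln_norm_add_lratio(2) distrib_left)
  qed measurable
  define s where "s k = 1 - 1 / real (k + 2)" for k
  have s: "0 < s k" "s k < 1" for k by (auto simp: s_def field_simps)
  have "s \<longlonglongrightarrow> 1 - 0" unfolding s_def
    by (intro tendsto_diff tendsto_const filterlim_compose[OF LIMSEQ_inverse_real_of_nat] LIMSEQ_ignore_initial_segment[OF lim_1_over_n[where 'a=real]])
  then have s1: "s \<longlonglongrightarrow> 1" by simp
  have "(\<lambda>k. LINT z|lborel. indicator (ball 0 r) z * ln (norm (1 + of_real (s k) * lratio y z)))
     \<longlonglongrightarrow> (LINT z|lborel. indicator (ball 0 r) z * ln (norm (1 + lratio y z)))"
  proof (rule integral_dominated_convergence)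
    show "integrable lborel (\<lambda>z. indicator (ball 0 r) z * ln 2 + \<bar>indicator (ball 0 r) z * ln (norm (1 + lratio y z))\<bar>)"
      by (intro Bochner_Integration.integrable_add integrable_abs int integrable_mult_left ib)
    show "AE z in lborel. (\<lambda>k. indicator (ball 0 r) z * ln (norm (1 + of_real (s k) * lratio y z)))
        \<longlonglongrightarrow> indicator (ball 0 r) z * ln (norm (1 + lratio y z))"
      using nz
    proof eventually_elim
      case (elim z)
      then have "1 + lratio y z \<noteq> 0" using ln_norm_add_lratio(1) by blast
      then have "(\<lambda>k. indicator (ball 0 r) z * ln (norm (1 + of_real (s k) * lratio y z)))
        \<longlonglongrightarrow> indicator (ball 0 r) z * ln (norm (1 + of_real 1 * lratio y z))"
        by (intro tendsto_intros s1) auto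
      then show ?case by simp
    qed
    show "AE z in lborel. norm (indicator (ball 0 r) z * ln (norm (1 + of_real (s k) * lratio y z))) \<le>
        indicator (ball 0 r) z * ln 2 + \<bar>indicator (ball 0 r) z * ln (norm (1 + lratio y z))\<bar>" for k
      using nz
    proof eventually_elim
      case (elim z)
      define w where "w = lratio y z"
      have w: "1 + w \<noteq> 0" "norm w \<le> 1" using elim ln_norm_add_lratio(1) norm_lratio_le by (auto simp: w_def)
      have sw: "norm (of_real (s k) * w) \<le> s k"
        using mult_left_mono[OF w(2), of "s k"] s[of k] by (simp add: norm_mult)
      have lo: "1 - s k \<le> norm (1 + of_real (s k) * w)"
        using norm_triangle_ineq4[of "1 + of_real (s k) * w" "of_real (s k) * w"] sw by simp
      have "1 + w = (1 + of_real (s k) * w) + of_real (1 - s k) * w" by (simp add: algebra_simps)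
      then have "norm (1 + w) \<le> norm (1 + of_real (s k) * w) + norm (of_real (1 - s k) * w)"
        by (metis norm_triangle_ineq)
      also have "norm (of_real (1 - s k) * w) \<le> 1 - s k"
        using mult_left_mono[OF w(2), of "1 - s k"] s[of k] by (simp add: norm_mult del: of_real_diff)
      finally have h: "norm (1 + w) \<le> 2 * norm (1 + of_real (s k) * w)" using lo by simp
      have pos: "0 < norm (1 + of_real (s k) * w)" using lo s[of k] by linarith
      have "ln (norm (1 + w)) \<le> ln (2 * norm (1 + of_real (s k) * w))"
        using h w(1) pos by (intro ln_mono) auto
      also have "\<dots> = ln 2 + ln (norm (1 + of_real (s k) * w))" using pos by (simp add: ln_mult)
      finally have 1: "- ln (norm (1 + of_real (s k) * w)) \<le> ln 2 + \<bar>ln (norm (1 + w))\<bar>" by linarith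
      have "norm (1 + of_real (s k) * w) \<le> 2"
        using norm_triangle_ineq[of 1 "of_real (s k) * w"] sw s[of k] by simp
      then have "ln (norm (1 + of_real (s k) * w)) \<le> ln 2" using pos by (intro ln_mono) auto
      then have 2: "\<bar>ln (norm (1 + of_real (s k) * w))\<bar> \<le> ln 2 + \<bar>ln (norm (1 + w))\<bar>" using 1 by linarith
      show ?case using 2 by (simp add: w_def split: split_indicator)
    qed
  qed measurable
  moreover have "(\<lambda>k. LINT z|lborel. indicator (ball 0 r) z * ln (norm (1 + of_real (s k) * lratio y z))) = (\<lambda>k. 0)"
    using integral_ball_lratio_abel[OF s] assms by simp
  ultimately show "(LINT z|lborel. indicator (ball 0 r) z * ln (norm (1 + lratio y z))) = 0"
    by (simp add: LIMSEQ_const_iff)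
qed

text \<open>In the factorization through \<open>lratio\<close> only the radial term
  \<open>ln (max (norm z) (norm y))\<close> contributes to the integral.\<close>

lemma ball_mean_ln:
  assumes r: "0 < r"
  shows "ball_mean r (\<lambda>z. ln (norm z)) y = ln_mean r y"
proof -
  have [measurable]: "ball (0::complex) r \<in> sets borel" by simp
  have mb: "measure lborel (ball (0::complex) r) = pi * r\<^sup>2"
    using r by (simp add: measure_def emeasure_ball_complex)
  have ib: "integrable lborel (indicator (ball (0::complex) r) :: complex \<Rightarrow> real)"
    using assms by (simp add: emeasure_ball_complex)
  have nz: "AE z in lborel. y + z \<noteq> 0 \<and> z \<noteq> 0"
    using AE_neq_complex[of "- y"] AE_neq_complex[of 0] by eventually_elim (auto simp: add_eq_0_iff)
  define M where "M z = indicator (ball 0 r) z * ln (max (norm z) (norm y))" for z :: complex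
  have M: "integrable lborel M \<and> integral\<^sup>L lborel M = pi * r\<^sup>2 * ln_mean r y"
  proof (cases "r \<le> norm y")
    case True
    then have "M = (\<lambda>z. indicator (ball 0 r) z * ln (norm y))"
      by (auto simp: M_def max_def fun_eq_iff split: split_indicator)
    then show ?thesis using True ib mb by (simp add: ln_mean_def)
  next
    case False
    let ?N = "\<lambda>z::complex. indicator (ball 0 r) z * (ln r - ln (max (norm z) (norm y)))"
    have N: "integrable lborel ?N" "integral\<^sup>L lborel ?N = pi * (r\<^sup>2 - (norm y)\<^sup>2) / 2"
      using integral_ball_ln_max[of "norm y" r] False by auto
    have e: "M = (\<lambda>z. indicator (ball 0 r) z * ln r - ?N z)" by (auto simp: M_def fun_eq_iff algebra_simps)
    have "integrable lborel M" unfolding e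
      by (intro Bochner_Integration.integrable_diff N integrable_mult_left ib)
    moreover have "integral\<^sup>L lborel M = pi * r\<^sup>2 * ln r - pi * (r\<^sup>2 - (norm y)\<^sup>2) / 2"
      unfolding e by (subst Bochner_Integration.integral_diff[OF integrable_mult_left[OF ib] N(1)]) (simp only: N, simp add: mb)
    moreover have "pi * r\<^sup>2 * ln_mean r y = pi * r\<^sup>2 * ln r - pi * (r\<^sup>2 - (norm y)\<^sup>2) / 2"
      using False r by (simp add: ln_mean_def algebra_simps diff_divide_distrib)
    ultimately show ?thesis by simp
  qed
  have "(LINT z|lborel. indicator (ball 0 r) z * ln (norm (y + z))) =
      (LINT z|lborel. M z + indicator (ball 0 r) z * ln (norm (1 + lratio y z)))"
  proof (rule integral_cong_AE)
    show "AE z in lborel. indicator (ball 0 r) z * ln (norm (y + z)) = M z + indicator (ball 0 r) z * ln (norm (1 + lratio y z))"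
      using nz by eventually_elim (auto simp: ln_norm_add_lratio(2) distrib_left M_def)
  qed (use M in \<open>auto simp: M_def\<close>)
  also have "\<dots> = pi * r\<^sup>2 * ln_mean r y"
    using M integral_ball_ln_lratio[OF r, of y] by simp
  finally show ?thesis using r by (simp add: ball_mean_def)
qed

text \<open>The excess of the disc mean of the logarithm over its value. It vanishes off the disc of
  radius \<open>r\<close>, is nonnegative away from 0, and has total integral
  \<open>pi * r\<^sup>2 / 4\<close>, which is where the constant \<open>pi / 4\<close> in all later
  mean value inequalities comes from. Its value at 0 depends on the default \<open>ln 0\<close>,
  hence the estimates almost everywhere.\<close>

definition ln_defect :: "real \<Rightarrow> complex \<Rightarrow> real" where
  "ln_defect r y = ln_mean r y - ln (norm y)"

lemma ln_mean_measurable [measurable]: "ln_mean r \<in> borel_measurable borel"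
  unfolding ln_mean_def[abs_def] by measurable

lemma ln_defect_measurable [measurable]: "ln_defect r \<in> borel_measurable borel"
  unfolding ln_defect_def[abs_def] by measurable

lemma ln_defect_outside: "r \<le> norm y \<Longrightarrow> ln_defect r y = 0"
  by (simp add: ln_defect_def ln_mean_def)

text \<open>With \<open>s = (norm y / r)\<^sup>2\<close> the defect is
  \<open>(s - 1 - ln s) / 2\<close>. For \<open>pi * r\<^sup>2 = 1\<close> this is the potential of
  one neutralized nucleus, so strictness matters.\<close>

lemma ln_defect_pos:
  assumes "y \<noteq> 0" "norm y < r"
  shows "0 < ln_defect r y"
proof -
  define s where "s = (norm y / r)\<^sup>2"
  have r: "0 < r" using assms by (smt (verit) norm_ge_zero)
  have t: "0 < norm y / r" "norm y / r < 1" using assms r by auto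
  have s: "0 < s" "s < 1" using t by (auto simp: s_def power_less_one_iff)
  have "ln s < s - 1"
    using ln_le_minus_one[OF s(1)] ln_eq_minus_one[OF s(1)] s(2) by fastforce
  moreover have "ln s = 2 * (ln (norm y) - ln r)"
    unfolding s_def using r assms by (simp add: ln_realpow ln_div)
  ultimately show ?thesis
    using assms by (simp add: ln_defect_def ln_mean_def s_def power_divide) argo
qed

lemma ln_defect_nonneg: "y \<noteq> 0 \<Longrightarrow> 0 \<le> ln_defect r y"
  using ln_defect_pos[of y r] ln_defect_outside[of r y] by (cases "norm y < r") auto

lemma ln_defect_integral:
  assumes r: "0 < r"
  shows "integrable lborel (ln_defect r)" and "integral\<^sup>L lborel (ln_defect r) = pi * r\<^sup>2 / 4"
proof -
  define f where "f t = ln r - (1 - t\<^sup>2 / r\<^sup>2) / 2 - ln t" for t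
  define F where "F t = pi * t\<^sup>2 * ln r + pi * t ^ 4 / (4 * r\<^sup>2) - pi * (t\<^sup>2 * ln t)" for t
  have q: "ln_defect r = (\<lambda>z. indicator (ball 0 r) z * f (norm z))"
    by (auto simp: fun_eq_iff ln_defect_def ln_mean_def f_def split: split_indicator)
  have nn: "0 \<le> f t" if "0 < t" "t \<le> r" for t
  proof (cases "t = r")
    case False
    then show ?thesis using ln_defect_pos[of "of_real t" r] that by (simp add: ln_defect_def ln_mean_def f_def)
  qed (use that in \<open>simp add: f_def\<close>)
  have c: "continuous_on {0..r} F"
    unfolding F_def by (intro continuous_intros sq_ln_continuous) (use r in auto)
  have d: "(F has_real_derivative 2 * pi * t * f t) (at t)" if "t \<in> {0<..<r} - {}" for t
    unfolding F_def f_def using that r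
    by (auto intro!: derivative_eq_intros simp: field_simps power2_eq_square power3_eq_cube power4_eq_xxxx)
  have [measurable]: "f \<in> borel_measurable borel" unfolding f_def by measurable
  show "integrable lborel (ln_defect r)" unfolding q
    by (rule radial_ball_nonneg(1)[where f=f and F=F and S="{}"]) (use r nn c d in auto)
  have "integral\<^sup>L lborel (ln_defect r) = F r - F 0" unfolding q
    by (rule radial_ball_nonneg(2)[where f=f and F=F and S="{}"]) (use r nn c d in auto)
  also have "\<dots> = pi * r\<^sup>2 / 4" using r by (simp add: F_def power2_eq_square power4_eq_xxxx)
  finally show "integral\<^sup>L lborel (ln_defect r) = pi * r\<^sup>2 / 4" .
qed

section \<open>Continuous differentiability and disc means of logarithmic potentials\<close>

definition log_pot :: "complex set \<Rightarrow> complex \<Rightarrow> real" where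
  "log_pot G x = (LINT y|lborel. indicator G y * ln (norm (x - y)))"

definition log_grad :: "complex set \<Rightarrow> complex \<Rightarrow> complex" where
  "log_grad G x = (LINT y|lborel. indicator G y *\<^sub>R ((x - y) /\<^sub>R (norm (x - y))\<^sup>2))"

lemma pos_sq_add: "0 < e \<Longrightarrow> 0 < (norm (z::complex))\<^sup>2 + (e::real)\<^sup>2"
  by (simp add: add_nonneg_pos)

text \<open>By \<open>2 * norm z * e \<le> (norm z)\<^sup>2 + e\<^sup>2\<close>, the relative
  increment \<open>u\<close> of the argument of \<open>ln\<close> is at most
  \<open>2 * norm h / e\<close>, uniformly in \<open>z\<close>. The assumption on \<open>h\<close>
  ensures \<open>\<bar>u\<bar> \<le> 1 / 2\<close>, where \<open>ln (1 + u) - u\<close> is at most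
  \<open>2 * u\<^sup>2\<close>; the constant 5 rounds up \<open>4 + 1 / 2\<close>.\<close>

lemma ln_reg_taylor:
  fixes z h :: complex
  assumes e: "0 < e" and h: "norm h \<le> e / 4"
  shows "\<bar>ln ((norm (z + h))\<^sup>2 + e\<^sup>2) / 2 - ln ((norm z)\<^sup>2 + e\<^sup>2) / 2 - (z /\<^sub>R ((norm z)\<^sup>2 + e\<^sup>2)) \<bullet> h\<bar> \<le> 5 / e\<^sup>2 * (norm h)\<^sup>2"
proof -
  define a where "a = (norm z)\<^sup>2 + e\<^sup>2"
  define u where "u = (2 * (z \<bullet> h) + (norm h)\<^sup>2) / a"
  have a: "0 < a" using e by (simp add: a_def pos_sq_add)
  have ae: "e\<^sup>2 \<le> a" by (simp add: a_def)
  have "2 * norm z * e \<le> a" unfolding a_def by (rule sum_squares_bound)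
  have cs: "\<bar>z \<bullet> h\<bar> \<le> norm z * norm h" by (rule Cauchy_Schwarz_ineq2)
  have "\<bar>2 * (z \<bullet> h) + (norm h)\<^sup>2\<bar> \<le> 2 * norm z * norm h + (norm h)\<^sup>2"
    using cs zero_le_power2[of "norm h"] by linarith
  also have "\<dots> = (2 * norm z * e) * (norm h / e) + (norm h)\<^sup>2" using e by simp
  also have "\<dots> \<le> a * (norm h / e) + a * (norm h / e)"
  proof (intro add_mono mult_right_mono)
    show "2 * norm z * e \<le> a" by fact
    have "(norm h)\<^sup>2 \<le> norm h * e" using h e by (simp add: power2_eq_square mult_left_mono)
    also have "\<dots> = e\<^sup>2 * (norm h / e)" using e by (simp add: power2_eq_square)
    also have "\<dots> \<le> a * (norm h / e)" using ae e by (intro mult_right_mono) auto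
    finally show "(norm h)\<^sup>2 \<le> a * (norm h / e)" .
  qed (use e in auto)
  finally have "\<bar>2 * (z \<bullet> h) + (norm h)\<^sup>2\<bar> \<le> a * (norm h / e) + a * (norm h / e)" .
  also have "\<dots> = a * (2 * (norm h / e))" by (simp only: mult_2 distrib_left)
  finally have "\<bar>2 * (z \<bullet> h) + (norm h)\<^sup>2\<bar> \<le> a * (2 * (norm h / e))" .
  then have u: "\<bar>u\<bar> \<le> 2 * (norm h / e)" using a by (simp add: u_def abs_divide divide_le_eq mult.commute)
  also have "\<dots> \<le> 1 / 2" using h e by (simp add: divide_le_eq)
  finally have u2: "\<bar>u\<bar> \<le> 1 / 2" .
  have "(norm (z + h))\<^sup>2 + e\<^sup>2 = a + (2 * (z \<bullet> h) + (norm h)\<^sup>2)"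
    by (simp add: a_def power2_norm_eq_inner inner_add inner_commute)
  also have "\<dots> = a * (1 + u)" using a by (simp add: u_def field_simps)
  finally have "ln ((norm (z + h))\<^sup>2 + e\<^sup>2) = ln a + ln (1 + u)"
    using a u2 by (simp add: ln_mult)
  then have eq: "ln ((norm (z + h))\<^sup>2 + e\<^sup>2) / 2 - ln a / 2 - (z /\<^sub>R a) \<bullet> h = (ln (1 + u) - u) / 2 + (norm h)\<^sup>2 / (2 * a)"
    using a by (simp add: u_def field_simps)
  have "\<bar>(ln (1 + u) - u) / 2 + (norm h)\<^sup>2 / (2 * a)\<bar> \<le> \<bar>ln (1 + u) - u\<bar> / 2 + (norm h)\<^sup>2 / (2 * a)"
    using a by (intro order_trans[OF abs_triangle_ineq]) auto
  also have "\<bar>ln (1 + u) - u\<bar> \<le> 2 * u\<^sup>2" by (rule abs_ln_one_plus_x_minus_x_bound[OF u2])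
  also have "u\<^sup>2 \<le> (2 * (norm h / e))\<^sup>2" using power_mono[OF u, of 2] by simp
  also have "(norm h)\<^sup>2 / (2 * a) \<le> (norm h)\<^sup>2 / (2 * e\<^sup>2)" using ae e a by (intro divide_left_mono) auto
  finally have "\<bar>(ln (1 + u) - u) / 2 + (norm h)\<^sup>2 / (2 * a)\<bar> \<le> 2 * (2 * (norm h / e))\<^sup>2 / 2 + (norm h)\<^sup>2 / (2 * e\<^sup>2)"
    by simp
  also have "\<dots> \<le> 5 / e\<^sup>2 * (norm h)\<^sup>2" using e by (simp add: power2_eq_square field_simps)
  finally show ?thesis using eq by (simp add: a_def)
qed

lemma ln_defect_reflect_integral: "0 < r \<Longrightarrow> (LINT y|lborel. ln_defect r (x - y)) = pi * r\<^sup>2 / 4"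
  by (subst integral_lborel_reflect) (auto simp: ln_defect_integral)

lemma AE_ln_defect_nonneg: "AE y in lborel. 0 \<le> ln_defect r (x - y)"
  using AE_neq_complex[of x] by eventually_elim (auto intro!: ln_defect_nonneg)

lemma ln_diff_bound:
  fixes x y :: complex
  assumes y: "norm y < R" and x: "2 * R \<le> norm x" "0 < R"
  shows "\<bar>ln (norm (x - y)) - ln (norm x)\<bar> \<le> 2 * R / norm x"
proof -
  define s t where "s = norm (x - y)" and "t = norm x"
  have st: "\<bar>s - t\<bar> \<le> R" using y norm_triangle_ineq3[of "x - y" x] by (simp add: s_def t_def)
  have t: "0 < t" "2 * R \<le> t" using x by (auto simp: t_def)
  have s: "t / 2 \<le> s" "0 < s" using st t x(2) by linarith+
  have "ln (s / t) \<le> s / t - 1" using s t by (intro ln_le_minus_one) auto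
  also have "\<dots> = (s - t) / t" using t by (simp add: field_simps)
  also have "\<dots> \<le> 2 * R / t" using st t x(2) by (intro divide_right_mono) auto
  finally have 1: "ln s - ln t \<le> 2 * R / t" using s t by (simp add: ln_div)
  have "ln (t / s) \<le> t / s - 1" using s t by (intro ln_le_minus_one) auto
  also have "\<dots> = (t - s) / s" using s by (simp add: field_simps)
  also have "\<dots> \<le> R / s" using st s by (intro divide_right_mono) auto
  also have "\<dots> \<le> R / (t / 2)" using s t x(2) by (intro divide_left_mono) auto
  also have "\<dots> = 2 * R / t" by simp
  finally have 2: "ln t - ln s \<le> 2 * R / t" using s t by (simp add: ln_div)
  show ?thesis using 1 2 by (simp add: s_def t_def abs_le_iff)
qed

context
  fixes G :: "complex set" and R :: real
  assumes G [measurable]: "G \<in> sets borel" and GR: "G \<subseteq> ball 0 R"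
begin

lemma G_finite: "emeasure lborel G < \<infinity>"
  using GR by (intro bounded_finite_measure) (auto intro: bounded_subset)

lemma G_integrable: "integrable lborel (indicator G :: complex \<Rightarrow> real)"
  using G_finite by (auto simp: less_top)

lemma G_bdd_integrable:
  fixes f :: "complex \<Rightarrow> 'b::{banach, second_countable_topology}"
  assumes [measurable]: "f \<in> borel_measurable borel" and b: "\<And>y. y \<in> G \<Longrightarrow> norm (f y) \<le> B"
  shows "integrable lborel (\<lambda>y. indicator G y *\<^sub>R f y)"
proof (rule Bochner_Integration.integrable_bound[OF integrable_mult_right[of B, OF G_integrable]])
  show "AE x in lborel. norm (indicator G x *\<^sub>R f x) \<le> norm (B * indicator G x)"
    by (intro AE_I2) (auto split: split_indicator intro!: order_trans[OF b abs_ge_self])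
qed measurable

text \<open>The logarithm with its singularity smoothed at scale \<open>e\<close>: the kernel has a
  bounded gradient, so differentiation under the integral is elementary. The limit
  \<open>e -> 0\<close> is taken afterwards, by uniform convergence of the gradients.\<close>

definition reg_pot :: "real \<Rightarrow> complex \<Rightarrow> real" where
  "reg_pot e x = (LINT y|lborel. indicator G y * (ln ((norm (x - y))\<^sup>2 + e\<^sup>2) / 2))"

definition reg_grad :: "real \<Rightarrow> complex \<Rightarrow> complex" where
  "reg_grad e x = (LINT y|lborel. indicator G y *\<^sub>R ((x - y) /\<^sub>R ((norm (x - y))\<^sup>2 + e\<^sup>2)))"

lemma reg_bounds:
  assumes "0 < e"
  shows "integrable lborel (\<lambda>y. indicator G y * (ln ((norm (x - y))\<^sup>2 + e\<^sup>2) / 2))"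
    and "norm ((x - y) /\<^sub>R ((norm (x - y))\<^sup>2 + e\<^sup>2)) \<le> 1 / e"
    and "integrable lborel (\<lambda>y. indicator G y *\<^sub>R ((x - y) /\<^sub>R ((norm (x - y))\<^sup>2 + e\<^sup>2)))"
proof -
  have "integrable lborel (\<lambda>y. indicator G y *\<^sub>R (ln ((norm (x - y))\<^sup>2 + e\<^sup>2) / 2))"
  proof (rule G_bdd_integrable)
    fix y assume "y \<in> G"
    then have n: "norm (x - y) \<le> norm x + R" using norm_triangle_ineq4[of x y] GR by force
    have "ln ((norm (x - y))\<^sup>2 + e\<^sup>2) \<le> ln ((norm x + R)\<^sup>2 + e\<^sup>2)"
      using pos_sq_add[OF assms, of "x - y"] n by (intro ln_mono) (auto intro: power_mono add_pos_nonneg)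
    moreover have "ln (e\<^sup>2) \<le> ln ((norm (x - y))\<^sup>2 + e\<^sup>2)"
      using assms pos_sq_add[OF assms, of "x - y"] by (intro ln_mono) auto
    ultimately show "norm (ln ((norm (x - y))\<^sup>2 + e\<^sup>2) / 2) \<le> \<bar>ln ((norm x + R)\<^sup>2 + e\<^sup>2)\<bar> + \<bar>ln (e\<^sup>2)\<bar>"
      by simp
  qed measurable
  then show "integrable lborel (\<lambda>y. indicator G y * (ln ((norm (x - y))\<^sup>2 + e\<^sup>2) / 2))" by simp
  show b: "norm ((x - y) /\<^sub>R ((norm (x - y))\<^sup>2 + e\<^sup>2)) \<le> 1 / e" for y
  proof -
    have "norm (x - y) * e \<le> (norm (x - y))\<^sup>2 + e\<^sup>2"
    proof -
      have "0 \<le> norm (x - y) * e" using assms by simp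
      then show ?thesis using sum_squares_bound[of "norm (x - y)" e] by linarith
    qed
    moreover have "norm ((x - y) /\<^sub>R a) = norm (x - y) / a" if "0 < a" for a
      using that by (simp add: divide_inverse_commute)
    moreover have "n / a \<le> 1 / e" if "0 < a" "n * e \<le> a" for a n :: real
      using that assms by (simp add: field_simps)
    ultimately show ?thesis using pos_sq_add[OF assms, of "x - y"] by metis
  qed
  show "integrable lborel (\<lambda>y. indicator G y *\<^sub>R ((x - y) /\<^sub>R ((norm (x - y))\<^sup>2 + e\<^sup>2)))"
    by (rule G_bdd_integrable[where B="1 / e"]) (use b in auto)
qed

lemma reg_pot_derivative:
  assumes e: "0 < e"
  shows "(reg_pot e has_derivative (\<lambda>h. reg_grad e x \<bullet> h)) (at x)"
proof -
  define m where "m = measure lborel G"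
  have rem: "\<bar>reg_pot e (x + h) - reg_pot e x - reg_grad e x \<bullet> h\<bar> \<le> 5 / e\<^sup>2 * m * (norm h)\<^sup>2" if h: "norm h \<le> e / 4" for h
  proof -
    let ?k = "\<lambda>y. ln ((norm (x - y + h))\<^sup>2 + e\<^sup>2) / 2 - ln ((norm (x - y))\<^sup>2 + e\<^sup>2) / 2 - ((x - y) /\<^sub>R ((norm (x - y))\<^sup>2 + e\<^sup>2)) \<bullet> h"
    have i1: "integrable lborel (\<lambda>y. indicator G y * (ln ((norm (x - y + h))\<^sup>2 + e\<^sup>2) / 2))"
      using reg_bounds(1)[OF e, of "x + h"] by (simp add: algebra_simps)
    note i2 = reg_bounds(1)[OF e, of x] and i3 = reg_bounds(3)[OF e, of x]
    have "reg_pot e (x + h) - reg_pot e x - reg_grad e x \<bullet> h = (LINT y|lborel. indicator G y * (ln ((norm (x - y + h))\<^sup>2 + e\<^sup>2) / 2)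
        - indicator G y * (ln ((norm (x - y))\<^sup>2 + e\<^sup>2) / 2) - (indicator G y *\<^sub>R ((x - y) /\<^sub>R ((norm (x - y))\<^sup>2 + e\<^sup>2))) \<bullet> h)"
      unfolding reg_pot_def reg_grad_def
      by (subst Bochner_Integration.integral_diff, intro Bochner_Integration.integrable_diff i1 i2, rule integrable_inner_left[OF i3],
          subst Bochner_Integration.integral_diff[OF i1 i2], subst integral_inner_left[OF i3]) (simp add: algebra_simps)
    also have "\<dots> = (LINT y|lborel. indicator G y * ?k y)"
      by (intro Bochner_Integration.integral_cong) (auto simp: algebra_simps split: split_indicator)
    finally have "\<bar>reg_pot e (x + h) - reg_pot e x - reg_grad e x \<bullet> h\<bar> \<le> (LINT y|lborel. \<bar>indicator G y * ?k y\<bar>)"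
      by (simp only: integral_abs_bound)
    also have "\<dots> \<le> (LINT y|lborel. 5 / e\<^sup>2 * (norm h)\<^sup>2 * indicator G y)"
    proof (rule integral_mono')
      show "integrable lborel (\<lambda>y::complex. 5 / e\<^sup>2 * (norm h)\<^sup>2 * indicator G y)"
        by (rule integrable_mult_right[OF G_integrable])
      show "\<bar>indicator G y * ?k y\<bar> \<le> 5 / e\<^sup>2 * (norm h)\<^sup>2 * indicator G y" for y
        using ln_reg_taylor[OF e h, of "x - y"] by (auto split: split_indicator)
    qed auto
    also have "\<dots> = 5 / e\<^sup>2 * m * (norm h)\<^sup>2" by (simp add: m_def)
    finally show ?thesis .
  qed
  show ?thesis
    unfolding has_derivative_at
  proof
    show "bounded_linear ((\<bullet>) (reg_grad e x))" by (rule bounded_linear_inner_right)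
    have "((\<lambda>h::complex. 5 / e\<^sup>2 * m * norm h) \<longlongrightarrow> 5 / e\<^sup>2 * m * norm (0::complex)) (at 0)"
      by (rule tendsto_mult[OF tendsto_const tendsto_norm[OF tendsto_ident_at]])
    then have lim: "((\<lambda>h::complex. 5 / e\<^sup>2 * m * norm h) \<longlongrightarrow> 0) (at 0)" by simp
    show "(\<lambda>h. norm (reg_pot e (x + h) - reg_pot e x - reg_grad e x \<bullet> h) / norm h) \<midarrow>0\<rightarrow> 0"
    proof (rule Lim_null_comparison[OF _ lim])
      have "\<forall>\<^sub>F h in at 0. norm h < e / 4 \<and> h \<noteq> (0::complex)"
        using e by (intro eventually_conj) (auto simp: eventually_at intro!: exI[of _ "e / 4"] zero_less_one)
      then show "\<forall>\<^sub>F h in at 0. norm (norm (reg_pot e (x + h) - reg_pot e x - reg_grad e x \<bullet> h) / norm h) \<le> 5 / e\<^sup>2 * m * norm h"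
      proof eventually_elim
        case (elim h)
        then have "\<bar>reg_pot e (x + h) - reg_pot e x - reg_grad e x \<bullet> h\<bar> / norm h \<le> (5 / e\<^sup>2 * m * (norm h)\<^sup>2) / norm h"
          using rem[of h] by (intro divide_right_mono) auto
        also have "\<dots> = 5 / e\<^sup>2 * m * norm h" using elim by (simp add: power2_eq_square)
        finally show ?case by simp
      qed
    qed
  qed
qed

lemma reg_grad_continuous:
  assumes e: "0 < e"
  shows "continuous_on UNIV (reg_grad e)"
proof -
  have "(\<lambda>n. reg_grad e (X n)) \<longlonglongrightarrow> reg_grad e x" if X: "X \<longlonglongrightarrow> x" for X x
    unfolding reg_grad_def
  proof (rule integral_dominated_convergence)
    show "integrable lborel (\<lambda>y. 1 / e * indicator G y)" by (rule integrable_mult_right[OF G_integrable])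
    show "AE y in lborel. (\<lambda>n. indicator G y *\<^sub>R ((X n - y) /\<^sub>R ((norm (X n - y))\<^sup>2 + e\<^sup>2)))
       \<longlonglongrightarrow> indicator G y *\<^sub>R ((x - y) /\<^sub>R ((norm (x - y))\<^sup>2 + e\<^sup>2))"
      using pos_sq_add[OF e] by (intro AE_I2 tendsto_intros X) (metis less_irrefl)
    show "AE y in lborel. norm (indicator G y *\<^sub>R ((X n - y) /\<^sub>R ((norm (X n - y))\<^sup>2 + e\<^sup>2))) \<le> 1 / e * indicator G y" for n
      using reg_bounds(2)[OF e, of "X n"] by (intro AE_I2) (auto split: split_indicator)
  qed measurable
  then show ?thesis by (auto simp: continuous_on_sequentially o_def)
qed

lemma log_grad_integrable: "integrable lborel (\<lambda>y. indicator G y *\<^sub>R ((x - y) /\<^sub>R (norm (x - y))\<^sup>2))"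
proof (rule Bochner_Integration.integrable_bound[OF inverse_norm_bound(1)[OF G G_finite, of x]])
  show "AE y in lborel. norm (indicator G y *\<^sub>R ((x - y) /\<^sub>R (norm (x - y))\<^sup>2)) \<le> norm (indicator G y * (1 / norm (x - y)))"
    by (intro AE_I2) (auto split: split_indicator simp: power2_eq_square divide_simps)
qed measurable

lemma log_grad_bound: "norm (log_grad G x) \<le> 2 * pi + measure lborel G"
proof -
  have "norm (log_grad G x) \<le> (LINT y|lborel. norm (indicator G y *\<^sub>R ((x - y) /\<^sub>R (norm (x - y))\<^sup>2)))"
    unfolding log_grad_def by (rule integral_norm_bound)
  also have "\<dots> = (LINT y|lborel. indicator G y * (1 / norm (x - y)))"
    by (intro Bochner_Integration.integral_cong) (auto split: split_indicator simp: power2_eq_square divide_simps)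
  also have "\<dots> \<le> 2 * pi + measure lborel G" by (rule inverse_norm_bound(2)[OF G G_finite])
  finally show ?thesis .
qed

text \<open>An error bound that does not depend on the point. The two gradient kernels differ by a
  vector of norm \<open>e\<^sup>2 / (norm z * ((norm z)\<^sup>2 + e\<^sup>2))\<close>, which is
  integrated over the whole unit disc when near and bounded by \<open>e\<^sup>2\<close> on
  \<open>G\<close> when far.\<close>

definition reg_err :: "real \<Rightarrow> real" where
  "reg_err e = (LINT z|lborel. indicator (ball 0 1) z * (e\<^sup>2 / (norm (z::complex) * ((norm z)\<^sup>2 + e\<^sup>2)))) + e\<^sup>2 * measure lborel G"

lemma reg_err_kernel_le: "0 < e \<Longrightarrow> e\<^sup>2 / (norm (z::complex) * ((norm z)\<^sup>2 + e\<^sup>2)) \<le> 1 / norm z"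
proof -
  assume "0 < e"
  then have "0 < (norm z)\<^sup>2 + e\<^sup>2" by (rule pos_sq_add)
  then have "e\<^sup>2 / ((norm z)\<^sup>2 + e\<^sup>2) \<le> 1" by (simp add: divide_le_eq)
  then have "(1 / norm z) * (e\<^sup>2 / ((norm z)\<^sup>2 + e\<^sup>2)) \<le> (1 / norm z) * 1" by (rule mult_left_mono) simp
  then show ?thesis by simp
qed

lemma reg_err_integrable:
  assumes e: "0 < e"
  shows "integrable lborel (\<lambda>z::complex. indicator (ball 0 1) z * (e\<^sup>2 / (norm z * ((norm z)\<^sup>2 + e\<^sup>2))))"
proof (rule Bochner_Integration.integrable_bound[OF integrable_inverse_norm_ball(1)[of 1]])
  show "AE z::complex in lborel. norm (indicator (ball 0 1) z * (e\<^sup>2 / (norm z * ((norm z)\<^sup>2 + e\<^sup>2)))) \<le> norm (indicator (ball 0 1) z * (1 / norm z))"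
  proof (rule AE_I2)
    fix z :: complex
    have "0 \<le> e\<^sup>2 / (norm z * ((norm z)\<^sup>2 + e\<^sup>2))" by simp
    then show "norm (indicator (ball 0 1) z * (e\<^sup>2 / (norm z * ((norm z)\<^sup>2 + e\<^sup>2)))) \<le> norm (indicator (ball 0 1) z * (1 / norm z))"
      using reg_err_kernel_le[OF e, of z] by (auto split: split_indicator simp del: divide_nonneg_nonneg)
  qed
  have [measurable]: "ball (0::complex) 1 \<in> sets borel" by simp
  show "(\<lambda>z::complex. indicator (ball 0 1) z * (e\<^sup>2 / (norm z * ((norm z)\<^sup>2 + e\<^sup>2)))) \<in> borel_measurable lborel" by measurable
qed simp

lemma reg_grad_log_grad:
  assumes e: "0 < e"
  shows "norm (reg_grad e x - log_grad G x) \<le> reg_err e"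
proof -
  let ?c = "\<lambda>z::complex. indicator (ball 0 1) z * (e\<^sup>2 / (norm z * ((norm z)\<^sup>2 + e\<^sup>2)))"
  let ?d = "\<lambda>y. indicator G y *\<^sub>R ((x - y) /\<^sub>R ((norm (x - y))\<^sup>2 + e\<^sup>2)) - indicator G y *\<^sub>R ((x - y) /\<^sub>R (norm (x - y))\<^sup>2)"
  have "reg_grad e x - log_grad G x = integral\<^sup>L lborel ?d"
    unfolding reg_grad_def log_grad_def by (rule Bochner_Integration.integral_diff[symmetric, OF reg_bounds(3)[OF e] log_grad_integrable])
  then have "norm (reg_grad e x - log_grad G x) \<le> (LINT y|lborel. norm (?d y))"
    by (simp only: integral_norm_bound)
  also have "\<dots> \<le> (LINT y|lborel. ?c (x - y) + e\<^sup>2 * indicator G y)"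
  proof (rule integral_mono')
    show "integrable lborel (\<lambda>y. ?c (x - y) + e\<^sup>2 * indicator G y)"
      by (rule Bochner_Integration.integrable_add[OF integrable_lborel_reflect[OF reg_err_integrable[OF e]] integrable_mult_right[OF G_integrable]])
    fix y
    define z where "z = x - y"
    show "norm (?d y) \<le> ?c (x - y) + e\<^sup>2 * indicator G y"
    proof (cases "y \<in> G \<and> z \<noteq> 0")
      case True
      have p: "0 < (norm z)\<^sup>2 + e\<^sup>2" using e by (rule pos_sq_add)
      have "z /\<^sub>R ((norm z)\<^sup>2 + e\<^sup>2) - z /\<^sub>R (norm z)\<^sup>2 = (inverse ((norm z)\<^sup>2 + e\<^sup>2) - inverse ((norm z)\<^sup>2)) *\<^sub>R z"
        by (simp add: scaleR_diff_left)
      also have "inverse ((norm z)\<^sup>2 + e\<^sup>2) - inverse ((norm z)\<^sup>2) = - (e\<^sup>2 / ((norm z)\<^sup>2 * ((norm z)\<^sup>2 + e\<^sup>2)))"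
        using p True by (simp add: field_simps)
      finally have eq: "norm (?d y) = e\<^sup>2 / (norm z * ((norm z)\<^sup>2 + e\<^sup>2))"
        using True p by (simp add: z_def power2_eq_square)
      show ?thesis
      proof (cases "norm z < 1")
        case t: True
        then show ?thesis using True unfolding eq by (simp add: z_def)
      next
        case False
        have n1: "1 \<le> norm z" using False by simp
        have "1 \<le> (norm z)\<^sup>2" using n1 by (rule one_le_power)
        then have "1 \<le> (norm z)\<^sup>2 + e\<^sup>2" by (simp add: add_increasing2)
        then have "1 * 1 \<le> norm z * ((norm z)\<^sup>2 + e\<^sup>2)"
          using n1 by (intro mult_mono) auto
        then have "e\<^sup>2 / (norm z * ((norm z)\<^sup>2 + e\<^sup>2)) \<le> e\<^sup>2 / 1"
          by (intro divide_left_mono) auto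
        then show ?thesis using True False unfolding eq by (simp add: z_def)
      qed
    next
      case False
      then show ?thesis by (auto simp: z_def split: split_indicator)
    qed
  qed simp
  also have "\<dots> = reg_err e"
    unfolding reg_err_def
    by (subst Bochner_Integration.integral_add[OF integrable_lborel_reflect[OF reg_err_integrable[OF e]] integrable_mult_right[OF G_integrable]],
        subst integral_lborel_reflect[of ?c x]) (use reg_err_integrable[OF e] in auto)
  finally show ?thesis .
qed

definition reg_seq :: "nat \<Rightarrow> real" where "reg_seq n = 1 / real (Suc n)"

lemma reg_seq_pos: "0 < reg_seq n" by (simp add: reg_seq_def)

lemma reg_seq_lim: "reg_seq \<longlonglongrightarrow> 0"
  unfolding reg_seq_def by (rule LIMSEQ_Suc[OF lim_1_over_n])

lemma reg_err_lim: "(\<lambda>n. reg_err (reg_seq n)) \<longlonglongrightarrow> 0"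
proof -
  have "(\<lambda>n. LINT z|lborel. indicator (ball 0 1) z * ((reg_seq n)\<^sup>2 / (norm (z::complex) * ((norm z)\<^sup>2 + (reg_seq n)\<^sup>2)))) \<longlonglongrightarrow> (LINT z|(lborel :: complex measure). (0::real))"
  proof (rule integral_dominated_convergence)
    have [measurable]: "ball (0::complex) 1 \<in> sets borel" by simp
    show "integrable lborel (\<lambda>z::complex. indicator (ball 0 1) z * (1 / norm z))"
      by (rule integrable_inverse_norm_ball) simp
    show "(\<lambda>z::complex. indicator (ball 0 1) z * ((reg_seq n)\<^sup>2 / (norm z * ((norm z)\<^sup>2 + (reg_seq n)\<^sup>2)))) \<in> borel_measurable lborel" for n by measurable
    show "AE z::complex in lborel. (\<lambda>n. indicator (ball 0 1) z * ((reg_seq n)\<^sup>2 / (norm z * ((norm z)\<^sup>2 + (reg_seq n)\<^sup>2)))) \<longlonglongrightarrow> 0"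
      using AE_neq_complex[of 0]
    proof eventually_elim
      case (elim z)
      have "(\<lambda>n. indicator (ball 0 1) z * ((reg_seq n)\<^sup>2 / (norm z * ((norm z)\<^sup>2 + (reg_seq n)\<^sup>2)))) \<longlonglongrightarrow> indicator (ball 0 1) z * (0\<^sup>2 / (norm z * ((norm z)\<^sup>2 + 0\<^sup>2)))"
        using elim by (intro tendsto_intros reg_seq_lim) auto
      then show ?case by simp
    qed
    show "AE z::complex in lborel. norm (indicator (ball 0 1) z * ((reg_seq n)\<^sup>2 / (norm z * ((norm z)\<^sup>2 + (reg_seq n)\<^sup>2)))) \<le> indicator (ball 0 1) z * (1 / norm z)" for n
      using reg_err_kernel_le[OF reg_seq_pos, of n] by (intro AE_I2) (auto split: split_indicator)
  qed simp
  moreover have "(\<lambda>n. (reg_seq n)\<^sup>2 * measure lborel G) \<longlonglongrightarrow> 0\<^sup>2 * measure lborel G"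
    by (intro tendsto_intros reg_seq_lim)
  ultimately show ?thesis unfolding reg_err_def by (auto intro: tendsto_eq_intros)
qed

lemma reg_pot_lim: "(\<lambda>n. reg_pot (reg_seq n) x) \<longlonglongrightarrow> log_pot G x"
  unfolding reg_pot_def log_pot_def
proof (rule integral_dominated_convergence)
  let ?w = "\<lambda>y. indicator G y * (ln ((norm (x - y))\<^sup>2 + 1\<^sup>2) / 2) + \<bar>indicator G y * ln (norm (x - y))\<bar>"
  show "integrable lborel ?w"
    by (intro Bochner_Integration.integrable_add integrable_abs ln_bound(1)[OF G GR] reg_bounds(1)) simp
  have sq: "ln t = ln (t\<^sup>2) / 2" if "0 < t" for t :: real using that by (simp add: ln_realpow)
  show "AE y in lborel. (\<lambda>n. indicator G y * (ln ((norm (x - y))\<^sup>2 + (reg_seq n)\<^sup>2) / 2)) \<longlonglongrightarrow> indicator G y * ln (norm (x - y))"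
    using AE_neq_complex[of x]
  proof eventually_elim
    case (elim y)
    then have "(\<lambda>n. indicator G y * (ln ((norm (x - y))\<^sup>2 + (reg_seq n)\<^sup>2) / 2)) \<longlonglongrightarrow> indicator G y * (ln ((norm (x - y))\<^sup>2 + 0\<^sup>2) / 2)"
      by (intro tendsto_intros reg_seq_lim) auto
    moreover have "ln ((norm (x - y))\<^sup>2) / 2 = ln (norm (x - y))" using elim sq[of "norm (x - y)"] by simp
    ultimately show ?case by (simp only: zero_power2 add_0_right)
  qed
  show "AE y in lborel. norm (indicator G y * (ln ((norm (x - y))\<^sup>2 + (reg_seq n)\<^sup>2) / 2)) \<le> ?w y" for n
    using AE_neq_complex[of x]
  proof eventually_elim
    case (elim y)
    define t where "t = norm (x - y)"
    have t: "0 < t" using elim by (simp add: t_def)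
    \<comment> \<open>Since the scales are at most 1, the regularized logarithm lies between
      \<open>ln (t\<^sup>2)\<close> and \<open>ln (t\<^sup>2 + 1)\<close>, which provides a majorant
      independent of \<open>n\<close>.\<close>
    have e1: "(reg_seq n)\<^sup>2 \<le> 1\<^sup>2" by (intro power_mono) (auto simp: reg_seq_def)
    have "ln (t\<^sup>2) \<le> ln (t\<^sup>2 + (reg_seq n)\<^sup>2)" using t by (intro ln_mono) (auto intro: add_pos_nonneg)
    moreover have "ln (t\<^sup>2 + (reg_seq n)\<^sup>2) \<le> ln (t\<^sup>2 + 1\<^sup>2)" using t e1 by (intro ln_mono) (auto intro: add_pos_nonneg)
    moreover have "0 \<le> ln (t\<^sup>2 + 1\<^sup>2)" by (intro ln_ge_zero) auto
    ultimately have "\<bar>ln (t\<^sup>2 + (reg_seq n)\<^sup>2) / 2\<bar> \<le> ln (t\<^sup>2 + 1\<^sup>2) / 2 + \<bar>ln t\<bar>"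
      using sq[OF t] by linarith
    then show ?case by (auto simp: t_def split: split_indicator)
  qed
qed measurable

text \<open>The regularized gradients converge uniformly by \<open>reg_err\<close>, so limit and
  derivative may be exchanged; the limit function is then identified pointwise by
  \<open>reg_pot_lim\<close>.\<close>

lemma log_pot_derivative: "(log_pot G has_derivative (\<lambda>h. log_grad G x \<bullet> h)) (at x)"
proof -
  have "\<exists>g. \<forall>x\<in>UNIV. (\<lambda>n. reg_pot (reg_seq n) x) \<longlonglongrightarrow> g x \<and> (g has_derivative (\<lambda>h. log_grad G x \<bullet> h)) (at x within UNIV)"
  proof (rule has_derivative_sequence)
    show "(reg_pot (reg_seq n) has_derivative (\<lambda>h. reg_grad (reg_seq n) x \<bullet> h)) (at x within UNIV)" for n x
      using reg_pot_derivative[OF reg_seq_pos] by simp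
    show "(\<lambda>n. reg_pot (reg_seq n) 0) \<longlonglongrightarrow> log_pot G 0" by (rule reg_pot_lim)
    fix e :: real assume "0 < e"
    then have "\<forall>\<^sub>F n in sequentially. reg_err (reg_seq n) < e" using reg_err_lim by (rule order_tendstoD(2)[rotated])
    then show "\<forall>\<^sub>F n in sequentially. \<forall>x\<in>UNIV. \<forall>h. norm (reg_grad (reg_seq n) x \<bullet> h - log_grad G x \<bullet> h) \<le> e * norm h"
    proof eventually_elim
      case (elim n)
      show ?case
      proof (intro ballI allI)
        fix x h
        have "norm (reg_grad (reg_seq n) x \<bullet> h - log_grad G x \<bullet> h) \<le> norm (reg_grad (reg_seq n) x - log_grad G x) * norm h"
          unfolding inner_diff_left[symmetric] real_norm_def by (rule Cauchy_Schwarz_ineq2)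
        also have "\<dots> \<le> e * norm h"
          using reg_grad_log_grad[OF reg_seq_pos, of n x] elim by (intro mult_right_mono) auto
        finally show "norm (reg_grad (reg_seq n) x \<bullet> h - log_grad G x \<bullet> h) \<le> e * norm h" .
      qed
    qed
  qed auto
  then obtain g where g: "\<And>x. (\<lambda>n. reg_pot (reg_seq n) x) \<longlonglongrightarrow> g x" "\<And>x. (g has_derivative (\<lambda>h. log_grad G x \<bullet> h)) (at x)"
    by auto
  have "g = log_pot G" using LIMSEQ_unique[OF g(1) reg_pot_lim] by auto
  then show ?thesis using g(2) by simp
qed

lemma log_grad_continuous: "continuous_on UNIV (log_grad G)"
proof (rule uniform_limit_theorem[where F=sequentially and f="\<lambda>n. reg_grad (reg_seq n)"])
  show "\<forall>\<^sub>F n in sequentially. continuous_on UNIV (reg_grad (reg_seq n))"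
    using reg_grad_continuous[OF reg_seq_pos] by simp
  show "uniform_limit UNIV (\<lambda>n. reg_grad (reg_seq n)) (log_grad G) sequentially"
  proof (rule uniform_limitI)
    fix e :: real assume "0 < e"
    then have "\<forall>\<^sub>F n in sequentially. reg_err (reg_seq n) < e" using reg_err_lim by (rule order_tendstoD(2)[rotated])
    then show "\<forall>\<^sub>F n in sequentially. \<forall>x\<in>UNIV. dist (reg_grad (reg_seq n) x) (log_grad G x) < e"
      by eventually_elim (auto simp: dist_norm intro: order_le_less_trans[OF reg_grad_log_grad[OF reg_seq_pos]])
  qed
qed auto

lemma log_pot_lipschitz: "\<bar>log_pot G x - log_pot G y\<bar> \<le> (2 * pi + measure lborel G) * norm (x - y)"
proof -
  have "norm (log_pot G x - log_pot G y) \<le> (2 * pi + measure lborel G) * norm (x - y)"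
  proof (rule differentiable_bound[OF convex_UNIV])
    show "(log_pot G has_derivative (\<lambda>h. log_grad G z \<bullet> h)) (at z within UNIV)" for z
      using log_pot_derivative by simp
    show "onorm (\<lambda>h. log_grad G z \<bullet> h) \<le> 2 * pi + measure lborel G" for z
    proof (rule onorm_le)
      fix h
      have "norm (log_grad G z \<bullet> h) \<le> norm (log_grad G z) * norm h" by (simp add: Cauchy_Schwarz_ineq2)
      also have "\<dots> \<le> (2 * pi + measure lborel G) * norm h" by (intro mult_right_mono log_grad_bound) auto
      finally show "norm (log_grad G z \<bullet> h) \<le> (2 * pi + measure lborel G) * norm h" .
    qed
  qed auto
  then show ?thesis by simp
qed

lemma log_pot_continuous: "continuous_on S (log_pot G)"
  using log_pot_derivative by (meson continuous_at_imp_continuous_on has_derivative_continuous)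

text \<open>Fubini moves the disc mean onto the kernel, where Newton's theorem evaluates it: the
  failure of the mean value property is the convolution of the indicator with
  \<open>ln_defect\<close>.\<close>

lemma ball_mean_log_pot:
  assumes r: "0 < r"
  shows "ball_mean r (log_pot G) x - log_pot G x = (LINT y|lborel. indicator G y * ln_defect r (x - y))"
    and "integrable lborel (\<lambda>y. indicator G y * ln_defect r (x - y))"
proof -
  have [measurable]: "ball (0::complex) r \<in> sets borel" by simp
  have ib: "integrable lborel (indicator (ball (0::complex) r) :: complex \<Rightarrow> real)"
    using r by (simp add: emeasure_ball_complex)
  have iq: "integrable lborel (\<lambda>y. ln_defect r (x - y))" by (rule integrable_lborel_reflect[OF ln_defect_integral(1)[OF r]])
  show i: "integrable lborel (\<lambda>y. indicator G y * ln_defect r (x - y))"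
    using integrable_mult_indicator[OF _ iq, of G] by simp
  define f where "f z y = indicator (ball 0 r) z * (indicator G y * ln (norm (x + z - y)))" for z y
  define C where "C = 2 * pi + measure lborel G * (1 + (norm x + r) + R)"
  have int: "integrable (lborel \<Otimes>\<^sub>M lborel) (case_prod f)"
  proof (rule lborel_pair.Fubini_integrable)
    show "case_prod f \<in> borel_measurable (lborel \<Otimes>\<^sub>M lborel)" unfolding f_def by measurable
    show "AE z in lborel. integrable lborel (\<lambda>y. case (z, y) of (z, y) \<Rightarrow> f z y)"
      unfolding f_def prod.case by (intro AE_I2 integrable_mult_right ln_bound(1)[OF G GR])
    show "integrable lborel (\<lambda>z. LINT y|lborel. norm (case (z, y) of (z, y) \<Rightarrow> f z y))"
    proof (rule Bochner_Integration.integrable_bound[OF integrable_mult_right[of C, OF ib]])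
      show "(\<lambda>z. LINT y|lborel. norm (case (z, y) of (z, y) \<Rightarrow> f z y)) \<in> borel_measurable lborel"
        unfolding f_def by measurable
      show "AE z in lborel. norm (LINT y|lborel. norm (case (z, y) of (z, y) \<Rightarrow> f z y)) \<le> norm (C * indicator (ball 0 r) z)"
      proof (rule AE_I2)
        fix z :: complex
        have "(LINT y|lborel. norm (f z y)) = indicator (ball 0 r) z * (LINT y|lborel. indicator G y * \<bar>ln (norm (x + z - y))\<bar>)"
          by (simp add: f_def abs_mult)
        also have "\<dots> \<le> indicator (ball 0 r) z * C"
        proof (cases "z \<in> ball 0 r")
          case True
          have "norm (x + z) \<le> norm x + r" using norm_triangle_ineq[of x z] True by simp
          then have "2 * pi + measure lborel G * (1 + norm (x + z) + R) \<le> C"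
            unfolding C_def by (intro add_left_mono mult_left_mono) auto
          then show ?thesis using ln_bound(2)[OF G GR, of "x + z"] by (intro mult_left_mono) auto
        qed auto
        finally have l: "(LINT y|lborel. norm (f z y)) \<le> C * indicator (ball 0 r) z" by (simp add: mult.commute)
        have "0 \<le> (LINT y|lborel. norm (f z y))" by (rule integral_nonneg_AE) auto
        then show "norm (LINT y|lborel. norm (case (z, y) of (z, y) \<Rightarrow> f z y)) \<le> norm (C * indicator (ball 0 r) z)"
          using l by simp
      qed
    qed
  qed
  have "ball_mean r (log_pot G) x * (pi * r\<^sup>2) = (LINT z|lborel. LINT y|lborel. f z y)"
    using r by (simp add: ball_mean_def log_pot_def f_def)
  also have "\<dots> = (LINT y|lborel. LINT z|lborel. f z y)"
    by (rule lborel_pair.Fubini_integral[OF int, symmetric])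
  also have "\<dots> = (LINT y|lborel. (indicator G y * ln_mean r (x - y)) * (pi * r\<^sup>2))"
  proof (intro Bochner_Integration.integral_cong refl)
    fix y
    have "(LINT z|lborel. f z y) = indicator G y * (LINT z|lborel. indicator (ball 0 r) z * ln (norm ((x - y) + z)))"
      unfolding f_def by (simp add: mult.left_commute algebra_simps)
    also have "(LINT z|lborel. indicator (ball 0 r) z * ln (norm ((x - y) + z))) = ln_mean r (x - y) * (pi * r\<^sup>2)"
      using ball_mean_ln[OF r, of "x - y"] r by (simp add: ball_mean_def field_simps)
    finally show "(LINT z|lborel. f z y) = (indicator G y * ln_mean r (x - y)) * (pi * r\<^sup>2)" by simp
  qed
  finally have "ball_mean r (log_pot G) x = (LINT y|lborel. indicator G y * ln_mean r (x - y))" using r by simp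
  also have "\<dots> = (LINT y|lborel. indicator G y * ln_defect r (x - y) + indicator G y * ln (norm (x - y)))"
    by (simp add: ln_defect_def algebra_simps)
  also have "\<dots> = (LINT y|lborel. indicator G y * ln_defect r (x - y)) + log_pot G x"
    unfolding log_pot_def by (rule Bochner_Integration.integral_add[OF i ln_bound(1)[OF G GR]])
  finally show "ball_mean r (log_pot G) x - log_pot G x = (LINT y|lborel. indicator G y * ln_defect r (x - y))" by simp
qed

text \<open>This is the equation \<open>\<Delta> (log_pot G) = 2 \<pi> 1_G\<close> in terms of disc
  means. All four parts express that \<open>ln_defect r\<close> lives on the disc, is nonnegative
  almost everywhere and has integral \<open>pi / 4 * r\<^sup>2\<close>.\<close>

lemma ball_mean_log_pot_bounds:
  assumes r: "0 < r"
  shows "log_pot G x \<le> ball_mean r (log_pot G) x" and "ball_mean r (log_pot G) x \<le> log_pot G x + pi / 4 * r\<^sup>2"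
    and "ball x r \<subseteq> G \<Longrightarrow> ball_mean r (log_pot G) x = log_pot G x + pi / 4 * r\<^sup>2"
    and "ball x r \<inter> G = {} \<Longrightarrow> ball_mean r (log_pot G) x = log_pot G x"
proof -
  let ?I = "LINT y|lborel. indicator G y * ln_defect r (x - y)"
  have iq: "integrable lborel (\<lambda>y. ln_defect r (x - y))" by (rule integrable_lborel_reflect[OF ln_defect_integral(1)[OF r]])
  have "AE y in lborel. 0 \<le> indicator G y * ln_defect r (x - y)"
    using AE_ln_defect_nonneg[of r x] by eventually_elim auto
  then have "0 \<le> ?I" by (rule integral_nonneg_AE)
  then show "log_pot G x \<le> ball_mean r (log_pot G) x" using ball_mean_log_pot(1)[OF r, of x] by simp
  have "?I \<le> (LINT y|lborel. ln_defect r (x - y))"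
  proof (rule integral_mono_AE[OF ball_mean_log_pot(2)[OF r] iq])
    show "AE y in lborel. indicator G y * ln_defect r (x - y) \<le> ln_defect r (x - y)"
      using AE_ln_defect_nonneg[of r x] by eventually_elim (auto split: split_indicator)
  qed
  then show "ball_mean r (log_pot G) x \<le> log_pot G x + pi / 4 * r\<^sup>2"
    using ball_mean_log_pot(1)[OF r, of x] ln_defect_reflect_integral[OF r, of x] by simp
  show "ball_mean r (log_pot G) x = log_pot G x + pi / 4 * r\<^sup>2" if "ball x r \<subseteq> G"
  proof -
    have "indicator G y * ln_defect r (x - y) = ln_defect r (x - y)" for y
      using that ln_defect_outside[of r "x - y"] by (cases "y \<in> ball x r") (auto simp: dist_norm)
    then have "?I = pi * r\<^sup>2 / 4" by (simp only: ln_defect_reflect_integral[OF r])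
    then show ?thesis using ball_mean_log_pot(1)[OF r, of x] by simp
  qed
  show "ball_mean r (log_pot G) x = log_pot G x" if "ball x r \<inter> G = {}"
  proof -
    have "indicator G y * ln_defect r (x - y) = 0" for y
      using that ln_defect_outside[of r "x - y"] by (cases "y \<in> ball x r") (auto simp: dist_norm indicator_def)
    then have "?I = 0" by (simp only: Bochner_Integration.integral_zero)
    then show ?thesis using ball_mean_log_pot(1)[OF r, of x] by simp
  qed
qed

lemma log_pot_at_infinity:
  assumes x: "2 * R \<le> norm x" "0 < R"
  shows "\<bar>log_pot G x - measure lborel G * ln (norm x)\<bar> \<le> measure lborel G * (2 * R / norm x)"
proof -
  have "log_pot G x - measure lborel G * ln (norm x) = (LINT y|lborel. indicator G y * ln (norm (x - y)) - indicator G y * ln (norm x))"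
    unfolding log_pot_def
    by (subst Bochner_Integration.integral_diff[OF ln_bound(1)[OF G GR] integrable_mult_left[OF G_integrable]]) simp
  then have "\<bar>log_pot G x - measure lborel G * ln (norm x)\<bar> \<le> (LINT y|lborel. \<bar>indicator G y * ln (norm (x - y)) - indicator G y * ln (norm x)\<bar>)"
    by (simp only: integral_abs_bound)
  also have "\<dots> \<le> (LINT y|lborel. indicator G y * (2 * R / norm x))"
  proof (rule integral_mono')
    show "integrable lborel (\<lambda>y. indicator G y * (2 * R / norm x))" by (rule integrable_mult_left[OF G_integrable])
    fix y
    show "\<bar>indicator G y * ln (norm (x - y)) - indicator G y * ln (norm x)\<bar> \<le> indicator G y * (2 * R / norm x)"
    proof (cases "y \<in> G")
      case True
      then have "norm y < R" using GR by auto
      from ln_diff_bound[OF this x] True show ?thesis by simp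
    qed auto
    show "0 \<le> indicator G y * (2 * R / norm x)" using x by (intro mult_nonneg_nonneg divide_nonneg_nonneg) auto
  qed
  also have "\<dots> = measure lborel G * (2 * R / norm x)" by simp
  finally show ?thesis .
qed

end

section \<open>Local and global sub-mean value properties\<close>

text \<open>On the unit circle \<open>cnj z\<close> is the inverse of \<open>z\<close>, so
  \<open>z ^ i * cnj z ^ j\<close> collapses to a power of \<open>z\<close> or of
  \<open>cnj z\<close>; in the second case the real part permits conjugating the whole term.\<close>

lemma Re_poly_mult_cnj_circle:
  "\<exists>S :: complex poly. \<forall>z. norm z = 1 \<longrightarrow> Re (poly P z * cnj (poly Q z)) = Re (poly S z)"
proof -
  define t where "t i j = (if j \<le> i then monom (coeff P i * cnj (coeff Q j)) (i - j)
      else monom (cnj (coeff P i) * coeff Q j) (j - i))" for i j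
  have t: "Re (poly (t i j) z) = Re ((coeff P i * z ^ i) * cnj (coeff Q j * z ^ j))" if z: "norm z = 1" for i j z
  proof -
    have zz: "z * cnj z = 1" using z by (simp add: complex_norm_square[symmetric])
    have k: "z ^ n * cnj z ^ n = 1" for n using zz by (metis power_mult_distrib power_one)
    show ?thesis
    proof (cases "j \<le> i")
      case True
      have "z ^ i * cnj z ^ j = z ^ (i - j) * (z ^ j * cnj z ^ j)"
        using True by (simp add: mult.assoc[symmetric] power_add[symmetric])
      then have "(coeff P i * z ^ i) * cnj (coeff Q j * z ^ j) = coeff P i * cnj (coeff Q j) * z ^ (i - j)"
        by (simp add: k mult_ac)
      then show ?thesis using True by (simp only: t_def poly_monom if_True)
    next
      case False
      have "z ^ i * cnj z ^ j = cnj z ^ (j - i) * (z ^ i * cnj z ^ i)"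
        using False by (simp add: mult.left_commute power_add[symmetric])
      then have "(coeff P i * z ^ i) * cnj (coeff Q j * z ^ j) = cnj (cnj (coeff P i) * coeff Q j * z ^ (j - i))"
        by (simp add: k mult_ac)
      then show ?thesis using False by (simp only: t_def poly_monom if_False complex_cnj(1) cnj.sel)
    qed
  qed
  show ?thesis
  proof (intro exI[of _ "\<Sum>i\<le>degree P. \<Sum>j\<le>degree Q. t i j"] allI impI)
    fix z :: complex assume z: "norm z = 1"
    have "poly P z * cnj (poly Q z) = (\<Sum>i\<le>degree P. \<Sum>j\<le>degree Q. (coeff P i * z ^ i) * cnj (coeff Q j * z ^ j))"
      by (simp only: poly_altdef cnj_sum sum_product)
    then show "Re (poly P z * cnj (poly Q z)) = Re (poly (\<Sum>i\<le>degree P. \<Sum>j\<le>degree Q. t i j) z)"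
      by (simp only: poly_sum Re_sum t[OF z])
  qed
qed

text \<open>Every real polynomial in the two coordinates has a harmonic polynomial with the same
  values on the circle. The only step with content is the product, by
  \<open>Re a * Re b = (Re (a * b) + Re (a * cnj b)) / 2\<close>.\<close>

lemma real_polynomial_circle:
  assumes "real_polynomial_function f"
  shows "\<exists>p :: complex poly. \<forall>z. norm z = 1 \<longrightarrow> f z = Re (poly p z)"
  using assms
proof (induction rule: real_polynomial_function.induct)
  case (linear f)
  interpret bounded_linear f by fact
  have "f z = Re (poly [:0, Complex (f 1) (- f \<i>):] z)" for z
  proof -
    have "z = Re z *\<^sub>R 1 + Im z *\<^sub>R \<i>" by (simp add: complex_eq_iff)
    then have "f z = Re z * f 1 + Im z * f \<i>" by (metis add scaleR real_scaleR_def)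
    then show ?thesis by simp
  qed
  then show ?case by blast
next
  case (const c)
  have "c = Re (poly [:of_real c:] z)" for z by simp
  then show ?case by blast
next
  case (add f g)
  then obtain p q where "\<forall>z. norm z = 1 \<longrightarrow> f z = Re (poly p z)" "\<forall>z. norm z = 1 \<longrightarrow> g z = Re (poly q z)" by auto
  then show ?case by (intro exI[of _ "p + q"]) simp
next
  case (mult f g)
  then obtain p q where pq: "\<forall>z. norm z = 1 \<longrightarrow> f z = Re (poly p z)" "\<forall>z. norm z = 1 \<longrightarrow> g z = Re (poly q z)" by auto
  obtain S where S: "\<forall>z. norm z = 1 \<longrightarrow> Re (poly p z * cnj (poly q z)) = Re (poly S z)"
    using Re_poly_mult_cnj_circle by blast
  have m: "Re a * Re b = Re (a * b) / 2 + Re (a * cnj b) / 2" for a b by (simp add: field_simps)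
  show ?case
  proof (intro exI[of _ "smult (1/2) (p * q) + smult (1/2) S"] allI impI)
    fix z :: complex assume z: "norm z = 1"
    have "f z * g z = Re (poly p z * poly q z) / 2 + Re (poly S z) / 2"
      using pq S z m[of "poly p z" "poly q z"] by metis
    then show "f z * g z = Re (poly (smult (1/2) (p * q) + smult (1/2) S) z)" by simp
  qed
qed

text \<open>Stone-Weierstrass on the rescaled unit circle gives a real polynomial, which is then
  exchanged for a harmonic one with the same boundary values.\<close>

lemma dirichlet_approx:
  assumes f: "continuous_on (sphere a r) f" and r: "0 < r" and e: "0 < e"
  shows "\<exists>p :: complex poly. \<forall>z\<in>sphere a r. \<bar>f z - Re (poly p z)\<bar> < e"
proof -
  have "continuous_on (sphere 0 1) (\<lambda>w. f (a + of_real r * w))"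
    by (rule continuous_on_compose2[OF f]) (use r in \<open>auto intro!: continuous_intros simp: dist_norm norm_mult\<close>)
  then obtain g where g: "real_polynomial_function g" "\<And>w. w \<in> sphere 0 1 \<Longrightarrow> \<bar>f (a + of_real r * w) - g w\<bar> < e"
    using Stone_Weierstrass_real_polynomial_function[OF compact_sphere _ e] by blast
  obtain p where p: "\<And>w. norm w = 1 \<Longrightarrow> g w = Re (poly p w)" using real_polynomial_circle[OF g(1)] by blast
  show ?thesis
  proof (intro exI[of _ "pcompose p [:- a / of_real r, 1 / of_real r:]"] ballI)
    fix z assume z: "z \<in> sphere a r"
    define w where "w = (z - a) / of_real r"
    have w: "norm w = 1" "a + of_real r * w = z" using z r by (auto simp: w_def norm_divide dist_norm norm_minus_commute)
    have "poly (pcompose p [:- a / of_real r, 1 / of_real r:]) z = poly p w"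
      by (simp add: poly_pcompose w_def diff_divide_distrib)
    then show "\<bar>f z - Re (poly (pcompose p [:- a / of_real r, 1 / of_real r:]) z)\<bar> < e"
      using g(2)[of w] p[OF w(1)] w by simp
  qed
qed

lemma integral_circle_power:
  "(LINT t|lborel. indicator {0..2*pi} t *\<^sub>R cis t ^ n) = (if n = 0 then of_real (2 * pi) else 0)"
proof (cases "n = 0")
  case False
  have "(LINT t|lborel. indicator {0..2*pi} t *\<^sub>R cis (real n * t)) = (cis (real n * (2*pi)) - cis (real n * 0)) / (\<i> * of_nat n)"
    unfolding diff_divide_distrib
  proof (rule integral_FTC_Icc)
    show "((\<lambda>t. cis (real n * t) / (\<i> * of_nat n)) has_vector_derivative cis (real n * t)) (at t within {0..2*pi})" for t
      using False unfolding cis_conv_exp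
      by (auto intro!: derivative_eq_intros has_vector_derivative_real_field simp: field_simps)
    show "continuous_on {0..2*pi} (\<lambda>t. cis (real n * t))" by (intro continuous_intros)
  qed auto
  moreover have "cis (real n * (2*pi)) = 1" using cis_multiple_2pi[of "real n"] by (simp add: mult_ac)
  ultimately show ?thesis using False by (simp add: Complex.DeMoivre)
qed (simp add: scaleR_conv_of_real)

lemma integrable_circle: "continuous_on UNIV f \<Longrightarrow> integrable lborel (\<lambda>t::real. indicator {0..2*pi} t *\<^sub>R (f (cis t) :: 'b :: {banach, second_countable_topology}))"
  by (intro borel_integrable_compact) (auto intro!: continuous_intros continuous_on_compose2[of UNIV f])

lemma integral_circle_poly:
  "(LINT t|lborel. indicator {0..2*pi} t *\<^sub>R poly p (cis t)) = of_real (2 * pi) * poly p 0"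
proof -
  have e: "indicator {0..2*pi} t *\<^sub>R poly p (cis t) = (\<Sum>i\<le>degree p. coeff p i * (indicator {0..2*pi} t *\<^sub>R cis t ^ i))" for t
    by (simp add: poly_altdef scaleR_sum_right)
  have int: "integrable lborel (\<lambda>t. indicator {0..2*pi} t *\<^sub>R cis t ^ i)" for i
    by (rule integrable_circle[of "\<lambda>z. z ^ i"]) (intro continuous_intros)
  have "(LINT t|lborel. indicator {0..2*pi} t *\<^sub>R poly p (cis t)) = (\<Sum>i\<le>degree p. coeff p i * (if i = 0 then of_real (2 * pi) else 0))"
    unfolding e by (subst Bochner_Integration.integral_sum)
      (intro integrable_mult_right int, simp only: Bochner_Integration.integral_mult_right_zero integral_circle_power)
  also have "\<dots> = (\<Sum>i\<le>degree p. if i = 0 then coeff p 0 * of_real (2 * pi) else 0)" by (intro sum.cong) auto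
  also have "\<dots> = of_real (2 * pi) * poly p 0" by (simp add: poly_0_coeff_0)
  finally show ?thesis .
qed

text \<open>The weak form is deliberate: the radius may depend on the point, as it must for
  functions glued from pieces, and the slack \<open>e * r\<^sup>2\<close> is what points of density
  zero can supply. For continuous functions \<open>submean_global\<close> recovers the full
  property.\<close>

definition local_submean :: "(complex \<Rightarrow> real) \<Rightarrow> bool" where
  "local_submean u \<longleftrightarrow> (\<forall>x. \<forall>e>0. \<forall>r0>0. \<exists>r. 0 < r \<and> r < r0 \<and> u x \<le> ball_mean r u x + e * r\<^sup>2)"

text \<open>Adding \<open>b * (norm (y - a))\<^sup>2\<close> gains \<open>b / 2 * s\<^sup>2\<close>
  in each disc mean. This beats a slack of \<open>b / 4 * s\<^sup>2\<close> and rules out an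
  interior maximum, while \<open>b = d / r\<^sup>2\<close> perturbs the function by at most
  \<open>d\<close>.\<close>

lemma max_principle:
  assumes w: "continuous_on UNIV w" "local_submean w" and r: "0 < r"
    and bd: "\<And>z. z \<in> sphere a r \<Longrightarrow> w z \<le> 0" and z: "z \<in> cball a r"
  shows "w z \<le> 0"
proof -
  have "w z \<le> 0 + d" if d: "0 < d" for d
  proof -
    define b where "b = d / r\<^sup>2"
    have b: "0 < b" using d r by (simp add: b_def)
    define W where "W y = w y + b * (norm (y - a))\<^sup>2" for y
    have cW: "continuous_on UNIV W" unfolding W_def by (intro continuous_intros w)
    have "\<exists>y\<in>cball a r. \<forall>v\<in>cball a r. W v \<le> W y"
      by (rule continuous_attains_sup) (use cW r in \<open>auto intro: continuous_on_subset\<close>)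
    then obtain y where y: "y \<in> cball a r" and ymax: "\<And>v. v \<in> cball a r \<Longrightarrow> W v \<le> W y" by blast
    have "y \<in> sphere a r"
    proof (rule ccontr)
      assume "y \<notin> sphere a r"
      then have "0 < r - dist a y" using y by auto
      moreover have "0 < b / 4" using b by simp
      ultimately obtain s where s: "0 < s" "s < r - dist a y" "w y \<le> ball_mean s w y + b / 4 * s\<^sup>2"
        using w(2) unfolding local_submean_def by blast
      have "ball_mean s W y = ball_mean s w y + ball_mean s (\<lambda>v. b * (norm (v - a))\<^sup>2) y"
        unfolding W_def by (intro ball_mean_add mean_integrable_cont continuous_intros w)
      also have "\<dots> = ball_mean s w y + b * ((norm (y - a))\<^sup>2 + s\<^sup>2 / 2)" by (simp only: ball_mean_cmult ball_mean_norm_sq[OF s(1)])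
      finally have "W y + b / 4 * s\<^sup>2 \<le> ball_mean s W y" using s(3) by (simp add: W_def algebra_simps)
      moreover have "ball_mean s W y \<le> ball_mean s (\<lambda>_. W y) y"
      proof (intro ball_mean_mono mean_integrable_cont cW)
        fix v assume "v \<in> ball y s"
        then have "v \<in> cball a r" using s(2) dist_triangle[of a v y] by auto
        then show "W v \<le> W y" by (rule ymax)
      qed auto
      ultimately have "b / 4 * s\<^sup>2 \<le> 0" by (simp add: ball_mean_const[OF s(1)])
      then show False using b s(1) by (simp add: mult_le_0_iff)
    qed
    then have "W y \<le> b * r\<^sup>2" using bd[of y] by (simp add: W_def dist_norm norm_minus_commute)
    moreover have "w z \<le> W z" using b by (simp add: W_def)
    ultimately have "w z \<le> b * r\<^sup>2" using ymax[OF z] by linarith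
    then show ?thesis using r by (simp add: b_def)
  qed
  then show ?thesis by (rule field_le_epsilon)
qed

lemma local_submean_diff_poly:
  assumes "continuous_on UNIV u" "local_submean u"
  shows "local_submean (\<lambda>z. u z - Re (poly p z))"
  unfolding local_submean_def
proof (intro allI impI)
  fix x and e r0 :: real assume "0 < e" "0 < r0"
  then obtain r where r: "0 < r" "r < r0" "u x \<le> ball_mean r u x + e * r\<^sup>2" using assms(2) unfolding local_submean_def by blast
  have "ball_mean r (\<lambda>z. u z - Re (poly p z)) x = ball_mean r u x - Re (poly p x)"
    by (subst ball_mean_diff) (auto intro!: mean_integrable_cont assms continuous_intros simp: ball_mean_Re_poly[OF r(1)])
  then show "\<exists>r. 0 < r \<and> r < r0 \<and> u x - Re (poly p x) \<le> ball_mean r (\<lambda>z. u z - Re (poly p z)) x + e * r\<^sup>2"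
    using r by (intro exI[of _ r]) auto
qed

lemma poly_majorant:
  assumes u: "continuous_on UNIV u" "local_submean u" and r: "0 < r"
    and bd: "\<And>z. z \<in> sphere a r \<Longrightarrow> u z \<le> Re (poly p z)" and z: "z \<in> cball a r"
  shows "u z \<le> Re (poly p z)"
  using max_principle[OF _ local_submean_diff_poly[OF u, of p] r _ z] bd u(1)
  by (force intro!: continuous_intros)

text \<open>A harmonic polynomial lies above \<open>u\<close> on the circle by at most
  \<open>2 * e\<close>. The maximum principle carries the bound to the centre, where the polynomial
  is its own circle mean.\<close>

lemma circle_submean:
  assumes u: "continuous_on UNIV u" "local_submean u"
  shows "2 * pi * u a \<le> (LINT t|lborel. indicator {0..2*pi} t * u (a + w * cis t))"
proof (cases "w = 0")
  case False
  have "2 * pi * u a \<le> (LINT t|lborel. indicator {0..2*pi} t * u (a + w * cis t)) + d" if d: "0 < d" for d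
  proof -
    define e where "e = d / (4 * pi)"
    have e: "0 < e" using d by (simp add: e_def)
    define r where "r = norm w"
    have r: "0 < r" using False by (simp add: r_def)
    obtain p where p: "\<And>z. z \<in> sphere a r \<Longrightarrow> \<bar>u z - Re (poly p z)\<bar> < e"
      using dirichlet_approx[OF continuous_on_subset[OF u(1)] r e, of a] by blast
    define q where "q = p + [:of_real e:]"
    have "u z \<le> Re (poly q z)" if "z \<in> sphere a r" for z using p[OF that] by (simp add: q_def)
    then have ua: "u a \<le> Re (poly q a)" by (rule poly_majorant[OF u r]) (use r in auto)
    let ?s = "pcompose q [:a, w:]"
    have s: "poly ?s (cis t) = poly q (a + w * cis t)" for t by (simp add: poly_pcompose mult.commute)
    have is': "integrable lborel (\<lambda>t. indicator {0..2*pi} t *\<^sub>R poly ?s (cis t))"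
      by (rule integrable_circle) (intro continuous_intros)
    have iR: "integrable lborel (\<lambda>t. indicator {0..2*pi} t * Re (poly q (a + w * cis t)))"
      using integrable_Re[OF is'] by (simp add: s)
    have iu: "integrable lborel (\<lambda>t. indicator {0..2*pi} t * u (a + w * cis t))"
      using integrable_circle[of "\<lambda>z. u (a + w * z)"] u(1)
      by (simp add: continuous_on_compose2[OF u(1)] continuous_intros)
    have "2 * pi * u a \<le> 2 * pi * Re (poly q a)" using ua by simp
    also have "\<dots> = Re (LINT t|lborel. indicator {0..2*pi} t *\<^sub>R poly ?s (cis t))"
      unfolding integral_circle_poly by (simp add: poly_pcompose)
    also have "\<dots> = (LINT t|lborel. indicator {0..2*pi} t * Re (poly q (a + w * cis t)))"
      by (subst integral_Re[OF is', symmetric]) (simp add: s)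
    also have "\<dots> \<le> (LINT t|lborel. indicator {0..2*pi} t * u (a + w * cis t) + indicator {0..2*pi} t * (2 * e))"
    proof (rule integral_mono[OF iR])
      show "integrable lborel (\<lambda>t. indicator {0..2*pi} t * u (a + w * cis t) + indicator {0..2*pi} t * (2 * e))"
        by (intro Bochner_Integration.integrable_add iu integrable_mult_left) auto
      fix t :: real
      have "a + w * cis t \<in> sphere a r" by (simp add: dist_norm norm_mult r_def)
      from p[OF this] show "indicator {0..2*pi} t * Re (poly q (a + w * cis t)) \<le> indicator {0..2*pi} t * u (a + w * cis t) + indicator {0..2*pi} t * (2 * e)"
        by (auto simp: q_def split: split_indicator)
    qed
    also have "\<dots> = (LINT t|lborel. indicator {0..2*pi} t * u (a + w * cis t)) + 2 * pi * (2 * e)"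
      by (subst Bochner_Integration.integral_add[OF iu]) auto
    finally show ?thesis by (simp add: e_def)
  qed
  then show ?thesis by (rule field_le_epsilon)
qed simp

text \<open>The circle inequality is integrated over all starting points \<open>w\<close> in the
  disc. After exchanging the integrals, each fixed angle only rotates the disc, so every inner
  integral is the same disc mean.\<close>

lemma submean_global:
  assumes u: "continuous_on UNIV u" "local_submean u" and r: "0 < r"
  shows "u a \<le> ball_mean r u a"
proof -
  have [measurable]: "u \<in> borel_measurable borel" by (rule borel_measurable_continuous_onI[OF u(1)])
  have [measurable]: "cis \<in> borel_measurable borel" by (intro borel_measurable_continuous_onI continuous_intros)
  have [measurable]: "ball (0::complex) r \<in> sets borel" by simp
  have ib: "integrable lborel (indicator (ball (0::complex) r) :: complex \<Rightarrow> real)"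
    using r by (simp add: emeasure_ball_complex)
  define f where "f w t = indicator (ball 0 r) w * (indicator {0..2*pi} t * u (a + w * cis t))" for w t
  obtain C where C: "\<And>z. z \<in> cball a r \<Longrightarrow> norm (u z) \<le> C"
    using compact_imp_bounded[OF compact_continuous_image[OF continuous_on_subset[OF u(1)] compact_cball[of a r]]]
    unfolding bounded_iff by blast
  have b: "norm (f w t) \<le> (C * indicator (ball 0 r) w) * indicator {0..2*pi} t" for w t
    using C[of "a + w * cis t"] by (auto simp: f_def dist_norm norm_mult split: split_indicator)
  have iu: "integrable lborel (\<lambda>t. indicator {0..2*pi} t * u (a + w * cis t))" for w
    using integrable_circle[of "\<lambda>z. u (a + w * z)"] u(1)
    by (simp add: continuous_on_compose2[OF u(1)] continuous_intros)
  have ift: "integrable lborel (f w)" for w unfolding f_def by (intro integrable_mult_right iu)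
  have int: "integrable (lborel \<Otimes>\<^sub>M lborel) (case_prod f)"
  proof (rule lborel_pair.Fubini_integrable)
    show "case_prod f \<in> borel_measurable (lborel \<Otimes>\<^sub>M lborel)" unfolding f_def by measurable
    show "AE w in lborel. integrable lborel (\<lambda>t. case (w, t) of (w, t) \<Rightarrow> f w t)" using ift by simp
    show "integrable lborel (\<lambda>w. LINT t|lborel. norm (case (w, t) of (w, t) \<Rightarrow> f w t))"
    proof (rule Bochner_Integration.integrable_bound[OF integrable_mult_right[of "2 * pi * C", OF ib]])
      show "(\<lambda>w. LINT t|lborel. norm (case (w, t) of (w, t) \<Rightarrow> f w t)) \<in> borel_measurable lborel"
        unfolding f_def by measurable
      show "AE w in lborel. norm (LINT t|lborel. norm (case (w, t) of (w, t) \<Rightarrow> f w t)) \<le> norm (2 * pi * C * indicator (ball 0 r) w)"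
      proof (rule AE_I2)
        fix w :: complex
        have "(LINT t|lborel. norm (f w t)) \<le> (LINT t|lborel. (C * indicator (ball 0 r) w) * indicator {0..2*pi} t)"
          by (rule integral_mono[OF integrable_norm[OF ift] _ b]) simp
        also have "\<dots> = 2 * pi * C * indicator (ball 0 r) w" by simp
        finally have l: "(LINT t|lborel. norm (f w t)) \<le> 2 * pi * C * indicator (ball 0 r) w" .
        have "0 \<le> (LINT t|lborel. norm (f w t))" by (rule integral_nonneg_AE) auto
        then show "norm (LINT t|lborel. norm (case (w, t) of (w, t) \<Rightarrow> f w t)) \<le> norm (2 * pi * C * indicator (ball 0 r) w)"
          using l by simp
      qed
    qed
  qed
  have "2 * pi * u a * (pi * r\<^sup>2) = (LINT w|lborel. indicator (ball (0::complex) r) w * (2 * pi * u a))"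
    using r by (simp add: measure_def emeasure_ball_complex)
  also have "\<dots> \<le> (LINT w|lborel. LINT t|lborel. f w t)"
  proof (rule integral_mono)
    show "integrable lborel (\<lambda>w. LINT t|lborel. f w t)" using lborel_pair.integrable_fst[OF int] .
    show "indicator (ball 0 r) w * (2 * pi * u a) \<le> (LINT t|lborel. f w t)" for w
      using circle_submean[OF u, of a w] by (auto simp: f_def split: split_indicator)
  qed (use ib in auto)
  also have "\<dots> = (LINT t|lborel. LINT w|lborel. f w t)"
    by (rule lborel_pair.Fubini_integral[OF int, symmetric])
  also have "\<dots> = (LINT t|lborel. indicator {0..2*pi} t * (ball_mean r u a * (pi * r\<^sup>2)))"
  proof (intro Bochner_Integration.integral_cong refl)
    fix t :: real
    have "(LINT w|lborel. f w t) = indicator {0..2*pi} t * (LINT w|lborel. indicator (ball 0 r) w * u (a + cis t * w))"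
    proof -
      have "f w t = indicator {0..2*pi} t * (indicator (ball 0 r) w * u (a + cis t * w))" for w
        by (simp add: f_def mult_ac)
      then show ?thesis by (simp only: Bochner_Integration.integral_mult_right_zero)
    qed
    also have "(LINT w|lborel. indicator (ball 0 r) w * u (a + cis t * w)) = (LINT w|lborel. indicator (ball 0 r) (cis t * w) * u (a + cis t * w))"
      by (intro Bochner_Integration.integral_cong) (auto simp: norm_mult split: split_indicator)
    also have "\<dots> = (LINT w|lborel. indicator (ball 0 r) w * u (a + w))"
      by (rule integral_lborel_rotate) auto
    also have "\<dots> = ball_mean r u a * (pi * r\<^sup>2)" using r by (simp add: ball_mean_def)
    finally show "(LINT w|lborel. f w t) = indicator {0..2*pi} t * (ball_mean r u a * (pi * r\<^sup>2))" .
  qed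
  also have "\<dots> = 2 * pi * ball_mean r u a * (pi * r\<^sup>2)" by simp
  finally show ?thesis using r by simp
qed

section \<open>The obstacle problem\<close>

definition minorants :: "(complex \<Rightarrow> real) \<Rightarrow> (complex \<Rightarrow> real) set" where
  "minorants p = {v. continuous_on UNIV v \<and> (\<forall>x. v x \<le> p x) \<and> (\<forall>x r. 0 < r \<longrightarrow> v x \<le> ball_mean r v x + pi / 4 * r\<^sup>2)}"

definition obstacle_sol :: "(complex \<Rightarrow> real) \<Rightarrow> complex \<Rightarrow> real" where
  "obstacle_sol p x = (SUP v\<in>minorants p. v x)"

lemma ball_mean_add_norm_sq:
  assumes "continuous_on UNIV v" "0 < r"
  shows "ball_mean r (\<lambda>z. v z + c * (norm z)\<^sup>2) x = ball_mean r v x + c * ((norm x)\<^sup>2 + r\<^sup>2 / 2)"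
proof -
  have "ball_mean r (\<lambda>z. v z + c * (norm z)\<^sup>2) x = ball_mean r v x + ball_mean r (\<lambda>z. c * (norm z)\<^sup>2) x"
    by (intro ball_mean_add mean_integrable_cont continuous_intros assms)
  then show ?thesis using ball_mean_norm_sq[OF assms(2), of 0 x] by (simp add: ball_mean_cmult)
qed

text \<open>Adding \<open>pi / 2 * (norm z)\<^sup>2\<close>, whose disc means exceed its values by
  exactly \<open>pi / 4 * r\<^sup>2\<close>, turns the constraint into a sub-mean value property,
  for which the local form implies the global one.\<close>

lemma minorants_local:
  assumes v: "continuous_on UNIV v" "\<And>x. v x \<le> p x"
    and loc: "\<And>x e r0. 0 < e \<Longrightarrow> 0 < r0 \<Longrightarrow> \<exists>r. 0 < r \<and> r < r0 \<and> v x \<le> ball_mean r v x + pi / 4 * r\<^sup>2 + e * r\<^sup>2"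
  shows "v \<in> minorants p"
  unfolding minorants_def
proof (intro CollectI conjI allI impI v)
  let ?u = "\<lambda>z. v z + pi / 2 * (norm z)\<^sup>2"
  have cu: "continuous_on UNIV ?u" by (intro continuous_intros v)
  have lu: "local_submean ?u"
    unfolding local_submean_def
  proof (intro allI impI)
    fix x :: complex and e r0 :: real assume "0 < e" "0 < r0"
    then obtain r where r: "0 < r" "r < r0" "v x \<le> ball_mean r v x + pi / 4 * r\<^sup>2 + e * r\<^sup>2" using loc by blast
    then show "\<exists>r. 0 < r \<and> r < r0 \<and> ?u x \<le> ball_mean r ?u x + e * r\<^sup>2"
      by (intro exI[of _ r], subst ball_mean_add_norm_sq[OF v(1) r(1)]) (simp add: algebra_simps)
  qed
  fix x and r :: real assume r: "0 < r"
  show "v x \<le> ball_mean r v x + pi / 4 * r\<^sup>2"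
    using submean_global[OF cu lu r, of x] unfolding ball_mean_add_norm_sq[OF v(1) r] by (simp add: algebra_simps)
qed

text \<open>Where \<open>w\<close> equals \<open>v\<close> the inequality is inherited from
  \<open>v\<close>, since the mean of \<open>w\<close> is at least that of \<open>v\<close>. Hence a
  competitor obtained by raising a minorant needs checking only where it was raised, and not at the
  seam.\<close>

lemma minorants_glue:
  assumes v: "v \<in> minorants p" and w: "continuous_on UNIV w" "\<And>x. w x \<le> p x" "\<And>x. v x \<le> w x"
    and loc: "\<And>x r0. w x \<noteq> v x \<Longrightarrow> 0 < r0 \<Longrightarrow> \<exists>r. 0 < r \<and> r < r0 \<and> w x \<le> ball_mean r w x + pi / 4 * r\<^sup>2"
  shows "w \<in> minorants p"
proof (rule minorants_local[OF w(1,2)])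
  fix x and e r0 :: real assume e: "0 < e" "0 < r0"
  show "\<exists>r. 0 < r \<and> r < r0 \<and> w x \<le> ball_mean r w x + pi / 4 * r\<^sup>2 + e * r\<^sup>2"
  proof (cases "w x = v x")
    case True
    have r: "0 < r0 / 2" using e by simp
    have "v x \<le> ball_mean (r0 / 2) v x + pi / 4 * (r0 / 2)\<^sup>2" using v r unfolding minorants_def by blast
    also have "ball_mean (r0 / 2) v x \<le> ball_mean (r0 / 2) w x"
      using v w by (intro ball_mean_mono mean_integrable_cont) (auto simp: minorants_def)
    finally show ?thesis using True e by (intro exI[of _ "r0 / 2"]) (auto intro: add_increasing2)
  next
    case False
    then obtain r where "0 < r" "r < r0" "w x \<le> ball_mean r w x + pi / 4 * r\<^sup>2" using loc e by blast
    then show ?thesis using e by (intro exI[of _ r]) (auto intro: add_increasing2)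
  qed
qed

context
  fixes p :: "complex \<Rightarrow> real" and L :: real
  assumes lip: "\<And>x y. p x \<le> p y + L * norm (x - y)" and L: "0 \<le> L" and ne: "minorants p \<noteq> {}"
begin

lemma p_cont: "continuous_on S p"
proof -
  have "\<bar>p x - p y\<bar> \<le> L * norm (x - y)" for x y
    using lip[of x y] lip[of y x] by (simp add: norm_minus_commute abs_le_iff)
  then have "L-lipschitz_on S p" using L by (intro lipschitz_onI) (auto simp: dist_norm)
  then show ?thesis by (rule lipschitz_on_continuous_on)
qed

lemma obstacle_sol_bdd: "bdd_above ((\<lambda>v. v x) ` minorants p)"
  by (rule bdd_aboveI[of _ "p x"]) (auto simp: minorants_def)

lemma obstacle_sol_upper: "v \<in> minorants p \<Longrightarrow> v x \<le> obstacle_sol p x"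
  unfolding obstacle_sol_def by (rule cSUP_upper[OF _ obstacle_sol_bdd])

lemma obstacle_sol_least: "(\<And>v. v \<in> minorants p \<Longrightarrow> v x \<le> c) \<Longrightarrow> obstacle_sol p x \<le> c"
  unfolding obstacle_sol_def by (rule cSUP_least[OF ne])

lemma obstacle_sol_le: "obstacle_sol p x \<le> p x"
  by (rule obstacle_sol_least) (simp add: minorants_def)

text \<open>Lowering a translate by \<open>L * norm h\<close> makes up for the change of the
  obstacle. So the supremum inherits the Lipschitz constant of \<open>p\<close>, which is how it
  comes to be continuous and itself a minorant.\<close>

lemma minorants_shift:
  assumes v: "v \<in> minorants p"
  shows "(\<lambda>z. v (h + z) - L * norm h) \<in> minorants p"
proof -
  have c: "continuous_on UNIV v" using v by (simp add: minorants_def)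
  have c': "continuous_on UNIV (\<lambda>z. v (h + z))"
    by (rule continuous_on_compose2[OF c]) (auto intro!: continuous_intros)
  show ?thesis
    unfolding minorants_def
  proof (intro CollectI conjI allI impI)
    show "continuous_on UNIV (\<lambda>z. v (h + z) - L * norm h)" by (intro continuous_intros c')
    fix x
    have "v (h + x) \<le> p (h + x)" using v by (simp add: minorants_def)
    also have "\<dots> \<le> p x + L * norm h" using lip[of "h + x" x] by simp
    finally show "v (h + x) - L * norm h \<le> p x" by simp
    fix r :: real assume r: "0 < r"
    have "ball_mean r (\<lambda>z. v (h + z) - L * norm h) x = ball_mean r v (h + x) - L * norm h"
      by (subst ball_mean_diff[OF mean_integrable_cont[OF c'] mean_integrable_const]) (simp add: ball_mean_translate ball_mean_const[OF r])
    then show "v (h + x) - L * norm h \<le> ball_mean r (\<lambda>z. v (h + z) - L * norm h) x + pi / 4 * r\<^sup>2"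
      using v r by (simp add: minorants_def)
  qed
qed

lemma obstacle_sol_lipschitz: "obstacle_sol p x \<le> obstacle_sol p y + L * norm (x - y)"
proof (rule obstacle_sol_least)
  fix v assume "v \<in> minorants p"
  from obstacle_sol_upper[OF minorants_shift[OF this, of "x - y"], of y] show "v x \<le> obstacle_sol p y + L * norm (x - y)" by simp
qed

lemma obstacle_sol_cont: "continuous_on S (obstacle_sol p)"
proof -
  have "\<bar>obstacle_sol p x - obstacle_sol p y\<bar> \<le> L * norm (x - y)" for x y
    using obstacle_sol_lipschitz[of x y] obstacle_sol_lipschitz[of y x] by (simp add: norm_minus_commute abs_le_iff)
  then have "L-lipschitz_on S (obstacle_sol p)" using L by (intro lipschitz_onI) (auto simp: dist_norm)
  then show ?thesis by (rule lipschitz_on_continuous_on)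
qed

lemma obstacle_sol_submean: "0 < r \<Longrightarrow> obstacle_sol p x \<le> ball_mean r (obstacle_sol p) x + pi / 4 * r\<^sup>2"
proof (rule obstacle_sol_least)
  fix v assume r: "0 < r" and v: "v \<in> minorants p"
  then have "v x \<le> ball_mean r v x + pi / 4 * r\<^sup>2" by (simp add: minorants_def)
  also have "ball_mean r v x \<le> ball_mean r (obstacle_sol p) x"
    using v obstacle_sol_cont obstacle_sol_upper by (intro ball_mean_mono mean_integrable_cont) (auto simp: minorants_def)
  finally show "v x \<le> ball_mean r (obstacle_sol p) x + pi / 4 * r\<^sup>2" by simp
qed

lemma obstacle_sol_in_minorants: "obstacle_sol p \<in> minorants p"
  using obstacle_sol_cont obstacle_sol_le obstacle_sol_submean by (simp add: minorants_def)

text \<open>Perron's harmonic lifting, with harmonic polynomials that approximate the boundary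
  values in place of the solution of the Dirichlet problem.\<close>
lemma obstacle_sol_harmonic:
  assumes x0: "obstacle_sol p x0 < p x0"
  shows "\<exists>R>0. \<forall>x r. 0 < r \<and> cball x r \<subseteq> cball x0 R \<longrightarrow> obstacle_sol p x = ball_mean r (obstacle_sol p) x + pi / 4 * r\<^sup>2"
proof -
  define Q where "Q z = pi / 2 * (norm z)\<^sup>2" for z :: complex
  have cQ: "continuous_on S Q" for S unfolding Q_def by (intro continuous_intros)
  define s where "s z = obstacle_sol p z + Q z" for z
  define ps where "ps z = p z + Q z" for z
  have cs: "continuous_on S s" for S unfolding s_def by (intro continuous_intros obstacle_sol_cont cQ)
  have cps: "continuous_on S ps" for S unfolding ps_def by (intro continuous_intros p_cont cQ)
  have bs: "ball_mean r s x = ball_mean r (obstacle_sol p) x + Q x + pi / 4 * r\<^sup>2" if "0 < r" for r x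
    using ball_mean_add_norm_sq[OF obstacle_sol_cont that, of "pi / 2" x] by (simp add: s_def[abs_def] Q_def algebra_simps)
  have ls: "local_submean s"
    unfolding local_submean_def
  proof (intro allI impI)
    fix x :: complex and e r0 :: real assume e: "0 < e" "0 < r0"
    have "s x \<le> ball_mean (r0 / 2) s x" using obstacle_sol_submean[of "r0/2" x] e bs[of "r0/2" x] by (simp add: s_def)
    then show "\<exists>r. 0 < r \<and> r < r0 \<and> s x \<le> ball_mean r s x + e * r\<^sup>2"
      using e by (intro exI[of _ "r0/2"]) (auto intro: add_increasing2)
  qed
  define d where "d = ps x0 - s x0"
  have d: "0 < d" using x0 by (simp add: d_def ps_def s_def)
  have "isCont s x0" "isCont ps x0" using cs[of UNIV] cps[of UNIV] by (auto simp: continuous_on_eq_continuous_at)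
  then obtain d1 d2 where d1: "0 < d1" "\<And>z. dist z x0 < d1 \<Longrightarrow> \<bar>s z - s x0\<bar> < d / 4"
    and d2: "0 < d2" "\<And>z. dist z x0 < d2 \<Longrightarrow> \<bar>ps z - ps x0\<bar> < d / 4"
    unfolding continuous_at_eps_delta dist_real_def using d by (metis divide_pos_pos zero_less_numeral)
  \<comment> \<open>On this disc the oscillation is below a quarter of the gap: the harmonic
    replacement stays under \<open>s x0 + d / 4\<close> by the maximum principle, and the shifted
    obstacle stays above \<open>s x0 + 3 / 4 * d\<close>.\<close>
  define R where "R = min d1 d2 / 2"
  have R: "0 < R" using d1 d2 by (simp add: R_def)
  have near: "s z < s x0 + d / 4 \<and> ps x0 - d / 4 < ps z" if "z \<in> cball x0 R" for z
  proof -
    have D: "dist z x0 < d1" "dist z x0 < d2" using that d1 d2 by (auto simp: R_def dist_commute)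
    show ?thesis using d1(2)[OF D(1)] d2(2)[OF D(2)] by linarith
  qed
  have approx: "\<exists>q. \<forall>z\<in>cball x0 R. \<bar>s z - Re (poly q z)\<bar> \<le> e" if e: "0 < e" for e
  proof -
    obtain q where q: "\<And>z. z \<in> sphere x0 R \<Longrightarrow> \<bar>s z - Re (poly q z)\<bar> < e"
      using dirichlet_approx[OF cs R e] by blast
    \<comment> \<open>Lowering by \<open>e\<close> puts \<open>h\<close> strictly below
      \<open>s\<close> on the circle, so that the lifted function joins \<open>obstacle_sol\<close>
      continuously there.\<close>
    define h where "h z = Re (poly q z) - e" for z
    have hq: "h z = Re (poly (q - [:of_real e:]) z)" for z by (simp add: h_def)
    have ch: "continuous_on S h" for S unfolding h_def by (intro continuous_intros)
    have bh: "ball_mean r h x = h x" if "0 < r" for r x 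
    proof -
      have "h = (\<lambda>z. Re (poly (q - [:of_real e:]) z))" by (rule ext) (rule hq)
      then show ?thesis by (simp only: ball_mean_Re_poly[OF that])
    qed
    have lh: "local_submean h" unfolding local_submean_def
    proof (intro allI impI)
      fix x :: complex and e r0 :: real assume e: "0 < e" "0 < r0"
      then show "\<exists>r. 0 < r \<and> r < r0 \<and> h x \<le> ball_mean r h x + e * r\<^sup>2"
        by (intro exI[of _ "r0/2"]) (auto simp: bh)
    qed
    have hs: "h z < s z" if "z \<in> sphere x0 R" for z using q[OF that] by (simp add: h_def)
    have hps: "h z \<le> ps z" if z: "z \<in> cball x0 R" for z
    proof -
      have "h y \<le> Re (poly [:of_real (s x0 + d / 4):] y)" if "y \<in> sphere x0 R" for y
        using hs[OF that] near[of y] that by simp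
      then have "h z \<le> Re (poly [:of_real (s x0 + d / 4):] z)"
        by (rule poly_majorant[OF ch lh R _ z])
      then have "h z \<le> s x0 + d / 4" by simp
      then show ?thesis using near[OF z] d d_def by linarith
    qed
    define w where "w z = (if z \<in> cball x0 R then max (obstacle_sol p z) (h z - Q z) else obstacle_sol p z)" for z
    have "continuous_on (cball x0 R \<union> - ball x0 R) w"
      unfolding w_def
    proof (rule continuous_on_cases)
      show "continuous_on (cball x0 R) (\<lambda>z. max (obstacle_sol p z) (h z - Q z))"
        by (intro continuous_intros obstacle_sol_cont ch cQ)
      show "continuous_on (- ball x0 R) (obstacle_sol p)" by (rule obstacle_sol_cont)
      show "\<forall>z. z \<in> cball x0 R \<and> z \<notin> cball x0 R \<or> z \<in> - ball x0 R \<and> z \<in> cball x0 R \<longrightarrow> max (obstacle_sol p z) (h z - Q z) = obstacle_sol p z"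
      proof (intro allI impI)
        fix z assume "z \<in> cball x0 R \<and> z \<notin> cball x0 R \<or> z \<in> - ball x0 R \<and> z \<in> cball x0 R"
        then have "z \<in> sphere x0 R" by auto
        from hs[OF this] show "max (obstacle_sol p z) (h z - Q z) = obstacle_sol p z" by (simp add: s_def)
      qed
    qed auto
    moreover have "cball x0 R \<union> - ball x0 R = UNIV" by auto
    ultimately have cw: "continuous_on UNIV w" by simp
    have wv: "obstacle_sol p z \<le> w z" for z by (simp add: w_def)
    have "w \<in> minorants p"
    proof (rule minorants_glue[OF obstacle_sol_in_minorants cw])
      show "w x \<le> p x" for x using hps[of x] obstacle_sol_le[of x] by (auto simp: w_def ps_def)
      show "obstacle_sol p x \<le> w x" for x by (rule wv)
      fix x and r0 :: real assume wx: "w x \<noteq> obstacle_sol p x" and r0: "0 < r0"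
      then have x: "x \<in> cball x0 R" "w x = h x - Q x" "obstacle_sol p x < h x - Q x" by (auto simp: w_def max_def split: if_splits)
      then have "x \<notin> sphere x0 R" using hs[of x] by (auto simp: s_def)
      then have "0 < R - dist x0 x" using x(1) by auto
      define r where "r = min r0 (R - dist x0 x) / 2"
      have r: "0 < r" "r < r0" "r < R - dist x0 x" using r0 \<open>0 < R - dist x0 x\<close> by (auto simp: r_def)
      have "ball_mean r (\<lambda>z. h z - Q z) x = h x - Q x - pi / 4 * r\<^sup>2"
      proof -
        have "(\<lambda>z. h z - Q z) = (\<lambda>z. h z + (- pi / 2) * (norm z)\<^sup>2)" by (simp add: Q_def)
        then show ?thesis
          by (simp only: ball_mean_add_norm_sq[OF ch r(1)] bh[OF r(1)]) (simp add: Q_def algebra_simps)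
      qed
      moreover have "ball_mean r (\<lambda>z. h z - Q z) x \<le> ball_mean r w x"
      proof (intro ball_mean_mono mean_integrable_cont cw continuous_intros ch cQ)
        fix y assume "y \<in> ball x r"
        then have "dist x0 y < R" using dist_triangle[of x0 y x] r(3) by simp
        then show "h y - Q y \<le> w y" by (simp add: w_def)
      qed
      ultimately show "\<exists>r. 0 < r \<and> r < r0 \<and> w x \<le> ball_mean r w x + pi / 4 * r\<^sup>2"
        using r x(2) by (intro exI[of _ r]) auto
    qed
    \<comment> \<open>Maximality of the solution gives \<open>h \<le> s\<close> on the disc; the
      opposite bound \<open>s \<le> h + 2 * e\<close> is the maximum principle for \<open>s\<close>.
      Together they make \<open>s\<close> a uniform limit of harmonic polynomials.\<close>
    then have wle: "w z \<le> obstacle_sol p z" for z by (rule obstacle_sol_upper)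
    have lo: "h z \<le> s z" if "z \<in> cball x0 R" for z
    proof -
      have "max (obstacle_sol p z) (h z - Q z) \<le> obstacle_sol p z" using wle[of z] that by (simp add: w_def)
      then show ?thesis by (simp add: s_def)
    qed
    have hi: "s z \<le> Re (poly (q + [:of_real e:]) z)" if z: "z \<in> cball x0 R" for z
    proof (rule poly_majorant[OF cs ls R _ z])
      show "s y \<le> Re (poly (q + [:of_real e:]) y)" if "y \<in> sphere x0 R" for y using q[OF that] by simp
    qed
    have "\<bar>s z - Re (poly q z)\<bar> \<le> e" if "z \<in> cball x0 R" for z
      using lo[OF that] hi[OF that] by (simp add: h_def)
    then show ?thesis by blast
  qed
  show ?thesis
  proof (intro exI[of _ R] conjI R allI impI)
    fix x and r :: real assume xr: "0 < r \<and> cball x r \<subseteq> cball x0 R"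
    then have r: "0 < r" by simp
    have sub: "y \<in> cball x0 R" if "y \<in> ball x r" for y using xr ball_subset_cball[of x r] that by blast
    have xin: "x \<in> cball x0 R" using sub[of x] r by simp
    have "\<bar>ball_mean r s x - s x\<bar> \<le> 0 + e" if e: "0 < e" for e
    proof -
      obtain q where q: "\<And>z. z \<in> cball x0 R \<Longrightarrow> \<bar>s z - Re (poly q z)\<bar> \<le> e / 2" using approx[of "e/2"] half_gt_zero[OF e] by blast
      have "ball_mean r s x - Re (poly q x) = ball_mean r (\<lambda>z. s z - Re (poly q z)) x"
        by (subst ball_mean_diff) (auto intro!: mean_integrable_cont cs continuous_intros simp: ball_mean_Re_poly[OF r])
      moreover have "ball_mean r (\<lambda>z. s z - Re (poly q z)) x \<le> ball_mean r (\<lambda>_. e / 2) x"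
      proof (intro ball_mean_mono mean_integrable_cont cs continuous_intros)
        fix y assume "y \<in> ball x r"
        from q[OF sub[OF this]] show "s y - Re (poly q y) \<le> e / 2" by linarith
      qed
      moreover have "ball_mean r (\<lambda>_. - (e / 2)) x \<le> ball_mean r (\<lambda>z. s z - Re (poly q z)) x"
      proof (intro ball_mean_mono mean_integrable_cont cs continuous_intros)
        fix y assume "y \<in> ball x r"
        from q[OF sub[OF this]] show "- (e / 2) \<le> s y - Re (poly q y)" by linarith
      qed
      ultimately show ?thesis using q[OF xin] unfolding ball_mean_const[OF r] by linarith
    qed
    then have "\<bar>ball_mean r s x - s x\<bar> \<le> 0" by (rule field_le_epsilon)
    then show "obstacle_sol p x = ball_mean r (obstacle_sol p) x + pi / 4 * r\<^sup>2" using bs[OF r, of x] by (simp add: s_def)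
  qed
qed

end

section \<open>Potentials of discs\<close>

text \<open>The kernel is even, so averaging over the observation point is the same as averaging
  over the charge. Thus the regularity and mean value bounds of \<open>log_pot\<close> pass to
  \<open>ln_mean\<close>.\<close>

lemma ln_mean_log_pot:
  assumes r: "0 < r"
  shows "ln_mean r y = log_pot (ball 0 r) y / (pi * r\<^sup>2)"
proof -
  have [measurable]: "ball (0::complex) r \<in> sets borel" by simp
  have "(LINT z|lborel. indicator (ball 0 r) z * ln (norm (y - z))) = (LINT z|lborel. indicator (ball 0 r) (0 - z) * ln (norm (y - (0 - z))))"
    by (rule integral_lborel_reflect[symmetric]) measurable
  also have "\<dots> = (LINT z|lborel. indicator (ball 0 r) z * ln (norm (y + z)))"
    by (intro Bochner_Integration.integral_cong) (auto split: split_indicator)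
  finally show ?thesis unfolding ball_mean_ln[OF r, symmetric] by (simp add: ball_mean_def log_pot_def)
qed

lemma measure_ball_complex: "0 \<le> r \<Longrightarrow> measure lborel (ball (a::complex) r) = pi * r\<^sup>2"
  by (simp add: measure_def emeasure_ball_complex)

lemma ln_mean_outside: "r \<le> norm y \<Longrightarrow> ln_mean r y = ln (norm y)"
  by (simp add: ln_mean_def)

lemma ln_mean_ge_ln: "y \<noteq> 0 \<Longrightarrow> ln (norm y) \<le> ln_mean r y"
  using ln_defect_nonneg[of y r] by (simp add: ln_defect_def)

context
  fixes \<rho> :: real
  assumes \<rho>: "0 < \<rho>"
begin

lemma ln_mean_cont: "continuous_on S (ln_mean \<rho>)"
proof -
  have "continuous_on S (\<lambda>y. log_pot (ball 0 \<rho>) y / (pi * \<rho>\<^sup>2))"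
    by (intro continuous_intros log_pot_continuous) (use \<rho> in auto)
  moreover have "ln_mean \<rho> = (\<lambda>y. log_pot (ball 0 \<rho>) y / (pi * \<rho>\<^sup>2))" by (rule ext) (rule ln_mean_log_pot[OF \<rho>])
  ultimately show ?thesis by (simp only:)
qed

text \<open>Rescaled from the uniform charge of density \<open>1 / (pi * \<rho>\<^sup>2)\<close>. On
  the disc the defect \<open>r\<^sup>2 / (4 * \<rho>\<^sup>2)\<close> exceeds the allowance
  \<open>pi / 4 * r\<^sup>2\<close> precisely when \<open>pi * \<rho>\<^sup>2 < 1\<close>.\<close>

lemma ln_mean_ball_mean:
  assumes r: "0 < r"
  shows "ln_mean \<rho> x \<le> ball_mean r (ln_mean \<rho>) x" "ball_mean r (ln_mean \<rho>) x \<le> ln_mean \<rho> x + r\<^sup>2 / (4 * \<rho>\<^sup>2)"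
    "ball x r \<subseteq> ball 0 \<rho> \<Longrightarrow> ball_mean r (ln_mean \<rho>) x = ln_mean \<rho> x + r\<^sup>2 / (4 * \<rho>\<^sup>2)"
    "ball x r \<inter> ball 0 \<rho> = {} \<Longrightarrow> ball_mean r (ln_mean \<rho>) x = ln_mean \<rho> x"
proof -
  have e: "ln_mean \<rho> = (\<lambda>y. 1 / (pi * \<rho>\<^sup>2) * log_pot (ball 0 \<rho>) y)" by (rule ext) (simp add: ln_mean_log_pot[OF \<rho>])
  have b: "ball_mean r (ln_mean \<rho>) x = 1 / (pi * \<rho>\<^sup>2) * ball_mean r (log_pot (ball 0 \<rho>)) x" unfolding e by (rule ball_mean_cmult)
  have l: "ln_mean \<rho> x = 1 / (pi * \<rho>\<^sup>2) * log_pot (ball 0 \<rho>) x" using e by metis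
  have q: "r\<^sup>2 / (4 * \<rho>\<^sup>2) = 1 / (pi * \<rho>\<^sup>2) * (pi / 4 * r\<^sup>2)" by simp
  have p: "0 \<le> 1 / (pi * \<rho>\<^sup>2)" by simp
  have G: "ball (0::complex) \<rho> \<in> sets borel" by simp
  note B = ball_mean_log_pot_bounds[OF G subset_refl r, of x]
  show "ln_mean \<rho> x \<le> ball_mean r (ln_mean \<rho>) x" unfolding b l by (rule mult_left_mono[OF B(1) p])
  show "ball_mean r (ln_mean \<rho>) x \<le> ln_mean \<rho> x + r\<^sup>2 / (4 * \<rho>\<^sup>2)" unfolding b l q distrib_left[symmetric]
    by (rule mult_left_mono[OF B(2) p])
  show "ball_mean r (ln_mean \<rho>) x = ln_mean \<rho> x + r\<^sup>2 / (4 * \<rho>\<^sup>2)" if "ball x r \<subseteq> ball 0 \<rho>"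
    unfolding b l q distrib_left[symmetric] B(3)[OF that] ..
  show "ball_mean r (ln_mean \<rho>) x = ln_mean \<rho> x" if "ball x r \<inter> ball 0 \<rho> = {}"
    unfolding b l B(4)[OF that] ..
qed

lemma ln_mean_lipschitz: "\<bar>ln_mean \<rho> x - ln_mean \<rho> y\<bar> \<le> (2 / \<rho>\<^sup>2 + 1) * norm (x - y)"
proof -
  have "ln_mean \<rho> x - ln_mean \<rho> y = (log_pot (ball 0 \<rho>) x - log_pot (ball 0 \<rho>) y) / (pi * \<rho>\<^sup>2)"
    by (simp add: ln_mean_log_pot[OF \<rho>] diff_divide_distrib)
  then have "\<bar>ln_mean \<rho> x - ln_mean \<rho> y\<bar> = \<bar>log_pot (ball 0 \<rho>) x - log_pot (ball 0 \<rho>) y\<bar> / (pi * \<rho>\<^sup>2)"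
    by (simp add: abs_divide abs_mult)
  also have "\<dots> \<le> (2 * pi + measure lborel (ball (0::complex) \<rho>)) * norm (x - y) / (pi * \<rho>\<^sup>2)"
    by (intro divide_right_mono log_pot_lipschitz[OF _ subset_refl]) auto
  also have "\<dots> = (2 / \<rho>\<^sup>2 + 1) * norm (x - y)"
    using \<rho> by (simp add: measure_ball_complex field_simps)
  finally show ?thesis .
qed

text \<open>Inside the smaller disc, with \<open>s = (\<rho> / \<rho>')\<^sup>2\<close> and
  \<open>t = (norm y / \<rho>)\<^sup>2\<close>, the difference of the two sides is
  \<open>(- ln s - t * (1 - s)) / 2\<close>; it is nonnegative as \<open>- ln s \<ge> 1 - s\<close>
  and \<open>t \<le> 1\<close>.\<close>

lemma ln_mean_mono:
  assumes "\<rho> \<le> \<rho>'"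
  shows "ln_mean \<rho> y \<le> ln_mean \<rho>' y"
proof (cases "\<rho> \<le> norm y")
  case True
  then have "y \<noteq> 0" using \<rho> by auto
  then show ?thesis using True ln_mean_ge_ln[of y \<rho>'] by (simp add: ln_mean_outside)
next
  case False
  define s where "s = (\<rho> / \<rho>')\<^sup>2"
  have r': "0 < \<rho>'" using assms \<rho> by simp
  have s: "0 < s" "s \<le> 1" using assms \<rho> by (auto simp: s_def power_le_one)
  have "ln s \<le> s - 1" using s by (intro ln_le_minus_one)
  moreover have "ln s = 2 * (ln \<rho> - ln \<rho>')" using \<rho> r' by (simp add: s_def ln_realpow ln_div)
  ultimately have 1: "ln \<rho>' - ln \<rho> \<ge> (1 - s) / 2" by simp
  have "(norm y)\<^sup>2 / \<rho>\<^sup>2 * (1 - s) \<le> 1 * (1 - s)"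
    using False \<rho> s by (intro mult_right_mono) (auto simp: divide_le_eq_1 intro!: power_mono)
  moreover have "(norm y)\<^sup>2 / \<rho>\<^sup>2 * s = (norm y)\<^sup>2 / \<rho>'\<^sup>2" using \<rho> by (simp add: s_def power_divide)
  ultimately have 2: "(norm y)\<^sup>2 / \<rho>\<^sup>2 - (norm y)\<^sup>2 / \<rho>'\<^sup>2 \<le> 1 - s"
    by (simp only: right_diff_distrib mult_1_right mult_1)
  have "ln_mean \<rho> y = ln \<rho> - 1 / 2 + (norm y)\<^sup>2 / \<rho>\<^sup>2 / 2" using False by (simp add: ln_mean_def diff_divide_distrib)
  moreover have "ln_mean \<rho>' y = ln \<rho>' - 1 / 2 + (norm y)\<^sup>2 / \<rho>'\<^sup>2 / 2" using False assms by (simp add: ln_mean_def diff_divide_distrib)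
  ultimately show ?thesis using 1 2 by argo
qed

end

section \<open>Removing null sets, and Liouville's theorem\<close>

text \<open>Separates the logarithmic singularity from a bounded part. The first term has integral
  \<open>pi * (d * r)\<^sup>2 / 4\<close>, small compared with \<open>r\<^sup>2\<close>; the second
  can be integrated over a set of small density.\<close>

lemma ln_defect_split:
  assumes d: "0 < d" "d < 1" and r: "0 < r" and z: "z \<noteq> 0"
  shows "ln_defect r z \<le> ln_defect (d * r) z + (ln (1 / d) + 1) * indicator (ball 0 r) z"
proof (cases "norm z < r")
  case True
  have dr: "0 < d * r" "d * r \<le> r" using d r by auto
  have m: "ln_mean r z \<le> ln r" using True r by (simp add: ln_mean_def divide_le_eq_1 power_mono)
  have ld: "ln (d * r) = ln r - ln (1 / d)" using d r by (simp add: ln_mult ln_div)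
  have "ln (d * r) - 1 \<le> ln_mean (d * r) z"
  proof (cases "d * r \<le> norm z")
    case True
    then have "ln (d * r) \<le> ln (norm z)" using dr z by (intro ln_mono) auto
    then show ?thesis using True by (simp add: ln_mean_def)
  next
    case False
    define q where "q = (norm z)\<^sup>2 / (d * r)\<^sup>2"
    have "0 \<le> q" by (simp add: q_def)
    moreover have "ln_mean (d * r) z = ln (d * r) - (1 - q) / 2" using False by (simp add: ln_mean_def q_def)
    ultimately show ?thesis by argo
  qed
  then show ?thesis using True m ld by (simp add: ln_defect_def)
next
  case False
  moreover have "d * r \<le> 1 * r" using d r by (intro mult_right_mono) auto
  ultimately have "norm z \<ge> d * r" by simp
  then show ?thesis using False by (simp add: ln_defect_outside)
qed

text \<open>At a point where \<open>S\<close> has density zero, its potential satisfies the mean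
  value property up to \<open>o(r\<^sup>2)\<close>. The measure of \<open>S\<close> alone does not
  control an unbounded kernel, hence the splitting at radius \<open>d * r\<close>.\<close>

lemma integral_ln_defect_small:
  assumes S [measurable]: "S \<in> sets borel" and SR: "S \<subseteq> ball 0 R" and e: "0 < e"
    and dens: "\<And>e. 0 < e \<Longrightarrow> \<exists>r0>0. \<forall>r. 0 < r \<and> r < r0 \<longrightarrow> measure lborel (S \<inter> ball x r) \<le> e * r\<^sup>2"
  shows "\<exists>r0>0. \<forall>r. 0 < r \<and> r < r0 \<longrightarrow> (LINT y|lborel. indicator S y * ln_defect r (x - y)) \<le> e * r\<^sup>2"
proof -
  \<comment> \<open>Chosen so that the singular part costs at most half of
    \<open>e * r\<^sup>2\<close>; the density \<open>e / (2 * M)\<close> then pays for the bounded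
    part.\<close>
  define d where "d = min (1/2) (sqrt (e / 2))"
  have d: "0 < d" "d < 1" using e by (auto simp: d_def)
  have dd: "d\<^sup>2 \<le> e / 2"
  proof -
    have "d\<^sup>2 \<le> (sqrt (e / 2))\<^sup>2" using d by (intro power_mono) (auto simp: d_def)
    then show ?thesis using e by simp
  qed
  define M where "M = ln (1 / d) + 1"
  have M: "0 < M" 
  proof -
    have "0 < ln (1 / d)" using d by (intro ln_gt_zero) auto
    then show ?thesis by (simp add: M_def)
  qed
  have "0 < e / (2 * M)" using e M by simp
  then obtain r0 where r0: "0 < r0" "\<And>r. 0 < r \<Longrightarrow> r < r0 \<Longrightarrow> measure lborel (S \<inter> ball x r) \<le> e / (2 * M) * r\<^sup>2"
    using dens[OF \<open>0 < e / (2 * M)\<close>] by auto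
  show ?thesis
  proof (intro exI[of _ r0] conjI r0 allI impI)
    fix r assume r: "0 < r \<and> r < r0"
    then have dr: "0 < d * r" using d by simp
    have [measurable]: "S \<inter> ball x r \<in> sets borel" by simp
    have fin: "emeasure lborel (S \<inter> ball x r) < \<infinity>" by (intro bounded_finite_measure) auto
    have i1: "integrable lborel (\<lambda>y. ln_defect (d * r) (x - y))" by (rule integrable_lborel_reflect[OF ln_defect_integral(1)[OF dr]])
    have i2: "integrable lborel (\<lambda>y. M * indicator (S \<inter> ball x r) y)"
      using fin by (intro integrable_mult_right) (auto simp: less_top)
    have "(LINT y|lborel. indicator S y * ln_defect r (x - y)) \<le> (LINT y|lborel. ln_defect (d * r) (x - y) + M * indicator (S \<inter> ball x r) y)"
    proof (rule integral_mono_AE)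
      show "integrable lborel (\<lambda>y. indicator S y * ln_defect r (x - y))" using ball_mean_log_pot(2)[OF S SR] r by blast
      show "integrable lborel (\<lambda>y. ln_defect (d * r) (x - y) + M * indicator (S \<inter> ball x r) y)"
        by (rule Bochner_Integration.integrable_add[OF i1 i2])
      show "AE y in lborel. indicator S y * ln_defect r (x - y) \<le> ln_defect (d * r) (x - y) + M * indicator (S \<inter> ball x r) y"
        using AE_neq_complex[of x] AE_ln_defect_nonneg[of "d * r" x]
      proof eventually_elim
        case (elim y)
        have "ln_defect r (x - y) \<le> ln_defect (d * r) (x - y) + M * indicator (ball 0 r) (x - y)"
          unfolding M_def using ln_defect_split[OF d _, of r "x - y"] r elim by simp
        moreover have "indicator (ball 0 r) (x - y) = (indicator (ball x r) y :: real)"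
          by (auto simp: dist_norm norm_minus_commute split: split_indicator)
        ultimately show ?case using elim M by (auto split: split_indicator)
      qed
    qed
    also have "\<dots> = pi * (d * r)\<^sup>2 / 4 + M * measure lborel (S \<inter> ball x r)"
      by (subst Bochner_Integration.integral_add[OF i1 i2]) (simp add: ln_defect_reflect_integral[OF dr])
    also have "\<dots> \<le> 1 * (d * r)\<^sup>2 + M * (e / (2 * M) * r\<^sup>2)"
    proof (intro add_mono mult_left_mono)
      have "pi * (d * r)\<^sup>2 \<le> 4 * (d * r)\<^sup>2" using pi_less_4 by (intro mult_right_mono) auto
      then show "pi * (d * r)\<^sup>2 / 4 \<le> 1 * (d * r)\<^sup>2" by simp
    qed (use r0(2)[of r] r M in auto)
    also have "\<dots> \<le> e / 2 * r\<^sup>2 + e / 2 * r\<^sup>2"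
    proof (intro add_mono)
      have "d\<^sup>2 * r\<^sup>2 \<le> e / 2 * r\<^sup>2" using dd by (intro mult_right_mono) auto
      then show "1 * (d * r)\<^sup>2 \<le> e / 2 * r\<^sup>2" by (simp add: power_mult_distrib)
    qed (use M in simp)
    also have "\<dots> = e * r\<^sup>2" by simp
    finally show "(LINT y|lborel. indicator S y * ln_defect r (x - y)) \<le> e * r\<^sup>2" .
  qed
qed

text \<open>A defect of the sub-mean value property on a bounded null set \<open>N\<close> is repaired by adding the
  potential of an open set \<open>G \<supseteq> N\<close> of small measure.\<close>
lemma submean_remove_null:
  assumes u: "continuous_on UNIV u" and low: "\<And>x r. 0 < r \<Longrightarrow> u x \<le> ball_mean r u x + pi / 4 * r\<^sup>2"
    and N: "N \<in> null_sets lborel" "N \<subseteq> ball 0 R"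
    and loc: "\<And>x e. x \<notin> N \<Longrightarrow> 0 < e \<Longrightarrow> \<exists>r0>0. \<forall>r. 0 < r \<and> r < r0 \<longrightarrow> u x \<le> ball_mean r u x + e * r\<^sup>2"
    and s: "0 < s"
  shows "u x \<le> ball_mean s u x"
proof -
  have Nb: "N \<in> sets borel" "emeasure lborel N = 0" using N(1) by auto
  have "\<exists>G. open G \<and> N \<subseteq> G \<and> emeasure lborel (G - N) < ennreal (1 / real (Suc n))" for n
  proof -
    have "0 < 1 / real (Suc n)" by simp
    then obtain U where "open U" "N \<subseteq> U" "emeasure lborel (U - N) < ennreal (1 / real (Suc n))"
      by (rule outer_regular_lborel[OF Nb(1)])
    then show ?thesis by auto
  qed
  then obtain G0 where G0: "\<And>n. open (G0 n)" "\<And>n. N \<subseteq> G0 n" "\<And>n. emeasure lborel (G0 n - N) < ennreal (1 / real (Suc n))"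
    by metis
  \<comment> \<open>Intersecting makes the sets decrease, so that a point outside one of them stays
    outside; the disc keeps them bounded, as potentials require.\<close>
  define G where "G n = (\<Inter>k\<le>n. G0 k) \<inter> ball 0 R" for n
  have Go: "open (G n)" "N \<subseteq> G n" "G n \<subseteq> ball 0 R" for n
    unfolding G_def using G0 N(2) by (auto intro!: open_Int open_INT)
  have Gm[measurable]: "G n \<in> sets borel" for n using Go(1) by simp
  have Gsmall: "emeasure lborel (G n) \<le> ennreal (1 / real (Suc n))" for n
  proof -
    have "emeasure lborel (G n) \<le> emeasure lborel (N \<union> (G0 n - N))"
      using G0(1) Nb by (intro emeasure_mono) (auto simp: G_def)
    also have "\<dots> \<le> emeasure lborel N + emeasure lborel (G0 n - N)"
      using G0(1) Nb by (intro emeasure_subadditive) auto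
    also have "\<dots> \<le> ennreal (1 / real (Suc n))" using G0(3)[of n] Nb by simp
    finally show ?thesis .
  qed
  have key: "u x \<le> ball_mean s u x + (LINT y|lborel. indicator (G n) y * ln_defect s (x - y))" for n
  proof -
    have cl: "continuous_on UNIV (log_pot (G n))" by (rule log_pot_continuous[OF Gm Go(3)])
    let ?w = "\<lambda>z. u z + log_pot (G n) z"
    have bw: "ball_mean r ?w y = ball_mean r u y + ball_mean r (log_pot (G n)) y" for r y by (intro ball_mean_add mean_integrable_cont u cl)
    have lw: "local_submean ?w"
      unfolding local_submean_def
    proof (intro allI impI)
      fix y :: complex and e r0 :: real assume e: "0 < e" "0 < r0"
      show "\<exists>r. 0 < r \<and> r < r0 \<and> ?w y \<le> ball_mean r ?w y + e * r\<^sup>2"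
      proof (cases "y \<in> N")
        case True
        then obtain r1 where r1: "0 < r1" "ball y r1 \<subseteq> G n" using Go(1,2)[of n] unfolding open_contains_ball by blast
        define r where "r = min r0 r1 / 2"
        have r: "0 < r" "r < r0" "ball y r \<subseteq> G n" using r1 e by (auto simp: r_def subset_iff)
        \<comment> \<open>On \<open>N\<close> the potential gains exactly the
          \<open>pi / 4 * r\<^sup>2\<close> that \<open>u\<close> may lose; elsewhere it does no
          harm, being sub-mean itself.\<close>
        have "ball_mean r (log_pot (G n)) y = log_pot (G n) y + pi / 4 * r\<^sup>2" by (rule ball_mean_log_pot_bounds(3)[OF Gm Go(3) r(1,3)])
        then have "?w y \<le> ball_mean r ?w y" using low[OF r(1), of y] bw by simp
        then show ?thesis using r e by (intro exI[of _ r]) (auto intro: add_increasing2)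
      next
        case False
        then obtain r1 where r1: "0 < r1" "\<And>r. 0 < r \<Longrightarrow> r < r1 \<Longrightarrow> u y \<le> ball_mean r u y + e * r\<^sup>2"
          using loc[OF False e(1)] by auto
        define r where "r = min r0 r1 / 2"
        have r: "0 < r" "r < r0" "r < r1" using r1 e by (auto simp: r_def)
        have "log_pot (G n) y \<le> ball_mean r (log_pot (G n)) y" by (rule ball_mean_log_pot_bounds(1)[OF Gm Go(3) r(1)])
        then show ?thesis using r1(2)[OF r(1,3)] r bw by (intro exI[of _ r]) auto
      qed
    qed
    have "?w x \<le> ball_mean s ?w x" by (rule submean_global[OF _ lw s]) (intro continuous_intros u cl)
    then show ?thesis using ball_mean_log_pot(1)[OF Gm Go(3) s, of n x] bw by simp
  qed
  have "(\<lambda>n. LINT y|lborel. indicator (G n) y * ln_defect s (x - y)) \<longlonglongrightarrow> (LINT y|(lborel :: complex measure). 0)"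
  proof (rule integral_dominated_convergence)
    show "integrable lborel (\<lambda>y. ln_defect s (x - y))" by (rule integrable_lborel_reflect[OF ln_defect_integral(1)[OF s]])
    have "emeasure lborel (\<Inter>n. G n) = 0"
    proof -
      have "emeasure lborel (\<Inter>n. G n) \<le> ennreal (1 / real (Suc n))" for n
        by (rule order_trans[OF emeasure_mono Gsmall[of n]]) auto
      moreover have "(\<lambda>n. ennreal (1 / real (Suc n))) \<longlonglongrightarrow> ennreal 0"
        by (intro tendsto_ennrealI LIMSEQ_Suc[OF lim_1_over_n])
      ultimately have "emeasure lborel (\<Inter>n. G n) \<le> ennreal 0" by (intro LIMSEQ_le_const) auto
      then show ?thesis by simp
    qed
    then have "(\<Inter>n. G n) \<in> null_sets lborel" by (intro null_setsI) auto
    then have "AE y in lborel. y \<notin> (\<Inter>n. G n)" by (rule AE_not_in)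
    then show "AE y in lborel. (\<lambda>n. indicator (G n) y * ln_defect s (x - y)) \<longlonglongrightarrow> 0"
    proof eventually_elim
      case (elim y)
      then obtain m where m: "y \<notin> G m" by auto
      have "y \<notin> G n" if "m \<le> n" for n using m that by (auto simp: G_def)
      then have "\<forall>\<^sub>F n in sequentially. indicator (G n) y * ln_defect s (x - y) = 0"
        by (intro eventually_sequentiallyI[of m]) simp
      then show ?case by (rule tendsto_eventually)
    qed
    show "AE y in lborel. norm (indicator (G n) y * ln_defect s (x - y)) \<le> ln_defect s (x - y)" for n
      using AE_ln_defect_nonneg[of s x] by eventually_elim (auto split: split_indicator)
  qed measurable
  then have "(\<lambda>n. ball_mean s u x + (LINT y|lborel. indicator (G n) y * ln_defect s (x - y))) \<longlonglongrightarrow> ball_mean s u x + 0"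
    by (intro tendsto_intros) simp
  then show ?thesis using key by (intro LIMSEQ_le_const[of _ "ball_mean s u x"]) auto
qed

lemma ball_mean_decaying:
  assumes g: "continuous_on UNIV g" and lim: "(g \<longlongrightarrow> 0) at_infinity"
  shows "((\<lambda>r. ball_mean r g x) \<longlongrightarrow> 0) at_top"
proof (rule tendstoI)
  fix e :: real assume e: "0 < e"
  obtain B where B: "\<And>y. B \<le> norm y \<Longrightarrow> \<bar>g y\<bar> < e / 2"
    using tendstoD[OF lim, of "e/2"] e by (auto simp: eventually_at_infinity dist_real_def)
  define B' where "B' = max B 1"
  obtain M where M: "\<And>y. y \<in> cball 0 B' \<Longrightarrow> norm (g y) \<le> M"
    using compact_imp_bounded[OF compact_continuous_image[OF continuous_on_subset[OF g] compact_cball[of 0 B']]]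
    unfolding bounded_iff by blast
  have "(0::complex) \<in> cball 0 B'" by (simp add: B'_def)
  then have M0: "0 \<le> M" using M order_trans[OF norm_ge_zero] by blast
  let ?I = "\<lambda>y. indicator (ball 0 B') y * (1::real)"
  have gb: "\<bar>g y\<bar> \<le> e / 2 + M * indicator (ball 0 B') y" for y
  proof (cases "y \<in> ball 0 B'")
    case True
    then show ?thesis using M[of y] e by simp
  next
    case False
    then have "B \<le> norm y" by (auto simp: B'_def)
    from B[OF this] False show ?thesis by simp
  qed
  have [measurable]: "ball (0::complex) r \<in> sets borel" for r by simp
  have est: "\<bar>ball_mean r g x\<bar> \<le> e / 2 + M * (B'\<^sup>2 / r\<^sup>2)" if r: "0 < r" for r
  proof -
    have iind: "mean_integrable r (\<lambda>y. indicator (ball 0 B') y) x"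
      unfolding mean_integrable_def
    proof (rule Bochner_Integration.integrable_bound)
      show "integrable lborel (indicator (ball (0::complex) r) :: complex \<Rightarrow> real)" using r by (simp add: emeasure_ball_complex)
    qed (auto split: split_indicator)
    have ib: "mean_integrable r (\<lambda>y. e / 2 + M * indicator (ball 0 B') y) x" by (intro mean_integrable_add mean_integrable_const mean_integrable_cmult iind)
    have "(LINT z|lborel. indicator (ball 0 r) z * (indicator (ball 0 B') (x + z) :: real)) \<le> (LINT z|lborel. indicator (ball 0 B') (x + z))"
      using iind integrable_lborel_translate[of "indicator (ball 0 B') :: complex \<Rightarrow> real" x]
      unfolding mean_integrable_def by (intro integral_mono) (auto simp: emeasure_ball_complex B'_def split: split_indicator)
    also have "\<dots> = pi * B'\<^sup>2"
      by (subst integral_lborel_translate) (auto simp: measure_ball_complex B'_def)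
    finally have I: "ball_mean r (\<lambda>y. indicator (ball 0 B') y) x \<le> B'\<^sup>2 / r\<^sup>2"
      using r by (simp add: ball_mean_def field_simps)
    have eq: "ball_mean r (\<lambda>y. e / 2 + M * indicator (ball 0 B') y) x = e / 2 + M * ball_mean r (\<lambda>y. indicator (ball 0 B') y) x"
      by (subst ball_mean_add) (auto intro!: mean_integrable_cmult iind simp: ball_mean_const[OF r] ball_mean_cmult)
    have "ball_mean r g x \<le> ball_mean r (\<lambda>y. e / 2 + M * indicator (ball 0 B') y) x"
      by (intro ball_mean_mono mean_integrable_cont g ib) (use gb in \<open>auto simp: abs_le_iff\<close>)
    moreover have "ball_mean r (\<lambda>y. - (e / 2 + M * indicator (ball 0 B') y)) x \<le> ball_mean r g x"
    proof (rule ball_mean_mono[OF mean_integrable_uminus[OF ib] mean_integrable_cont[OF g]])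
      fix y show "- (e / 2 + M * indicator (ball 0 B') y) \<le> g y" using gb[of y] by (simp add: abs_le_iff)
    qed
    ultimately have "\<bar>ball_mean r g x\<bar> \<le> e / 2 + M * ball_mean r (\<lambda>y. indicator (ball 0 B') y) x"
      unfolding ball_mean_uminus eq by (simp add: abs_le_iff)
    also have "\<dots> \<le> e / 2 + M * (B'\<^sup>2 / r\<^sup>2)" using I M0 by (intro add_left_mono mult_left_mono)
    finally show ?thesis .
  qed
  have "((\<lambda>r. M * (B'\<^sup>2 * (inverse r)\<^sup>2)) \<longlongrightarrow> M * (B'\<^sup>2 * 0\<^sup>2)) at_top"
    by (intro tendsto_intros tendsto_inverse_0_at_top filterlim_ident)
  then have "\<forall>\<^sub>F r in at_top. M * (B'\<^sup>2 * (inverse r)\<^sup>2) < e / 2"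
    using e by (intro order_tendstoD(2)[where y=0]) auto
  then show "\<forall>\<^sub>F r in at_top. dist (ball_mean r g x) 0 < e"
    using eventually_gt_at_top[of 0]
  proof eventually_elim
    case (elim r)
    have "B'\<^sup>2 / r\<^sup>2 = B'\<^sup>2 * (inverse r)\<^sup>2" by (simp only: divide_inverse power_inverse)
    then have "\<bar>ball_mean r g x\<bar> \<le> e / 2 + M * (B'\<^sup>2 * (inverse r)\<^sup>2)" using est[OF elim(2)] by (simp only:)
    then show ?case using elim(1) unfolding dist_real_def by linarith
  qed
qed

text \<open>As soon as \<open>r > norm x + 1\<close>, the closed form gives \<open>ln_mean r (x - y)
  = ln r - 1 / 2 + (norm (x - y))\<^sup>2 / (2 * r\<^sup>2)\<close> for all \<open>y\<close> in the
  unit disc, so the error is of order \<open>1 / r\<^sup>2\<close>.\<close>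

lemma ball_mean_ln_mean_asymp: "((\<lambda>r. ball_mean r (ln_mean 1) x - (ln r - 1 / 2)) \<longlongrightarrow> 0) at_top"
proof -
  have G: "ball (0::complex) 1 \<in> sets borel" by simp
  note P = ball_mean_log_pot[OF G subset_refl]
  have e: "ln_mean 1 = (\<lambda>y. 1 / pi * log_pot (ball 0 1) y)" by (rule ext) (simp add: ln_mean_log_pot)
  have iB: "integrable lborel (indicator (ball (0::complex) 1) :: complex \<Rightarrow> real)" by (simp add: emeasure_ball_complex)
  have est: "\<bar>ball_mean r (ln_mean 1) x - (ln r - 1 / 2)\<bar> \<le> (norm x + 1)\<^sup>2 / 2 * (inverse r)\<^sup>2" if r: "0 < r" "norm x + 1 < r" for r
  proof -
    have L: "\<bar>indicator (ball 0 1) y * ln_mean r (x - y) - indicator (ball 0 1) y * (ln r - 1 / 2)\<bar>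
        \<le> (norm x + 1)\<^sup>2 / 2 * (inverse r)\<^sup>2 * indicator (ball 0 1) y" for y
    proof (cases "y \<in> ball 0 1")
      case True
      then have n: "norm (x - y) \<le> norm x + 1" using norm_triangle_ineq4[of x y] by simp
      then have "ln_mean r (x - y) - (ln r - 1 / 2) = (norm (x - y))\<^sup>2 / 2 * (inverse r)\<^sup>2"

      proof -
        have "(norm (x - y))\<^sup>2 * (inverse r)\<^sup>2 = (norm (x - y))\<^sup>2 / r\<^sup>2" by (simp only: divide_inverse power_inverse)
        then have "(norm (x - y))\<^sup>2 / 2 * (inverse r)\<^sup>2 = (norm (x - y))\<^sup>2 / r\<^sup>2 / 2" by simp
        then show ?thesis using r n by (simp add: ln_mean_def diff_divide_distrib)
      qed
      moreover have "(norm (x - y))\<^sup>2 / 2 * (inverse r)\<^sup>2 \<le> (norm x + 1)\<^sup>2 / 2 * (inverse r)\<^sup>2"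
        using n by (intro mult_right_mono divide_right_mono power_mono) auto
      moreover have "0 \<le> (norm (x - y))\<^sup>2 / 2 * (inverse r)\<^sup>2" by simp
      ultimately show ?thesis using True by (simp only: indicator_simps mult_1 mult_1_right abs_of_nonneg)
    qed auto
    have i1: "integrable lborel (\<lambda>y. indicator (ball 0 1) y * ln_defect r (x - y) + indicator (ball 0 1) y * ln (norm (x - y)))"
      by (rule Bochner_Integration.integrable_add[OF P(2)[OF r(1)] ln_bound(1)[OF G subset_refl]])
    then have i2: "integrable lborel (\<lambda>y. indicator (ball 0 1) y * ln_mean r (x - y))" by (simp add: ln_defect_def algebra_simps)
    have "ball_mean r (log_pot (ball 0 1)) x = (LINT y|lborel. indicator (ball 0 1) y * ln_defect r (x - y)) + log_pot (ball 0 1) x"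
      using P(1)[OF r(1), of x] by simp
    also have "\<dots> = (LINT y|lborel. indicator (ball 0 1) y * ln_defect r (x - y) + indicator (ball 0 1) y * ln (norm (x - y)))"
      unfolding log_pot_def by (rule Bochner_Integration.integral_add[symmetric, OF P(2)[OF r(1)] ln_bound(1)[OF G subset_refl]])
    also have "\<dots> = (LINT y|lborel. indicator (ball 0 1) y * ln_mean r (x - y))" by (simp add: ln_defect_def algebra_simps)
    finally have "ball_mean r (log_pot (ball 0 1)) x - pi * (ln r - 1 / 2) = (LINT y|lborel. indicator (ball 0 1) y * ln_mean r (x - y) - indicator (ball 0 1) y * (ln r - 1 / 2))"
      by (subst Bochner_Integration.integral_diff[OF i2 integrable_mult_left[OF iB]]) (simp add: measure_ball_complex)
    then have "\<bar>ball_mean r (log_pot (ball 0 1)) x - pi * (ln r - 1 / 2)\<bar> \<le> (LINT y|lborel. \<bar>indicator (ball 0 1) y * ln_mean r (x - y) - indicator (ball 0 1) y * (ln r - 1 / 2)\<bar>)"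
      by (simp only: integral_abs_bound)
    also have "\<dots> \<le> (LINT y|lborel. (norm x + 1)\<^sup>2 / 2 * (inverse r)\<^sup>2 * indicator (ball (0::complex) 1) y)"
      by (rule integral_mono'[OF integrable_mult_right[OF iB] L]) simp
    also have "\<dots> = pi * ((norm x + 1)\<^sup>2 / 2 * (inverse r)\<^sup>2)" by (simp add: measure_ball_complex)
    finally have F: "\<bar>ball_mean r (log_pot (ball 0 1)) x - pi * (ln r - 1 / 2)\<bar> \<le> pi * ((norm x + 1)\<^sup>2 / 2 * (inverse r)\<^sup>2)" .
    have "ball_mean r (ln_mean 1) x = 1 / pi * ball_mean r (log_pot (ball 0 1)) x" unfolding e by (rule ball_mean_cmult)
    then have "ball_mean r (ln_mean 1) x - (ln r - 1 / 2) = (ball_mean r (log_pot (ball 0 1)) x - pi * (ln r - 1 / 2)) / pi"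
      by (simp add: diff_divide_distrib)
    then have "\<bar>ball_mean r (ln_mean 1) x - (ln r - 1 / 2)\<bar> = \<bar>ball_mean r (log_pot (ball 0 1)) x - pi * (ln r - 1 / 2)\<bar> / pi"
      by (simp add: abs_divide)
    also have "\<dots> \<le> pi * ((norm x + 1)\<^sup>2 / 2 * (inverse r)\<^sup>2) / pi" using F by (intro divide_right_mono) auto
    finally show ?thesis by simp
  qed
  have lim: "((\<lambda>r. (norm x + 1)\<^sup>2 / 2 * (inverse r)\<^sup>2) \<longlongrightarrow> 0) at_top"
  proof -
    have "((\<lambda>r. (norm x + 1)\<^sup>2 / 2 * (inverse r)\<^sup>2) \<longlongrightarrow> (norm x + 1)\<^sup>2 / 2 * 0\<^sup>2) at_top"
      by (intro tendsto_intros tendsto_inverse_0_at_top filterlim_ident)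
    then show ?thesis by simp
  qed
  show ?thesis
  proof (rule Lim_null_comparison[OF _ lim])
    show "\<forall>\<^sub>F r in at_top. norm (ball_mean r (ln_mean 1) x - (ln r - 1 / 2)) \<le> (norm x + 1)\<^sup>2 / 2 * (inverse r)\<^sup>2"
      using eventually_gt_at_top[of 0] eventually_gt_at_top[of "norm x + 1"]
      by eventually_elim (use est in auto)
  qed
qed

text \<open>The value \<open>h x\<close> is the mean over arbitrarily large discs, and comparing
  growth gives \<open>h x - m * (ln r - 1 / 2) -> 0\<close>. The unbounded logarithm forces
  \<open>m = 0\<close>, and then \<open>h x = 0\<close>. The function \<open>ln_mean 1\<close>
  stands in for the logarithm: it is continuous and agrees with it off the unit disc.\<close>

lemma harmonic_log_growth:
  assumes h: "continuous_on UNIV h" and harm: "\<And>x r. 0 < r \<Longrightarrow> ball_mean r h x = h x"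
    and lim: "((\<lambda>x. h x - m * ln (norm x)) \<longlongrightarrow> 0) at_infinity"
  shows "m = 0" "h x = 0"
proof -
  define g where "g z = h z - m * ln_mean 1 z" for z
  have cg: "continuous_on UNIV g" unfolding g_def by (intro continuous_intros h ln_mean_cont) simp
  have "(g \<longlongrightarrow> 0) at_infinity"
  proof (rule Lim_transform_eventually[OF lim])
    show "\<forall>\<^sub>F z in at_infinity. h z - m * ln (norm z) = g z"
      unfolding eventually_at_infinity g_def by (intro exI[of _ 1]) (simp add: ln_mean_outside)
  qed
  then have L1: "((\<lambda>r. ball_mean r g x) \<longlongrightarrow> 0) at_top" by (rule ball_mean_decaying[OF cg])
  have "((\<lambda>r. ball_mean r g x + m * (ball_mean r (ln_mean 1) x - (ln r - 1 / 2))) \<longlongrightarrow> 0 + m * 0) at_top"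
    by (intro tendsto_intros L1 ball_mean_ln_mean_asymp)
  then have "((\<lambda>r. ball_mean r g x + m * (ball_mean r (ln_mean 1) x - (ln r - 1 / 2))) \<longlongrightarrow> 0) at_top" by simp
  moreover have "\<forall>\<^sub>F r in at_top. ball_mean r g x + m * (ball_mean r (ln_mean 1) x - (ln r - 1 / 2)) = h x - m * (ln r - 1 / 2)"
    using eventually_gt_at_top[of 0]
  proof eventually_elim
    case (elim r)
    have "ball_mean r g x = ball_mean r h x - ball_mean r (\<lambda>z. m * ln_mean 1 z) x"
      unfolding g_def by (intro ball_mean_diff mean_integrable_cont continuous_intros h ln_mean_cont) simp_all
    then show ?case by (simp add: ball_mean_cmult harm[OF elim] algebra_simps)
  qed
  ultimately have L: "((\<lambda>r. h x - m * (ln r - 1 / 2)) \<longlongrightarrow> 0) at_top" by (rule Lim_transform_eventually)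
  show m: "m = 0"
  proof (rule ccontr)
    assume m: "m \<noteq> 0"
    have "((\<lambda>r. (h x - (h x - m * (ln r - 1 / 2))) / m + 1 / 2) \<longlongrightarrow> (h x - 0) / m + 1 / 2) at_top"
      using m by (intro tendsto_intros L) auto
    then have "((\<lambda>r. ln r :: real) \<longlongrightarrow> h x / m + 1 / 2) at_top" using m by simp
    moreover have "filterlim (ln :: real \<Rightarrow> real) at_infinity at_top"
      using ln_at_top by (rule filterlim_at_top_imp_at_infinity)
    ultimately show False using not_tendsto_and_filterlim_at_infinity[OF trivial_limit_at_top_linorder] by blast
  qed
  then have "((\<lambda>r::real. h x) \<longlongrightarrow> 0) at_top" using L by simp
  then show "h x = 0" by (simp add: tendsto_const_iff)
qed

section \<open>Lebesgue density\<close>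

lemma emeasure_lborel_rotate:
  fixes c :: complex
  assumes "norm c = 1" "A \<in> sets borel"
  shows "emeasure lborel ((*) c -` A) = emeasure lborel A"
proof -
  have "emeasure lborel A = emeasure (distr lborel borel ((*) c)) A" by (simp add: lborel_distr_rotate[OF assms(1)])
  also have "\<dots> = emeasure lborel ((*) c -` A)" using assms(2) by (subst emeasure_distr) auto
  finally show ?thesis by simp
qed

text \<open>The differentiation theorem concerns squares that have the point as lower left corner.
  Dividing by \<open>c\<close> turns this corner to any direction, so four choices of
  \<open>c\<close> surround the point; the exceptional null set is rotated along.\<close>

lemma density_quadrant:
  fixes c :: complex
  assumes S [measurable]: "S \<in> sets borel" and c: "norm c = 1"
  shows "AE x in lborel. x \<notin> S \<longrightarrow> (\<forall>e>0. \<exists>r0>0. \<forall>r. 0 < r \<and> r < r0 \<longrightarrow>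
    measure lborel (S \<inter> {y. y / c \<in> cbox (x / c) (x / c + r *\<^sub>R One)}) \<le> e * r\<^sup>2)"
proof -
  have c0: "c \<noteq> 0" using c by auto
  define T where "T = (*) c -` S"
  have "(*) c -` S \<inter> space borel \<in> sets borel" by (rule measurable_sets[OF _ S]) measurable
  then have T [measurable]: "T \<in> sets borel" by (simp add: T_def)
  have Tc: "T \<inter> cbox a b \<in> lmeasurable" for a b
    by (intro bounded_set_imp_lmeasurable) (auto intro: bounded_subset[OF bounded_cbox])
  obtain N where N: "negligible N" "\<And>x e. x \<notin> N \<Longrightarrow> 0 < e \<Longrightarrow> \<exists>d>0. \<forall>h. 0 < h \<and> h < d \<longrightarrow>
      norm (integral (cbox x (x + h *\<^sub>R One)) (indicator T :: complex \<Rightarrow> real) /\<^sub>R h ^ DIM(complex) - indicator T x) < e"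
    using integrable_ccontinuous_explicit[of "indicator T :: complex \<Rightarrow> real"] Tc by (auto simp: integrable_on_indicator)
  obtain N' where N': "N' \<in> null_sets lborel" "N \<subseteq> N'"
    using N(1) by (auto simp: negligible_iff_null_sets null_sets_completion_iff2)
  have "AE x in lborel. x \<notin> N'" by (rule AE_not_in[OF N'(1)])
  moreover have "distr lborel borel ((*) (1 / c)) = lborel" using c by (intro lborel_distr_rotate) (simp add: norm_divide)
  ultimately have "AE x in distr lborel borel ((*) (1 / c)). x \<notin> N'" by (simp only:)
  then have "AE x in lborel. 1 / c * x \<notin> N'" by (rule AE_distrD[rotated]) measurable
  then show ?thesis
  proof eventually_elim
    case (elim x)
    show ?case
    proof (intro impI allI)
      fix e :: real assume x: "x \<notin> S" and e: "0 < e"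
      define y where "y = x / c"
      have "y \<notin> N" using elim N'(2) by (auto simp: y_def)
      then obtain d where d: "d > 0" "\<And>h. 0 < h \<Longrightarrow> h < d \<Longrightarrow>
          norm (integral (cbox y (y + h *\<^sub>R One)) (indicator T :: complex \<Rightarrow> real) /\<^sub>R h ^ DIM(complex) - indicator T y) < e"
        using N(2)[of y e] e by auto
      have Ty: "indicator T y = (0::real)" using x c0 by (simp add: T_def y_def)
      show "\<exists>r0>0. \<forall>r. 0 < r \<and> r < r0 \<longrightarrow>
          measure lborel (S \<inter> {z. z / c \<in> cbox (x / c) (x / c + r *\<^sub>R One)}) \<le> e * r\<^sup>2"
      proof (intro exI[of _ d] conjI d allI impI)
        fix r assume r: "0 < r \<and> r < d"
        let ?B = "cbox y (y + r *\<^sub>R One)"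
        have "(*) c -` (S \<inter> {z. z / c \<in> ?B}) = T \<inter> ?B" using c0 by (auto simp: T_def)
        moreover have "{z. z / c \<in> ?B} = (\<lambda>z. z / c) -` ?B \<inter> space borel" by auto
        then have "{z. z / c \<in> ?B} \<in> sets borel" using measurable_sets[of "\<lambda>z. z / c" borel borel ?B] c0 by auto
        ultimately have m: "measure lborel (S \<inter> {z. z / c \<in> ?B}) = measure lborel (T \<inter> ?B)"
          using emeasure_lborel_rotate[OF c, of "S \<inter> {z. z / c \<in> ?B}"] by (simp add: measure_def)
        have "integral ?B (indicator T) = measure lborel (T \<inter> ?B)"
          using integral_indicator[OF Tc] by (simp add: measure_completion)
        then have "\<bar>measure lborel (T \<inter> ?B) / r\<^sup>2\<bar> < e"
          using d(2)[of r] r Ty by (simp add: DIM_complex divide_inverse_commute)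
        then have "measure lborel (T \<inter> ?B) \<le> e * r\<^sup>2" using r by (simp add: divide_less_eq)
        then show "measure lborel (S \<inter> {z. z / c \<in> cbox (x / c) (x / c + r *\<^sub>R One)}) \<le> e * r\<^sup>2"
          using m by (simp add: y_def)
      qed
    qed
  qed
qed

lemma in_cbox_One: "w \<in> cbox a (a + r *\<^sub>R One) \<longleftrightarrow> Re a \<le> Re w \<and> Re w \<le> Re a + r \<and> Im a \<le> Im w \<and> Im w \<le> Im a + r"
  by (auto simp: mem_box Basis_complex_def)

text \<open>The disc is covered by the four squares of side \<open>r\<close> with common corner
  \<open>x\<close>, each of which contributes \<open>e / 4 * r\<^sup>2\<close>.\<close>

lemma density_outside:
  fixes S :: "complex set"
  assumes S [measurable]: "S \<in> sets borel"
  shows "AE x in lborel. x \<notin> S \<longrightarrow> (\<forall>e>0. \<exists>r0>0. \<forall>r. 0 < r \<and> r < r0 \<longrightarrow> measure lborel (S \<inter> ball x r) \<le> e * r\<^sup>2)"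
proof -
  define Q where "Q c x r = S \<inter> {y. y / c \<in> cbox (x / c) (x / c + r *\<^sub>R One)}" for c x :: complex and r :: real
  have "AE x in lborel. x \<notin> S \<longrightarrow> (\<forall>e>0. \<exists>r0>0. \<forall>r. 0 < r \<and> r < r0 \<longrightarrow> measure lborel (Q c x r) \<le> e * r\<^sup>2)" if "norm c = 1" for c
    unfolding Q_def by (rule density_quadrant[OF S that])
  note A = this
  have n: "norm (-1 :: complex) = 1" "norm (-\<i>) = 1" by simp_all
  from A[OF norm_one] A[OF norm_ii] A[OF n(1)] A[OF n(2)] show ?thesis
  proof eventually_elim
    case (elim x)
    show ?case
    proof (intro impI allI)
      fix e :: real assume x: "x \<notin> S" and e: "0 < e"
      then have e4: "0 < e / 4" by simp
      obtain r1 where r1: "0 < r1" "\<And>r. 0 < r \<Longrightarrow> r < r1 \<Longrightarrow> measure lborel (Q 1 x r) \<le> e / 4 * r\<^sup>2" using elim(1) x e4 by blast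
      obtain r2 where r2: "0 < r2" "\<And>r. 0 < r \<Longrightarrow> r < r2 \<Longrightarrow> measure lborel (Q \<i> x r) \<le> e / 4 * r\<^sup>2" using elim(2) x e4 by blast
      obtain r3 where r3: "0 < r3" "\<And>r. 0 < r \<Longrightarrow> r < r3 \<Longrightarrow> measure lborel (Q (-1) x r) \<le> e / 4 * r\<^sup>2" using elim(3) x e4 by blast
      obtain r4 where r4: "0 < r4" "\<And>r. 0 < r \<Longrightarrow> r < r4 \<Longrightarrow> measure lborel (Q (-\<i>) x r) \<le> e / 4 * r\<^sup>2" using elim(4) x e4 by blast
      show "\<exists>r0>0. \<forall>r. 0 < r \<and> r < r0 \<longrightarrow> measure lborel (S \<inter> ball x r) \<le> e * r\<^sup>2"
      proof (intro exI[of _ "min (min r1 r2) (min r3 r4)"] conjI allI impI)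
        show "0 < min (min r1 r2) (min r3 r4)" using r1 r2 r3 r4 by simp
        fix r assume r: "0 < r \<and> r < min (min r1 r2) (min r3 r4)"
        have Qm[measurable]: "Q c x r \<in> sets borel" if "c \<noteq> 0" for c
        proof -
          have "{z. z / c \<in> cbox (x / c) (x / c + r *\<^sub>R One)} = (\<lambda>z. z / c) -` cbox (x / c) (x / c + r *\<^sub>R One) \<inter> space borel" by auto
          then have "{z. z / c \<in> cbox (x / c) (x / c + r *\<^sub>R One)} \<in> sets borel"
            using measurable_sets[of "\<lambda>z. z / c" borel borel "cbox (x / c) (x / c + r *\<^sub>R One)"] that by auto
          then show ?thesis by (simp add: Q_def)
        qed
        have Qb: "Q c x r \<subseteq> cball x (2 * r)" if c: "norm c = 1" for c
        proof
          fix y assume "y \<in> Q c x r"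
          then have "\<bar>Re (y / c - x / c)\<bar> \<le> r" "\<bar>Im (y / c - x / c)\<bar> \<le> r" by (auto simp: Q_def in_cbox_One)
          then have "norm (y / c - x / c) \<le> 2 * r" using cmod_le[of "y / c - x / c"] by simp
          moreover have "norm (y / c - x / c) = norm (y - x)" using c by (simp add: diff_divide_distrib[symmetric] norm_divide)
          ultimately show "y \<in> cball x (2 * r)" by (simp add: dist_norm norm_minus_commute)
        qed
        have Qf: "Q c x r \<in> fmeasurable lborel" if c: "norm c = 1" for c
        proof (rule fmeasurableI)
          have c0: "c \<noteq> 0" using c by auto
          show "Q c x r \<in> sets lborel" using Qm[OF c0] by simp
          show "emeasure lborel (Q c x r) < \<infinity>"
            using Qm[OF c0] Qb[OF c] by (intro bounded_finite_measure bounded_subset[OF bounded_cball]) auto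
        qed
        have sub: "S \<inter> ball x r \<subseteq> (Q 1 x r \<union> Q \<i> x r) \<union> (Q (-1) x r \<union> Q (-\<i>) x r)"
        proof
          fix y assume y: "y \<in> S \<inter> ball x r"
          have "\<bar>Re (y - x)\<bar> \<le> r" "\<bar>Im (y - x)\<bar> \<le> r"
            using y abs_Re_le_cmod[of "y - x"] abs_Im_le_cmod[of "y - x"] by (auto simp: dist_norm norm_minus_commute)
          then show "y \<in> (Q 1 x r \<union> Q \<i> x r) \<union> (Q (-1) x r \<union> Q (-\<i>) x r)"
            using y unfolding Q_def in_cbox_One by (auto simp: abs_le_iff)
        qed
        have f: "Q 1 x r \<in> fmeasurable lborel" "Q \<i> x r \<in> fmeasurable lborel" "Q (-1) x r \<in> fmeasurable lborel" "Q (-\<i>) x r \<in> fmeasurable lborel"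
          using Qf by auto
        have "measure lborel (S \<inter> ball x r) \<le> measure lborel ((Q 1 x r \<union> Q \<i> x r) \<union> (Q (-1) x r \<union> Q (-\<i>) x r))"
          by (rule measure_mono_fmeasurable[OF sub]) (use f in auto)
        also have "\<dots> \<le> (measure lborel (Q 1 x r) + measure lborel (Q \<i> x r)) + (measure lborel (Q (-1) x r) + measure lborel (Q (-\<i>) x r))"
          using f by (intro order_trans[OF measure_Un_le] add_mono) auto
        also have "\<dots> \<le> (e / 4 * r\<^sup>2 + e / 4 * r\<^sup>2) + (e / 4 * r\<^sup>2 + e / 4 * r\<^sup>2)"
          using r r1 r2 r3 r4 by (intro add_mono) auto
        also have "\<dots> = e * r\<^sup>2" by simp
        finally show "measure lborel (S \<inter> ball x r) \<le> e * r\<^sup>2" .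
      qed
    qed
  qed
qed

section \<open>The obstacle problem of the Thomas-Fermi model\<close>

definition tf_obstacle :: "complex list \<Rightarrow> real \<Rightarrow> complex \<Rightarrow> real" where
  "tf_obstacle xs \<rho> x = - (\<Sum>i<length xs. ln_mean \<rho> (x - xs ! i))"

lemma ball_mean_ln_mean_translate: "ball_mean r (\<lambda>y. ln_mean \<rho> (y - a)) x = ball_mean r (ln_mean \<rho>) (x - a)"
  using ball_mean_translate[of r "ln_mean \<rho>" "- a" x] by simp

context
  fixes \<rho> :: real
  assumes \<rho>: "0 < \<rho>"
begin

lemma ln_mean_translate_cont: "continuous_on S (\<lambda>y. ln_mean \<rho> (y - a))"
  by (rule continuous_on_compose2[OF ln_mean_cont[OF \<rho>, of UNIV]]) (auto intro!: continuous_intros)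

lemma tf_obstacle_cont: "continuous_on S (tf_obstacle xs \<rho>)"
  unfolding tf_obstacle_def by (intro continuous_intros ln_mean_translate_cont)

lemma tf_obstacle_lipschitz: "tf_obstacle xs \<rho> x \<le> tf_obstacle xs \<rho> y + real (length xs) * (2 / \<rho>\<^sup>2 + 1) * norm (x - y)"
proof -
  have "ln_mean \<rho> (y - xs ! i) \<le> ln_mean \<rho> (x - xs ! i) + (2 / \<rho>\<^sup>2 + 1) * norm (x - y)" for i
    using ln_mean_lipschitz[OF \<rho>, of "y - xs ! i" "x - xs ! i"] by (simp add: abs_le_iff norm_minus_commute)
  then have "(\<Sum>i<length xs. ln_mean \<rho> (y - xs ! i)) \<le> (\<Sum>i<length xs. ln_mean \<rho> (x - xs ! i) + (2 / \<rho>\<^sup>2 + 1) * norm (x - y))"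
    by (intro sum_mono)
  then show ?thesis by (simp add: tf_obstacle_def sum.distrib)
qed

lemma ball_mean_tf_obstacle: "ball_mean r (tf_obstacle xs \<rho>) x = - (\<Sum>i<length xs. ball_mean r (ln_mean \<rho>) (x - xs ! i))"
proof -
  have "ball_mean r (tf_obstacle xs \<rho>) x = - ball_mean r (\<lambda>x. \<Sum>i<length xs. ln_mean \<rho> (x - xs ! i)) x"
    unfolding tf_obstacle_def[abs_def] by (rule ball_mean_uminus)
  also have "ball_mean r (\<lambda>x. \<Sum>i<length xs. ln_mean \<rho> (x - xs ! i)) x = (\<Sum>i<length xs. ball_mean r (\<lambda>x. ln_mean \<rho> (x - xs ! i)) x)"
    by (intro ball_mean_sum mean_integrable_cont ln_mean_translate_cont)
  finally show ?thesis by (simp only: ball_mean_ln_mean_translate)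
qed

lemma ball_mean_tf_obstacle_le: "0 < r \<Longrightarrow> ball_mean r (tf_obstacle xs \<rho>) x \<le> tf_obstacle xs \<rho> x"
  unfolding ball_mean_tf_obstacle by (simp add: tf_obstacle_def sum_mono ln_mean_ball_mean(1)[OF \<rho>])

lemma ball_mean_tf_obstacle_ge:
  assumes "0 < r"
  shows "tf_obstacle xs \<rho> x - real (length xs) * (r\<^sup>2 / (4 * \<rho>\<^sup>2)) \<le> ball_mean r (tf_obstacle xs \<rho>) x"
proof -
  have "(\<Sum>i<length xs. ball_mean r (ln_mean \<rho>) (x - xs ! i)) \<le> (\<Sum>i<length xs. ln_mean \<rho> (x - xs ! i) + r\<^sup>2 / (4 * \<rho>\<^sup>2))"
    by (intro sum_mono ln_mean_ball_mean(2)[OF \<rho> assms])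
  then show ?thesis unfolding ball_mean_tf_obstacle by (simp add: tf_obstacle_def sum.distrib)
qed

lemma ball_shift: "ball (x - a) r \<subseteq> ball 0 \<rho> \<longleftrightarrow> ball x r \<subseteq> ball a \<rho>" for a x :: complex
proof -
  have "ball (x - a) r = (\<lambda>z. z - a) ` ball x r" "ball 0 \<rho> = (\<lambda>z. z - a) ` ball a \<rho>"
    using image_add_ball[of "- a" x r] image_add_ball[of "- a" a \<rho>] by auto
  then show ?thesis by (simp add: inj_image_subset_iff)
qed

lemma ball_shift_disjoint: "ball x r \<inter> ball a \<rho> = {} \<Longrightarrow> ball (x - a) r \<inter> ball 0 \<rho> = {}" for a x :: complex
proof -
  assume d: "ball x r \<inter> ball a \<rho> = {}"
  have "False" if "z \<in> ball (x - a) r" "z \<in> ball 0 \<rho>" for z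
  proof -
    have "z + a \<in> ball x r" "z + a \<in> ball a \<rho>"
      using that by (simp_all add: dist_norm algebra_simps)
    then show False using d by blast
  qed
  then show ?thesis by blast
qed

text \<open>The nucleus \<open>j\<close> contributes its full defect; the other smeared nuclei can
  only lower the mean further.\<close>

lemma ball_mean_tf_obstacle_inside:
  assumes r: "0 < r" and j: "j < length xs" and b: "ball x r \<subseteq> ball (xs ! j) \<rho>"
  shows "ball_mean r (tf_obstacle xs \<rho>) x \<le> tf_obstacle xs \<rho> x - r\<^sup>2 / (4 * \<rho>\<^sup>2)"
proof -
  have "(\<Sum>i<length xs. ln_mean \<rho> (x - xs ! i) + (if i = j then r\<^sup>2 / (4 * \<rho>\<^sup>2) else 0)) \<le> (\<Sum>i<length xs. ball_mean r (ln_mean \<rho>) (x - xs ! i))"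
  proof (intro sum_mono)
    fix i
    show "ln_mean \<rho> (x - xs ! i) + (if i = j then r\<^sup>2 / (4 * \<rho>\<^sup>2) else 0) \<le> ball_mean r (ln_mean \<rho>) (x - xs ! i)"
      using ln_mean_ball_mean(1)[OF \<rho> r, of "x - xs ! i"] ln_mean_ball_mean(3)[OF \<rho> r, of "x - xs ! j"] b by (auto simp: ball_shift)
  qed
  then show ?thesis unfolding ball_mean_tf_obstacle using j by (simp add: tf_obstacle_def sum.distrib)
qed

lemma ball_mean_tf_obstacle_far:
  assumes r: "0 < r" and d: "\<And>i. i < length xs \<Longrightarrow> ball x r \<inter> ball (xs ! i) \<rho> = {}"
  shows "ball_mean r (tf_obstacle xs \<rho>) x = tf_obstacle xs \<rho> x"
  unfolding ball_mean_tf_obstacle tf_obstacle_def using ln_mean_ball_mean(4)[OF \<rho> r ball_shift_disjoint[OF d]] by simp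

lemma tf_obstacle_le_Vnuc: "x \<notin> set xs \<Longrightarrow> tf_obstacle xs \<rho> x \<le> Vnuc xs x"
  unfolding tf_obstacle_def Vnuc_def by (intro le_imp_neg_le sum_mono ln_mean_ge_ln) (auto simp: in_set_conv_nth)

lemma tf_obstacle_eq_Vnuc: "(\<And>i. i < length xs \<Longrightarrow> \<rho> \<le> norm (x - xs ! i)) \<Longrightarrow> tf_obstacle xs \<rho> x = Vnuc xs x"
  unfolding tf_obstacle_def Vnuc_def by (simp add: ln_mean_outside)

end

lemma tf_obstacle_antimono: "0 < \<rho> \<Longrightarrow> \<rho> \<le> \<rho>' \<Longrightarrow> tf_obstacle xs \<rho>' x \<le> tf_obstacle xs \<rho> x"
  unfolding tf_obstacle_def by (intro le_imp_neg_le sum_mono ln_mean_mono)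

text \<open>Each charge has density \<open>1 / (pi * \<rho>'\<^sup>2)\<close>, so the assumption on
  the length bounds the total density by 1, even where all discs overlap. This competitor shows that
  minorants exist and confines the noncontact set.\<close>

lemma tf_obstacle_in_minorants:
  assumes "0 < \<rho>" "\<rho> \<le> \<rho>'" "real (length xs) \<le> pi * \<rho>'\<^sup>2"
  shows "tf_obstacle xs \<rho>' \<in> minorants (tf_obstacle xs \<rho>)"
  unfolding minorants_def
proof (intro CollectI conjI allI impI tf_obstacle_antimono assms)
  have r': "0 < \<rho>'" using assms by simp
  show "continuous_on UNIV (tf_obstacle xs \<rho>')" by (rule tf_obstacle_cont[OF r'])
  fix x and r :: real assume r: "0 < r"
  have "real (length xs) * (r\<^sup>2 / (4 * \<rho>'\<^sup>2)) \<le> pi * \<rho>'\<^sup>2 * (r\<^sup>2 / (4 * \<rho>'\<^sup>2))"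
    by (intro mult_right_mono assms) auto
  also have "\<dots> = pi / 4 * r\<^sup>2" using r' by simp
  finally show "tf_obstacle xs \<rho>' x \<le> ball_mean r (tf_obstacle xs \<rho>') x + pi / 4 * r\<^sup>2"
    using ball_mean_tf_obstacle_ge[OF r' r, of xs x] by simp
qed

context
  fixes xs :: "complex list" and \<rho> :: real
  assumes \<rho>: "0 < \<rho>" and \<rho>1: "pi * \<rho>\<^sup>2 < 1"
begin

definition tf_sol :: "complex \<Rightarrow> real" where "tf_sol = obstacle_sol (tf_obstacle xs \<rho>)"
definition tf_set :: "complex set" where "tf_set = {x. tf_sol x < tf_obstacle xs \<rho> x}"
text \<open>The least radius for which \<open>tf_obstacle_in_minorants\<close> applies.\<close>

definition tf_radius :: real where "tf_radius = max \<rho> (sqrt (real (length xs) / pi))"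

lemma tf_radius: "0 < tf_radius" "\<rho> \<le> tf_radius" "real (length xs) \<le> pi * tf_radius\<^sup>2"
proof -
  have "(sqrt (real (length xs) / pi))\<^sup>2 \<le> tf_radius\<^sup>2" unfolding tf_radius_def by (intro power_mono) auto
  then show "real (length xs) \<le> pi * tf_radius\<^sup>2" by (simp add: divide_le_eq mult.commute)
qed (use \<rho> in \<open>auto simp: tf_radius_def\<close>)

lemma comp_in_minorants: "tf_obstacle xs tf_radius \<in> minorants (tf_obstacle xs \<rho>)" by (rule tf_obstacle_in_minorants[OF \<rho> tf_radius(2,3)])

lemma tf_obstacle_minorants_facts: "\<And>x y. tf_obstacle xs \<rho> x \<le> tf_obstacle xs \<rho> y + real (length xs) * (2 / \<rho>\<^sup>2 + 1) * norm (x - y)"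
  "0 \<le> real (length xs) * (2 / \<rho>\<^sup>2 + 1)" "minorants (tf_obstacle xs \<rho>) \<noteq> {}"
  using tf_obstacle_lipschitz[OF \<rho>] comp_in_minorants by auto

lemmas tf_sol_upper = obstacle_sol_upper[OF tf_obstacle_minorants_facts, folded tf_sol_def]
lemmas tf_sol_le = obstacle_sol_le[OF tf_obstacle_minorants_facts, folded tf_sol_def]
lemmas tf_sol_cont = obstacle_sol_cont[OF tf_obstacle_minorants_facts, folded tf_sol_def]
lemmas tf_sol_submean = obstacle_sol_submean[OF tf_obstacle_minorants_facts, folded tf_sol_def]
lemmas tf_sol_in_minorants = obstacle_sol_in_minorants[OF tf_obstacle_minorants_facts, folded tf_sol_def]
lemmas tf_sol_harmonic = obstacle_sol_harmonic[OF tf_obstacle_minorants_facts, folded tf_sol_def]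

lemma tf_set_open: "open tf_set"
  unfolding tf_set_def by (intro open_Collect_less tf_sol_cont tf_obstacle_cont[OF \<rho>])

lemma tf_set_measurable [measurable]: "tf_set \<in> sets borel" using tf_set_open by simp

lemma tf_sol_outside: "x \<notin> tf_set \<Longrightarrow> tf_sol x = tf_obstacle xs \<rho> x"
  using tf_sol_le[of x] by (simp add: tf_set_def)

text \<open>Away from the large discs both smeared potentials equal \<open>Vnuc\<close> by Newton's
  theorem, so the competitor already touches the obstacle.\<close>

lemma tf_set_subset: "x \<in> tf_set \<Longrightarrow> \<exists>i<length xs. norm (x - xs ! i) < tf_radius"
proof (rule ccontr)
  assume x: "x \<in> tf_set" and "\<not> (\<exists>i<length xs. norm (x - xs ! i) < tf_radius)"
  then have n: "tf_radius \<le> norm (x - xs ! i)" if "i < length xs" for i using that by force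
  have "tf_obstacle xs tf_radius x = Vnuc xs x" by (rule tf_obstacle_eq_Vnuc[OF tf_radius(1)]) (rule n)
  moreover have "tf_obstacle xs \<rho> x = Vnuc xs x" by (rule tf_obstacle_eq_Vnuc[OF \<rho>]) (use n tf_radius(2) in force)
  ultimately show False using tf_sol_upper[OF comp_in_minorants, of x] x by (simp add: tf_set_def)
qed

definition tf_bound :: real where "tf_bound = tf_radius + (\<Sum>i<length xs. norm (xs ! i))"

lemma norm_le_tf_bound: "i < length xs \<Longrightarrow> norm (xs ! i) + tf_radius \<le> tf_bound"
  unfolding tf_bound_def using member_le_sum[of i "{..<length xs}" "\<lambda>i. norm (xs ! i)"] by simp

lemma tf_bound_pos: "0 < tf_bound" unfolding tf_bound_def using tf_radius(1) by (simp add: add_pos_nonneg sum_nonneg)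

lemma tf_set_bounded: "tf_set \<subseteq> ball 0 tf_bound"
proof
  fix x assume "x \<in> tf_set"
  then obtain i where i: "i < length xs" "norm (x - xs ! i) < tf_radius" using tf_set_subset by blast
  have "norm x \<le> norm (x - xs ! i) + norm (xs ! i)" using norm_triangle_sub[of x "xs ! i"] by simp
  then show "x \<in> ball 0 tf_bound" using i norm_le_tf_bound[OF i(1)] by simp
qed

text \<open>At a contact point in such a disc, \<open>tf_sol\<close> would lie below
  \<open>tf_obstacle\<close> in the mean, and the obstacle loses
  \<open>r\<^sup>2 / (4 * \<rho>\<^sup>2)\<close>, more than the allowance
  \<open>pi / 4 * r\<^sup>2\<close>.\<close>

lemma balls_subset_tf_set:
  assumes j: "j < length xs"
  shows "ball (xs ! j) \<rho> \<subseteq> tf_set"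
proof
  fix x assume x: "x \<in> ball (xs ! j) \<rho>"
  show "x \<in> tf_set"
  proof (rule ccontr)
    assume "x \<notin> tf_set"
    then have e: "tf_sol x = tf_obstacle xs \<rho> x" by (rule tf_sol_outside)
    obtain r where r: "0 < r" "ball x r \<subseteq> ball (xs ! j) \<rho>" using x open_ball open_contains_ball by metis
    have "tf_sol x \<le> ball_mean r tf_sol x + pi / 4 * r\<^sup>2" by (rule tf_sol_submean[OF r(1)])
    also have "ball_mean r tf_sol x \<le> ball_mean r (tf_obstacle xs \<rho>) x" by (intro ball_mean_mono mean_integrable_cont tf_sol_cont tf_obstacle_cont[OF \<rho>] tf_sol_le)
    also have "\<dots> \<le> tf_obstacle xs \<rho> x - r\<^sup>2 / (4 * \<rho>\<^sup>2)" by (rule ball_mean_tf_obstacle_inside[OF \<rho> r(1) j r(2)])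
    finally have "r\<^sup>2 / (4 * \<rho>\<^sup>2) \<le> pi / 4 * r\<^sup>2" using e by simp
    then have "1 \<le> pi * \<rho>\<^sup>2" using r(1) \<rho> by (simp add: field_simps)
    then show False using \<rho>1 by simp
  qed
qed

text \<open>In the noncontact set this is part of the equation found by lifting; at a contact point
  \<open>tf_sol\<close> is touched from above by the obstacle, which is superharmonic. Locality of
  the sub-mean value property for \<open>- tf_sol\<close> joins the two cases.\<close>

lemma tf_sol_supermean: "0 < r \<Longrightarrow> ball_mean r tf_sol x \<le> tf_sol x"
proof -
  assume r: "0 < r"
  have "local_submean (\<lambda>z. - tf_sol z)"
    unfolding local_submean_def
  proof (intro allI impI)
    fix x :: complex and e r0 :: real assume e: "0 < e" "0 < r0"
    show "\<exists>r. 0 < r \<and> r < r0 \<and> - tf_sol x \<le> ball_mean r (\<lambda>z. - tf_sol z) x + e * r\<^sup>2"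
    proof (cases "x \<in> tf_set")
      case True
      then obtain R where R: "0 < R" "\<And>y r. 0 < r \<Longrightarrow> cball y r \<subseteq> cball x R \<Longrightarrow> tf_sol y = ball_mean r tf_sol y + pi / 4 * r\<^sup>2"
        using tf_sol_harmonic[of x] by (auto simp: tf_set_def)
      define r where "r = min R r0 / 2"
      have r: "0 < r" "r < r0" "cball x r \<subseteq> cball x R" using R(1) e by (auto simp: r_def)
      have "0 \<le> e * r\<^sup>2" "0 \<le> pi / 4 * r\<^sup>2" using e by auto
      then have "- tf_sol x \<le> ball_mean r (\<lambda>z. - tf_sol z) x + e * r\<^sup>2" using R(2)[OF r(1,3)] unfolding ball_mean_uminus by linarith
      then show ?thesis using r by blast
    next
      case False
      define r where "r = r0 / 2"
      have r: "0 < r" "r < r0" using e by (auto simp: r_def)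
      have "ball_mean r tf_sol x \<le> ball_mean r (tf_obstacle xs \<rho>) x" by (intro ball_mean_mono mean_integrable_cont tf_sol_cont tf_obstacle_cont[OF \<rho>] tf_sol_le)
      also have "\<dots> \<le> tf_obstacle xs \<rho> x" by (rule ball_mean_tf_obstacle_le[OF \<rho> r(1)])
      finally have le: "ball_mean r tf_sol x \<le> tf_sol x" using tf_sol_outside[OF False] by simp
      have "0 \<le> e * r\<^sup>2" using e by auto
      then have "- tf_sol x \<le> ball_mean r (\<lambda>z. - tf_sol z) x + e * r\<^sup>2" using le unfolding ball_mean_uminus by linarith
      then show ?thesis using r by blast
    qed
  qed
  then have "- tf_sol x \<le> ball_mean r (\<lambda>z. - tf_sol z) x"
    by (intro submean_global r continuous_intros tf_sol_cont)
  then show ?thesis by (simp add: ball_mean_uminus)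
qed

definition tf_rem :: "complex \<Rightarrow> real" where "tf_rem x = tf_sol x + log_pot tf_set x"

lemmas tf_set_bounds = ball_mean_log_pot_bounds[OF tf_set_measurable tf_set_bounded]

lemma tf_rem_cont: "continuous_on S tf_rem"
  unfolding tf_rem_def by (intro continuous_intros tf_sol_cont log_pot_continuous[OF tf_set_measurable tf_set_bounded])

lemma ball_mean_tf_rem: "ball_mean r tf_rem x = ball_mean r tf_sol x + ball_mean r (log_pot tf_set) x"
  unfolding tf_rem_def by (intro ball_mean_add mean_integrable_cont tf_sol_cont log_pot_continuous[OF tf_set_measurable tf_set_bounded])

text \<open>The excess of the disc mean lies in \<open>[- pi / 4 * r\<^sup>2, 0]\<close> for
  \<open>tf_sol\<close> and in \<open>[0, pi / 4 * r\<^sup>2]\<close> for the potential. This is the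
  a priori bound that \<open>submean_remove_null\<close> requires on the exceptional set.\<close>

lemma tf_rem_bounds:
  assumes "0 < r"
  shows "\<bar>ball_mean r tf_rem x - tf_rem x\<bar> \<le> pi / 4 * r\<^sup>2"
  using tf_sol_submean[OF assms, of x] tf_sol_supermean[OF assms, of x] tf_set_bounds(1,2)[OF assms, of x] unfolding ball_mean_tf_rem tf_rem_def by linarith

lemma tf_rem_inside:
  assumes "x \<in> tf_set"
  shows "\<exists>r0>0. \<forall>r. 0 < r \<and> r < r0 \<longrightarrow> ball_mean r tf_rem x = tf_rem x"
proof -
  obtain R where R: "0 < R" "\<And>y r. 0 < r \<Longrightarrow> cball y r \<subseteq> cball x R \<Longrightarrow> tf_sol y = ball_mean r tf_sol y + pi / 4 * r\<^sup>2"
    using tf_sol_harmonic[of x] assms by (auto simp: tf_set_def)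
  obtain R' where R': "0 < R'" "ball x R' \<subseteq> tf_set" using tf_set_open assms open_contains_ball by blast
  show ?thesis
  proof (intro exI[of _ "min R R'"] conjI allI impI)
    fix r assume r: "0 < r \<and> r < min R R'"
    then have "tf_sol x = ball_mean r tf_sol x + pi / 4 * r\<^sup>2" by (intro R(2)) auto
    moreover have "ball x r \<subseteq> tf_set" using R'(2) r by (auto simp: subset_iff)
    then have "ball_mean r (log_pot tf_set) x = log_pot tf_set x + pi / 4 * r\<^sup>2" using r by (intro tf_set_bounds(3)) auto
    ultimately show "ball_mean r tf_rem x = tf_rem x" unfolding ball_mean_tf_rem tf_rem_def by simp
  qed (use R(1) R'(1) in auto)
qed

text \<open>Near \<open>x\<close> the obstacle is harmonic, so the gap \<open>f\<close> between
  obstacle and solution is nonnegative and sub-mean, with \<open>f x = 0\<close>. Its mean over the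
  disc of radius \<open>2 * r\<close> is at most \<open>pi * r\<^sup>2\<close>, whence
  \<open>f \<le> 4 * pi * r\<^sup>2\<close> on the disc of radius \<open>r\<close>. As
  \<open>f\<close> vanishes off \<open>tf_set\<close>, its mean is controlled by the area of
  \<open>tf_set\<close> in the disc.\<close>

lemma tf_rem_outside:
  assumes x: "x \<notin> tf_set" and d: "0 < d" and far: "\<And>i. i < length xs \<Longrightarrow> \<rho> + d \<le> norm (x - xs ! i)" and r: "0 < r" "2 * r < d"
  shows "\<bar>ball_mean r tf_rem x - tf_rem x\<bar> \<le> 4 * measure lborel (tf_set \<inter> ball x r) + (LINT y|lborel. indicator tf_set y * ln_defect r (x - y))"
proof -
  define f where "f y = tf_obstacle xs \<rho> y - tf_sol y" for y
  have cf: "continuous_on S f" for S unfolding f_def by (intro continuous_intros tf_sol_cont tf_obstacle_cont[OF \<rho>])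
  have f0: "0 \<le> f y" for y using tf_sol_le[of y] by (simp add: f_def)
  have pfar: "ball_mean s (tf_obstacle xs \<rho>) y = tf_obstacle xs \<rho> y" if "0 < s" "dist x y + s \<le> d" for s y
  proof (rule ball_mean_tf_obstacle_far[OF \<rho> that(1)])
    fix i assume i: "i < length xs"
    have "False" if "z \<in> ball y s" "z \<in> ball (xs ! i) \<rho>" for z
      using far[OF i] \<open>dist x y + s \<le> d\<close> that dist_triangle[of x "xs ! i" y] dist_triangle[of y "xs ! i" z]
      by (simp add: dist_norm[symmetric] dist_commute)
    then show "ball y s \<inter> ball (xs ! i) \<rho> = {}" by blast
  qed
  have bf: "ball_mean s f y = tf_obstacle xs \<rho> y - ball_mean s tf_sol y" if "0 < s" "dist x y + s \<le> d" for s y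
    unfolding f_def by (subst ball_mean_diff) (auto intro!: mean_integrable_cont tf_sol_cont tf_obstacle_cont[OF \<rho>] simp: pfar[OF that])
  have fx: "f x = 0" using tf_sol_outside[OF x] by (simp add: f_def)
  have le: "f y \<le> 4 * pi * r\<^sup>2" if y: "y \<in> ball x r" for y
  proof -
    have d1: "dist x y + r \<le> d" using y r by simp
    have "f y \<le> ball_mean r f y" using bf[OF r(1) d1] tf_sol_supermean[OF r(1), of y] by (simp add: f_def)
    \<comment> \<open>The disc of radius \<open>r\<close> about \<open>y\<close> lies in the disc of
      radius \<open>2 * r\<close> about \<open>x\<close>, which has four times its area, and
      \<open>f\<close> is nonnegative.\<close>
    also have "\<dots> \<le> 4 * ball_mean (2 * r) f x"
    proof -
      have "(LINT z|lborel. indicator (ball 0 r) z * f (y + z)) \<le> (LINT z|lborel. indicator (ball 0 (2 * r)) ((y - x) + z) * f (x + ((y - x) + z)))"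
      proof (rule integral_mono)
        show "integrable lborel (\<lambda>z. indicator (ball 0 r) z * f (y + z))" using mean_integrable_cont[OF cf, of r y] by (simp add: mean_integrable_def)
        have "integrable lborel (\<lambda>z. indicator (ball 0 (2 * r)) z * f (x + z))" using mean_integrable_cont[OF cf, of "2 * r" x] by (simp add: mean_integrable_def)
        from integrable_lborel_translate[OF this, of "y - x"]
        show "integrable lborel (\<lambda>z. indicator (ball 0 (2 * r)) ((y - x) + z) * f (x + ((y - x) + z)))" .
        fix z
        have "norm ((y - x) + z) < 2 * r" if "norm z < r"
          using norm_triangle_ineq[of "y - x" z] that y by (simp add: dist_norm norm_minus_commute)
        then show "indicator (ball 0 r) z * f (y + z) \<le> indicator (ball 0 (2 * r)) ((y - x) + z) * f (x + ((y - x) + z))"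
          using f0[of "y + z"] by (auto simp: algebra_simps split: split_indicator)
      qed
      also have "\<dots> = (LINT z|lborel. indicator (ball 0 (2 * r)) z * f (x + z))"
      proof (rule integral_lborel_translate)
        have [measurable]: "f \<in> borel_measurable borel" by (rule borel_measurable_continuous_onI[OF cf])
        have [measurable]: "ball (0::complex) (2 * r) \<in> sets borel" by simp
        show "(\<lambda>z. indicator (ball 0 (2 * r)) z * f (x + z)) \<in> borel_measurable borel" by measurable
      qed
      finally have "(LINT z|lborel. indicator (ball 0 r) z * f (y + z)) / (pi * r\<^sup>2) \<le> (LINT z|lborel. indicator (ball 0 (2 * r)) z * f (x + z)) / (pi * r\<^sup>2)"
        by (rule divide_right_mono) simp
      then show ?thesis by (simp add: ball_mean_def power_mult_distrib)
    qed
    also have "ball_mean (2 * r) f x \<le> pi * r\<^sup>2"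
    proof -
      have "ball_mean (2 * r) f x = tf_sol x - ball_mean (2 * r) tf_sol x" using bf[of "2 * r" x] r tf_sol_outside[OF x] by simp
      also have "\<dots> \<le> pi / 4 * (2 * r)\<^sup>2" using tf_sol_submean[of "2 * r" x] r by simp
      finally show ?thesis by (simp add: power_mult_distrib)
    qed
    finally show ?thesis by simp
  qed
  have "ball_mean r f x \<le> 4 * measure lborel (tf_set \<inter> ball x r)"
  proof -
    have [measurable]: "tf_set \<inter> ball x r \<in> sets borel" by simp
    have fin: "emeasure lborel (tf_set \<inter> ball x r) < \<infinity>" by (intro bounded_finite_measure) auto
    have ind: "indicator (tf_set \<inter> ball x r) (x + z) = (indicator (ball 0 r) z * indicator tf_set (x + z) :: real)" for z
      by (auto simp: dist_norm split: split_indicator)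
    have isb: "integrable lborel (indicator (tf_set \<inter> ball x r) :: complex \<Rightarrow> real)" using fin by (auto simp: less_top)
    have "(LINT z|lborel. indicator (ball 0 r) z * f (x + z)) \<le> (LINT z|lborel. 4 * pi * r\<^sup>2 * indicator (tf_set \<inter> ball x r) (x + z))"
    proof (rule integral_mono)
      show "integrable lborel (\<lambda>z. indicator (ball 0 r) z * f (x + z))" using mean_integrable_cont[OF cf, of r x] by (simp add: mean_integrable_def)
      show "integrable lborel (\<lambda>z. 4 * pi * r\<^sup>2 * indicator (tf_set \<inter> ball x r) (x + z))"
        by (intro integrable_mult_right integrable_lborel_translate[OF isb])
      fix z
      show "indicator (ball 0 r) z * f (x + z) \<le> 4 * pi * r\<^sup>2 * indicator (tf_set \<inter> ball x r) (x + z)"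
        using le[of "x + z"] tf_sol_outside[of "x + z"] unfolding ind by (auto simp: f_def dist_norm split: split_indicator)
    qed
    also have "\<dots> = 4 * pi * r\<^sup>2 * measure lborel (tf_set \<inter> ball x r)"
      using integral_lborel_translate[of "\<lambda>z. 4 * pi * r\<^sup>2 * indicator (tf_set \<inter> ball x r) z" x] by simp
    finally show ?thesis using r by (simp add: ball_mean_def field_simps)
  qed
  moreover have "0 \<le> ball_mean r f x"
  proof -
    have "ball_mean r (\<lambda>_. 0) x \<le> ball_mean r f x" by (intro ball_mean_mono mean_integrable_cont cf f0) auto
    then show ?thesis by (simp add: ball_mean_def)
  qed
  moreover have "ball_mean r tf_rem x - tf_rem x = - ball_mean r f x + (LINT y|lborel. indicator tf_set y * ln_defect r (x - y))"
    using bf[of r x] r tf_sol_outside[OF x] ball_mean_log_pot(1)[OF tf_set_measurable tf_set_bounded r(1), of x] unfolding ball_mean_tf_rem tf_rem_def by simp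
  moreover have "0 \<le> (LINT y|lborel. indicator tf_set y * ln_defect r (x - y))"
    using ball_mean_log_pot(1)[OF tf_set_measurable tf_set_bounded r(1), of x] tf_set_bounds(1)[OF r(1), of x] by simp
  ultimately show ?thesis by (simp add: abs_le_iff)
qed

lemma tf_rem_harmonic: "0 < r \<Longrightarrow> ball_mean r tf_rem x = tf_rem x"
proof -
  assume r: "0 < r"
  obtain N0 where N0: "N0 \<in> null_sets lborel" and dens: "\<And>x. x \<notin> N0 \<Longrightarrow> x \<notin> tf_set \<Longrightarrow>
      (\<forall>e>0. \<exists>r0>0. \<forall>r. 0 < r \<and> r < r0 \<longrightarrow> measure lborel (tf_set \<inter> ball x r) \<le> e * r\<^sup>2)"
    using AE_E3[OF density_outside[OF tf_set_measurable]] by (metis (mono_tags, lifting) DiffI UNIV_I space_borel space_lborel)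
  \<comment> \<open>Excluded are the points where the density theorem fails and the circles bounding
    the smeared nuclei, near which the obstacle is not harmonic. The intersection with a disc
    provides the boundedness that \<open>submean_remove_null\<close> demands.\<close>
  define N where "N = (N0 \<union> (\<Union>i<length xs. sphere (xs ! i) \<rho>)) \<inter> ball 0 (tf_bound + 1)"
  have sph: "sphere a \<rho> \<in> null_sets lborel" for a :: complex
    using negligible_sphere[of a \<rho>] by (auto simp: negligible_iff_null_sets null_sets_completion_iff)
  have N: "N \<in> null_sets lborel"
    unfolding N_def by (intro null_set_Int2 null_sets.Un N0 null_sets_UN' sph) auto
  have Nb: "N \<subseteq> ball 0 (tf_bound + 1)" by (simp add: N_def)
  have loc: "\<exists>r0>0. \<forall>r. 0 < r \<and> r < r0 \<longrightarrow> \<bar>ball_mean r tf_rem x - tf_rem x\<bar> \<le> e * r\<^sup>2" if x: "x \<notin> N" and e: "0 < e" for x e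
  proof (cases "x \<in> tf_set")
    case True
    then show ?thesis using tf_rem_inside[OF True] e by (metis abs_zero diff_self mult_nonneg_nonneg order_less_imp_le zero_le_power2)
  next
    case False
    have rho: "\<rho> \<le> norm (x - xs ! i)" if i: "i < length xs" for i
      using balls_subset_tf_set[OF i] False by (force simp: dist_norm norm_minus_commute)
    have d: "\<exists>d>0. \<forall>i<length xs. \<rho> + d \<le> norm (x - xs ! i)"
      if "\<And>i. i < length xs \<Longrightarrow> \<rho> < norm (x - xs ! i)"
    proof (cases "xs = []")
      case True
      then show ?thesis by (intro exI[of _ 1]) auto
    next
      case False
      define d where "d = Min ((\<lambda>i. norm (x - xs ! i) - \<rho>) ` {..<length xs})"
      have "0 < d" unfolding d_def using False that by (subst Min_gr_iff) auto
      moreover have "d \<le> norm (x - xs ! i) - \<rho>" if "i < length xs" for i unfolding d_def using that by (intro Min_le) auto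
      ultimately show ?thesis by (intro exI[of _ d]) force
    qed
    have main: ?thesis if d0: "0 < d" "\<And>i. i < length xs \<Longrightarrow> \<rho> + d \<le> norm (x - xs ! i)"
      and dn: "\<And>e. 0 < e \<Longrightarrow> \<exists>r0>0. \<forall>r. 0 < r \<and> r < r0 \<longrightarrow> measure lborel (tf_set \<inter> ball x r) \<le> e * r\<^sup>2" for d
    proof -
      obtain r1 where r1: "0 < r1" "\<And>r. 0 < r \<Longrightarrow> r < r1 \<Longrightarrow> measure lborel (tf_set \<inter> ball x r) \<le> e / 8 * r\<^sup>2"
        using dn[of "e / 8"] e by auto
      obtain r2 where r2: "0 < r2" "\<And>r. 0 < r \<Longrightarrow> r < r2 \<Longrightarrow> (LINT y|lborel. indicator tf_set y * ln_defect r (x - y)) \<le> e / 2 * r\<^sup>2"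
        using integral_ln_defect_small[OF tf_set_measurable tf_set_bounded half_gt_zero[OF e] dn] by blast
      show ?thesis
      proof (intro exI[of _ "min (min r1 r2) (d / 2)"] conjI allI impI)
        show "0 < min (min r1 r2) (d / 2)" using r1 r2 d0 by simp
        fix r assume r: "0 < r \<and> r < min (min r1 r2) (d / 2)"
        have "\<bar>ball_mean r tf_rem x - tf_rem x\<bar> \<le> 4 * measure lborel (tf_set \<inter> ball x r) + (LINT y|lborel. indicator tf_set y * ln_defect r (x - y))"
          using r by (intro tf_rem_outside[OF False d0]) auto
        also have "\<dots> \<le> 4 * (e / 8 * r\<^sup>2) + e / 2 * r\<^sup>2"
          using r r1(2)[of r] r2(2)[of r] by (intro add_mono mult_left_mono) auto
        finally show "\<bar>ball_mean r tf_rem x - tf_rem x\<bar> \<le> e * r\<^sup>2" by simp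
      qed
    qed
    show ?thesis
    proof (cases "x \<in> ball 0 (tf_bound + 1)")
      case True
      then have "x \<notin> N0" "x \<notin> (\<Union>i<length xs. sphere (xs ! i) \<rho>)" using x by (auto simp: N_def)
      then have "\<rho> < norm (x - xs ! i)" if "i < length xs" for i
        using rho[OF that] that by (fastforce simp: dist_norm norm_minus_commute)
      then obtain d0 where "0 < d0" "\<forall>i<length xs. \<rho> + d0 \<le> norm (x - xs ! i)" using d by blast
      then show ?thesis using main[of d0] dens[OF \<open>x \<notin> N0\<close> False] by blast
    next
      case xb: False
      \<comment> \<open>Outside the large disc no point is exceptional: both the smeared nuclei and
        \<open>tf_set\<close> are at distance at least 1, so the same estimate applies with
        \<open>d = 1\<close> and empty intersections.\<close>
      have far: "\<rho> + 1 \<le> norm (x - xs ! i)" if "i < length xs" for i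
        using norm_le_tf_bound[OF that] tf_radius(2) xb norm_triangle_ineq2[of x "xs ! i"] by simp
      have z: "measure lborel (tf_set \<inter> ball x r) = 0" if "r < 1" for r
      proof -
        have "tf_set \<inter> ball x r = {}"
        proof (rule ccontr)
          assume "tf_set \<inter> ball x r \<noteq> {}"
          then obtain y where "norm y < tf_bound" "norm (x - y) < r" using tf_set_bounded by (force simp: dist_norm)
          then show False using xb that norm_triangle_ineq2[of x y] by simp
        qed
        then show ?thesis by simp
      qed
      show ?thesis
      proof (rule main[of 1, OF _ far])
        show "\<exists>r0>0. \<forall>r. 0 < r \<and> r < r0 \<longrightarrow> measure lborel (tf_set \<inter> ball x r) \<le> e * r\<^sup>2" if "0 < e" for e
          using z that by (intro exI[of _ 1]) auto
      qed auto
    qed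
  qed
  show "ball_mean r tf_rem x = tf_rem x"
  proof (rule antisym)
    show "tf_rem x \<le> ball_mean r tf_rem x"
    proof (rule submean_remove_null[OF tf_rem_cont _ N Nb _ r])
      show "tf_rem y \<le> ball_mean s tf_rem y + pi / 4 * s\<^sup>2" if "0 < s" for y s using tf_rem_bounds[OF that, of y] by linarith
      show "\<exists>r0>0. \<forall>r. 0 < r \<and> r < r0 \<longrightarrow> tf_rem y \<le> ball_mean r tf_rem y + e * r\<^sup>2" if "y \<notin> N" "0 < e" for y e
        using loc[OF that] by (auto simp: abs_le_iff algebra_simps)
    qed
    have "- tf_rem x \<le> ball_mean r (\<lambda>z. - tf_rem z) x"
    proof (rule submean_remove_null[OF _ _ N Nb _ r])
      show "continuous_on UNIV (\<lambda>z. - tf_rem z)" by (intro continuous_intros tf_rem_cont)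
      show "- tf_rem y \<le> ball_mean s (\<lambda>z. - tf_rem z) y + pi / 4 * s\<^sup>2" if "0 < s" for y s
        unfolding ball_mean_uminus using tf_rem_bounds[OF that, of y] by linarith
      show "\<exists>r0>0. \<forall>r. 0 < r \<and> r < r0 \<longrightarrow> - tf_rem y \<le> ball_mean r (\<lambda>z. - tf_rem z) y + e * r\<^sup>2" if "y \<notin> N" "0 < e" for y e
        unfolding ball_mean_uminus using loc[OF that] by (auto simp: abs_le_iff algebra_simps)
    qed
    then show "ball_mean r tf_rem x \<le> tf_rem x" by (simp add: ball_mean_uminus)
  qed
qed

end

section \<open>Mass and potential of the noncontact set\<close>

lemma Vnuc_at_infinity: "((\<lambda>x. Vnuc xs x + real (length xs) * ln (norm x)) \<longlongrightarrow> 0) at_infinity"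
proof -
  have one: "((\<lambda>x. ln (norm (x - a)) - ln (norm x)) \<longlongrightarrow> 0) at_infinity" for a :: complex
  proof (rule Lim_null_comparison)
    define R where "R = norm a + 1"
    have "((\<lambda>x::complex. 2 * R * inverse (norm x)) \<longlongrightarrow> 2 * R * 0) at_infinity"
      by (intro tendsto_intros tendsto_inverse_0_at_top[OF filterlim_norm_at_top])
    then show "((\<lambda>x::complex. 2 * R / norm x) \<longlongrightarrow> 0) at_infinity" by (simp add: divide_inverse)
    have "0 < R" by (simp add: R_def add_nonneg_pos)
    then show "\<forall>\<^sub>F x in at_infinity. norm (ln (norm (x - a)) - ln (norm x)) \<le> 2 * R / norm x"
      unfolding eventually_at_infinity
    proof (intro exI[of _ "2 * R"] allI impI)
      fix x :: complex assume x: "2 * R \<le> norm x"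
      have "norm a < R" by (simp add: R_def)
      from ln_diff_bound[OF this x \<open>0 < R\<close>] show "norm (ln (norm (x - a)) - ln (norm x)) \<le> 2 * R / norm x" by simp
    qed
  qed
  have "((\<lambda>x. - (\<Sum>i<length xs. ln (norm (x - xs ! i)) - ln (norm x))) \<longlongrightarrow> - (\<Sum>i<length xs. 0)) at_infinity"
    by (intro tendsto_intros one)
  then show ?thesis by (simp add: Vnuc_def sum_subtractf)
qed

lemma log_pot_lim_at_infinity:
  assumes G: "G \<in> sets borel" "G \<subseteq> ball 0 R" and R: "0 < R"
  shows "((\<lambda>x. log_pot G x - measure lborel G * ln (norm x)) \<longlongrightarrow> 0) at_infinity"
proof (rule Lim_null_comparison)
  have "((\<lambda>x::complex. measure lborel G * (2 * R * inverse (norm x))) \<longlongrightarrow> measure lborel G * (2 * R * 0)) at_infinity"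
    by (intro tendsto_intros tendsto_inverse_0_at_top[OF filterlim_norm_at_top])
  then show "((\<lambda>x::complex. measure lborel G * (2 * R / norm x)) \<longlongrightarrow> 0) at_infinity" by (simp add: divide_inverse)
  show "\<forall>\<^sub>F x in at_infinity. norm (log_pot G x - measure lborel G * ln (norm x)) \<le> measure lborel G * (2 * R / norm x)"
    unfolding eventually_at_infinity using log_pot_at_infinity[OF G _ R] by (intro exI[of _ "2 * R"]) auto
qed

context
  fixes xs :: "complex list" and \<rho> :: real
  assumes \<rho>: "0 < \<rho>" and \<rho>1: "pi * \<rho>\<^sup>2 < 1"
begin

lemmas tf = \<rho> \<rho>1

lemma tf_obstacle_eq_Vnuc_outside:
  assumes "x \<notin> tf_set xs \<rho>"
  shows "tf_obstacle xs \<rho> x = Vnuc xs x"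
proof (rule tf_obstacle_eq_Vnuc[OF \<rho>])
  fix i assume "i < length xs"
  from balls_subset_tf_set[OF tf this] assms show "\<rho> \<le> norm (x - xs ! i)"
    by (force simp: dist_norm norm_minus_commute)
qed

text \<open>Far out the solution equals \<open>Vnuc\<close>, so the logarithmic growth measures the
  excess of the area of \<open>tf_set\<close> over the nuclear charge. Liouville's theorem then
  yields the mass and the potential in one stroke.\<close>

lemma tf_rem_log: "((\<lambda>x. tf_rem xs \<rho> x - (measure lborel (tf_set xs \<rho>) - real (length xs)) * ln (norm x)) \<longlongrightarrow> 0) at_infinity"
proof -
  have "((\<lambda>x. (Vnuc xs x + real (length xs) * ln (norm x)) + (log_pot (tf_set xs \<rho>) x - measure lborel (tf_set xs \<rho>) * ln (norm x))) \<longlongrightarrow> 0 + 0) at_infinity"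
    by (intro tendsto_add Vnuc_at_infinity log_pot_lim_at_infinity[OF tf_set_measurable[OF tf] tf_set_bounded[OF tf] tf_bound_pos[OF tf]])
  then have lim: "((\<lambda>x. (Vnuc xs x + real (length xs) * ln (norm x)) + (log_pot (tf_set xs \<rho>) x - measure lborel (tf_set xs \<rho>) * ln (norm x))) \<longlongrightarrow> 0) at_infinity" by simp
  show ?thesis
  proof (rule Lim_transform_eventually[OF lim])
    show "\<forall>\<^sub>F x in at_infinity. (Vnuc xs x + real (length xs) * ln (norm x)) + (log_pot (tf_set xs \<rho>) x - measure lborel (tf_set xs \<rho>) * ln (norm x))
       = tf_rem xs \<rho> x - (measure lborel (tf_set xs \<rho>) - real (length xs)) * ln (norm x)"
      unfolding eventually_at_infinity
    proof (intro exI[of _ "tf_bound xs \<rho>"] allI impI)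
      fix x :: complex assume "tf_bound xs \<rho> \<le> norm x"
      then have "x \<notin> tf_set xs \<rho>" using tf_set_bounded[OF tf, of xs] by auto
      then have "tf_sol xs \<rho> x = Vnuc xs x" using tf_sol_outside[OF tf] tf_obstacle_eq_Vnuc_outside by simp
      then show "(Vnuc xs x + real (length xs) * ln (norm x)) + (log_pot (tf_set xs \<rho>) x - measure lborel (tf_set xs \<rho>) * ln (norm x))
       = tf_rem xs \<rho> x - (measure lborel (tf_set xs \<rho>) - real (length xs)) * ln (norm x)"
        by (simp add: tf_rem_def[OF tf] algebra_simps)
    qed
  qed
qed

lemma measure_tf_set: "measure lborel (tf_set xs \<rho>) = real (length xs)"
  using harmonic_log_growth(1)[OF tf_rem_cont[OF tf] tf_rem_harmonic[OF tf] tf_rem_log] by simp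

lemma tf_sol_eq: "tf_sol xs \<rho> x = - log_pot (tf_set xs \<rho>) x"
  using harmonic_log_growth(2)[OF tf_rem_cont[OF tf] tf_rem_harmonic[OF tf] tf_rem_log, of x] by (simp add: tf_rem_def[OF tf])

lemma Phi_outside: "x \<notin> tf_set xs \<rho> \<Longrightarrow> Vnuc xs x + log_pot (tf_set xs \<rho>) x = 0"
  using tf_sol_eq[of x] tf_sol_outside[OF tf, of x xs] tf_obstacle_eq_Vnuc_outside[of x] by simp

lemma Phi_inside: "x \<in> tf_set xs \<rho> \<Longrightarrow> x \<notin> set xs \<Longrightarrow> 0 < Vnuc xs x + log_pot (tf_set xs \<rho>) x"
  using tf_sol_eq[of x] tf_obstacle_le_Vnuc[OF \<rho>, of x xs] by (simp add: tf_set_def[OF tf])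

lemma nuclei_in_tf_set: "set xs \<subseteq> tf_set xs \<rho>"
  using balls_subset_tf_set[OF tf] \<rho> by (force simp: in_set_conv_nth)

section \<open>Components, support and monotonicity of the noncontact set by comparison\<close>

lemma ball_far:
  assumes r: "0 < r" and C: "ball x r \<inter> (\<Union>i<length xs. ball (xs ! i) \<rho>) = {}"
  shows "ball_mean r (tf_obstacle xs \<rho>) x = tf_obstacle xs \<rho> x"
  using C by (intro ball_mean_tf_obstacle_far[OF \<rho> r]) auto

text \<open>A component without a nucleus also misses every smeared disc, since these are connected
  subsets of \<open>tf_set\<close>. The obstacle is then harmonic on it, and raising the solution to
  the obstacle there gives a larger minorant.\<close>

lemma tf_set_component_meets:
  assumes C: "C \<in> components (tf_set xs \<rho>)"
  shows "C \<inter> set xs \<noteq> {}"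
proof
  assume empty: "C \<inter> set xs = {}"
  have Co: "open C" by (rule open_components[OF tf_set_open[OF tf] C])
  have CS: "C \<subseteq> tf_set xs \<rho>" "C \<noteq> {}" using C in_components_subset in_components_nonempty by blast+
  have disj: "C \<inter> ball (xs ! i) \<rho> = {}" if i: "i < length xs" for i
  proof (rule ccontr)
    assume "C \<inter> ball (xs ! i) \<rho> \<noteq> {}"
    then have "ball (xs ! i) \<rho> \<subseteq> C"
      by (intro components_maximal[OF C convex_connected[OF convex_ball] balls_subset_tf_set[OF tf i]])
    then have "xs ! i \<in> C" using \<rho> by (meson centre_in_ball subsetD)
    then show False using empty i by auto
  qed
  define w where "w z = (if z \<in> C then tf_obstacle xs \<rho> z else tf_sol xs \<rho> z)" for z
  have "continuous_on (closure C \<union> - C) w"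
    unfolding w_def
  proof (rule continuous_on_cases)
    show "closed (- C)" using Co by auto
    show "\<forall>z. z \<in> closure C \<and> z \<notin> C \<or> z \<in> - C \<and> z \<in> C \<longrightarrow> tf_obstacle xs \<rho> z = tf_sol xs \<rho> z"
    proof (intro allI impI)
      fix z assume "z \<in> closure C \<and> z \<notin> C \<or> z \<in> - C \<and> z \<in> C"
      then have z: "z \<in> closure C" "z \<notin> C" by auto
      \<comment> \<open>Components are relatively closed, so a boundary point of \<open>C\<close> is
        a contact point and the two branches of \<open>w\<close> agree there.\<close>
      have "z \<notin> tf_set xs \<rho>"
      proof -
        obtain U where U: "closed U" "C = tf_set xs \<rho> \<inter> U"
          using closedin_component[OF C] unfolding closedin_closed by blast
        then have "closure C \<subseteq> U" by (intro closure_minimal) auto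
        then show ?thesis using U z by blast
      qed
      then show "tf_obstacle xs \<rho> z = tf_sol xs \<rho> z" by (simp add: tf_sol_outside[OF tf])
    qed
  qed (auto intro: tf_obstacle_cont[OF \<rho>] tf_sol_cont[OF tf])
  moreover have "closure C \<union> - C = UNIV" using closure_subset by auto
  ultimately have cw: "continuous_on UNIV w" by simp
  have "w \<in> minorants (tf_obstacle xs \<rho>)"
  proof (rule minorants_glue[OF tf_sol_in_minorants[OF tf] cw])
    show "w x \<le> tf_obstacle xs \<rho> x" "tf_sol xs \<rho> x \<le> w x" for x using tf_sol_le[OF tf, of xs x] by (auto simp: w_def)
    fix x and r0 :: real assume wx: "w x \<noteq> tf_sol xs \<rho> x" and r0: "0 < r0"
    then have x: "x \<in> C" by (auto simp: w_def split: if_splits)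
    then obtain r1 where r1: "0 < r1" "ball x r1 \<subseteq> C" using Co open_contains_ball by blast
    define r where "r = min r0 r1 / 2"
    have r: "0 < r" "r < r0" "ball x r \<subseteq> C" using r0 r1 by (auto simp: r_def subset_iff)
    have "ball_mean r w x = ball_mean r (tf_obstacle xs \<rho>) x" by (rule ball_mean_cong) (use r(3) in \<open>auto simp: w_def\<close>)
    also have "\<dots> = tf_obstacle xs \<rho> x" by (rule ball_far[OF r(1)]) (use r(3) disj in blast)
    finally have "w x \<le> ball_mean r w x + pi / 4 * r\<^sup>2" using x by (simp add: w_def)
    then show "\<exists>r. 0 < r \<and> r < r0 \<and> w x \<le> ball_mean r w x + pi / 4 * r\<^sup>2" using r by blast
  qed
  then have le: "w z \<le> tf_sol xs \<rho> z" for z by (rule tf_sol_upper[OF tf])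
  obtain z where z: "z \<in> C" using CS by blast
  then have "tf_obstacle xs \<rho> z \<le> tf_sol xs \<rho> z" using le[of z] by (simp add: w_def)
  moreover have "z \<in> tf_set xs \<rho>" using z CS(1) by blast
  ultimately show False by (simp add: tf_set_def[OF tf])
qed

text \<open>A maximum principle for the gap between obstacle and solution. The obstacle is harmonic
  on \<open>T\<close> and \<open>g\<close> has Laplacian at most \<open>2 * pi\<close>, so replacing
  the solution on \<open>T\<close> by the larger of itself and \<open>tf_obstacle - g\<close> gives
  a minorant; the bound on the boundary makes it continuous.\<close>

lemma region_competitor:
  assumes T: "open T" "T \<inter> (\<Union>i<length xs. ball (xs ! i) \<rho>) = {}"
    and g: "continuous_on UNIV g" "\<And>x. 0 \<le> g x" "\<And>x r. 0 < r \<Longrightarrow> ball_mean r g x \<le> g x + pi / 4 * r\<^sup>2"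
    and bd: "\<And>x. x \<in> closure T \<Longrightarrow> x \<notin> T \<Longrightarrow> tf_obstacle xs \<rho> x - tf_sol xs \<rho> x \<le> g x"
    and x: "x \<in> T"
  shows "tf_obstacle xs \<rho> x - tf_sol xs \<rho> x \<le> g x"
proof -
  define w where "w z = (if z \<in> T then max (tf_sol xs \<rho> z) (tf_obstacle xs \<rho> z - g z) else tf_sol xs \<rho> z)" for z
  have "continuous_on (closure T \<union> - T) w"
    unfolding w_def
  proof (rule continuous_on_cases)
    show "closed (- T)" using T(1) by auto
    show "continuous_on (closure T) (\<lambda>z. max (tf_sol xs \<rho> z) (tf_obstacle xs \<rho> z - g z))"
      by (intro continuous_intros tf_sol_cont[OF tf] tf_obstacle_cont[OF \<rho>] continuous_on_subset[OF g(1)]) auto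
    show "continuous_on (- T) (tf_sol xs \<rho>)" by (rule tf_sol_cont[OF tf])
    show "\<forall>z. z \<in> closure T \<and> z \<notin> T \<or> z \<in> - T \<and> z \<in> T \<longrightarrow> max (tf_sol xs \<rho> z) (tf_obstacle xs \<rho> z - g z) = tf_sol xs \<rho> z"
    proof (intro allI impI)
      fix z assume "z \<in> closure T \<and> z \<notin> T \<or> z \<in> - T \<and> z \<in> T"
      then have "tf_obstacle xs \<rho> z - tf_sol xs \<rho> z \<le> g z" using bd by blast
      then show "max (tf_sol xs \<rho> z) (tf_obstacle xs \<rho> z - g z) = tf_sol xs \<rho> z" by simp
    qed
  qed auto
  moreover have "closure T \<union> - T = UNIV" using closure_subset by auto
  ultimately have cw: "continuous_on UNIV w" by simp
  have "w \<in> minorants (tf_obstacle xs \<rho>)"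
  proof (rule minorants_glue[OF tf_sol_in_minorants[OF tf] cw])
    show "w x \<le> tf_obstacle xs \<rho> x" for x using tf_sol_le[OF tf, of xs x] g(2)[of x] by (auto simp: w_def)
    show "tf_sol xs \<rho> x \<le> w x" for x by (auto simp: w_def)
    fix x and r0 :: real assume wx: "w x \<noteq> tf_sol xs \<rho> x" and r0: "0 < r0"
    then have x: "x \<in> T" "w x = tf_obstacle xs \<rho> x - g x" by (auto simp: w_def max_def split: if_splits)
    then obtain r1 where r1: "0 < r1" "ball x r1 \<subseteq> T" using T(1) open_contains_ball by blast
    define r where "r = min r0 r1 / 2"
    have r: "0 < r" "r < r0" "ball x r \<subseteq> T" using r0 r1 by (auto simp: r_def subset_iff)
    have "tf_obstacle xs \<rho> x = ball_mean r (tf_obstacle xs \<rho>) x" by (rule ball_far[OF r(1), symmetric]) (use r(3) T(2) in blast)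
    then have "w x \<le> ball_mean r (tf_obstacle xs \<rho>) x - ball_mean r g x + pi / 4 * r\<^sup>2" using x(2) g(3)[OF r(1), of x] by simp
    also have "ball_mean r (tf_obstacle xs \<rho>) x - ball_mean r g x = ball_mean r (\<lambda>z. tf_obstacle xs \<rho> z - g z) x"
      by (intro ball_mean_diff[symmetric] mean_integrable_cont tf_obstacle_cont[OF \<rho>] g)
    also have "\<dots> \<le> ball_mean r w x"
      by (intro ball_mean_mono mean_integrable_cont cw continuous_intros tf_obstacle_cont[OF \<rho>] g) (use r(3) in \<open>auto simp: w_def\<close>)
    finally have "w x \<le> ball_mean r w x + pi / 4 * r\<^sup>2" by simp
    then show "\<exists>r. 0 < r \<and> r < r0 \<and> w x \<le> ball_mean r w x + pi / 4 * r\<^sup>2" using r by blast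
  qed
  then have "w x \<le> tf_sol xs \<rho> x" by (rule tf_sol_upper[OF tf])
  then show ?thesis using x by (simp add: w_def)
qed

text \<open>Comparison with the constant \<open>pi * M\<close> bounds the gap outside the disc. For
  a point at distance at least \<open>sqrt M\<close> from the disc, comparison with
  \<open>pi\<close> times the squared distance to the half plane beyond it, started on the tangent
  line where the barrier equals \<open>pi * M\<close>, makes the gap vanish.\<close>

lemma tf_set_in_disc:
  assumes R: "\<And>i. i < length xs \<Longrightarrow> norm (xs ! i) + \<rho> \<le> R" "0 < R" and M: "0 \<le> M"
    and bd: "\<And>x. norm x = R \<Longrightarrow> tf_obstacle xs \<rho> x - tf_sol xs \<rho> x \<le> pi * M"
  shows "tf_set xs \<rho> \<subseteq> ball 0 (R + sqrt M)"
proof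
  fix x assume x: "x \<in> tf_set xs \<rho>"
  have far: "False" if "R \<le> norm y" "y \<in> ball (xs ! i) \<rho>" "i < length xs" for y i
  proof -
    have "norm y \<le> norm (y - xs ! i) + norm (xs ! i)" using norm_triangle_sub[of y "xs ! i"] by simp
    then show False using that R(1)[OF that(3)] by (simp add: dist_norm norm_minus_commute)
  qed
  have M1: "tf_obstacle xs \<rho> y - tf_sol xs \<rho> y \<le> pi * M" if y: "R \<le> norm y" for y
  proof (cases "norm y = R")
    case False
    define T where "T = {z::complex. R < norm z}"
    have "open T" unfolding T_def by (intro open_Collect_less continuous_intros)
    moreover have "T \<inter> (\<Union>i<length xs. ball (xs ! i) \<rho>) = {}"
      using far[OF less_imp_le] unfolding T_def by blast
    moreover have "closure T \<subseteq> {z. R \<le> norm z}"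
      unfolding T_def by (intro closure_minimal closed_Collect_le continuous_intros) auto
    note T = this \<open>open T\<close> \<open>T \<inter> (\<Union>i<length xs. ball (xs ! i) \<rho>) = {}\<close>
    show ?thesis
    proof (rule region_competitor[OF T(2,3)])
      show "continuous_on UNIV (\<lambda>_. pi * M)" by (rule continuous_on_const)
      show "0 \<le> pi * M" using M by simp
      show "ball_mean r (\<lambda>_. pi * M) z \<le> pi * M + pi / 4 * r\<^sup>2" if "0 < r" for z r by (simp add: ball_mean_const[OF that])
      show "y \<in> T" using y False by (simp add: T_def)
      fix z assume "z \<in> closure T" "z \<notin> T"
      then have "norm z = R" using T(1) by (auto simp: T_def)
      then show "tf_obstacle xs \<rho> z - tf_sol xs \<rho> z \<le> pi * M" by (rule bd)
    qed
  qed (rule bd)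
  show "x \<in> ball 0 (R + sqrt M)"
  proof (rule ccontr)
    assume "x \<notin> ball 0 (R + sqrt M)"
    then have nx: "R + sqrt M \<le> norm x" by simp
    then have nx0: "0 < norm x" using R(2) real_sqrt_ge_zero[OF M] by linarith
    \<comment> \<open>Multiplication by \<open>e\<close> rotates \<open>x\<close> onto the positive
      real axis, so that \<open>T\<close> is the half plane cut off by the tangent of the disc
      facing \<open>x\<close>.\<close>
    define e where "e = cnj x / of_real (norm x)"
    have e: "norm e = 1" using nx0 by (simp add: e_def norm_divide)
    have ex: "Re (e * x) = norm x"
    proof -
      have "e * x = of_real ((norm x)\<^sup>2) / of_real (norm x)"
        unfolding e_def complex_norm_square by (simp add: mult.commute)
      also have "\<dots> = of_real (norm x)" using nx0 by (simp add: power2_eq_square)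
      finally show ?thesis by simp
    qed
    have le: "Re (e * y) \<le> norm y" for y using complex_Re_le_cmod[of "e * y"] e by (simp add: norm_mult)
    define g where "g y = pi * (max 0 (R + sqrt M - Re (e * y)))\<^sup>2" for y
    have cg: "continuous_on UNIV g" unfolding g_def by (intro continuous_intros)
    define T where "T = {z. R < Re (e * z)}"
    have "tf_obstacle xs \<rho> x - tf_sol xs \<rho> x \<le> g x" if xT: "x \<in> T"
    proof (rule region_competitor[of T])
      show "open T" unfolding T_def by (intro open_Collect_less continuous_intros)
      show "T \<inter> (\<Union>i<length xs. ball (xs ! i) \<rho>) = {}"
        using far[OF order_trans[OF less_imp_le le]] unfolding T_def by blast
      show "continuous_on UNIV g" by (rule cg)
      show "0 \<le> g y" for y by (simp add: g_def)
      show "ball_mean r g y \<le> g y + pi / 4 * r\<^sup>2" if "0 < r" for r y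
      proof -
        have "ball_mean r g y = pi * ball_mean r (\<lambda>z. (max 0 (R + sqrt M - Re (e * z)))\<^sup>2) y" unfolding g_def by (rule ball_mean_cmult)
        also have "\<dots> \<le> pi * ((max 0 (R + sqrt M - Re (e * y)))\<^sup>2 + r\<^sup>2 / 4)"
          by (intro mult_left_mono ball_mean_halfplane_sq_le that e) auto
        finally show ?thesis by (simp add: g_def algebra_simps)
      qed
      show "x \<in> T" by (rule xT)
      fix y assume y: "y \<in> closure T" "y \<notin> T"
      have "closure T \<subseteq> {z. R \<le> Re (e * z)}"
        unfolding T_def by (intro closure_minimal closed_Collect_le continuous_intros) auto
      then have ye: "Re (e * y) = R" using y by (auto simp: T_def)
      then have "g y = pi * M" using M by (simp add: g_def)
      then show "tf_obstacle xs \<rho> y - tf_sol xs \<rho> y \<le> g y" using M1[of y] le[of y] ye by simp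
    qed
    moreover have "g x = 0" using nx ex by (simp add: g_def)
    \<comment> \<open>When \<open>M = 0\<close>, the point may lie on the tangent itself and so
      outside \<open>T\<close>; there the constant bound is already 0.\<close>
    moreover have "x \<in> T \<or> M = 0 \<and> norm x = R" using nx ex M 
    proof (cases "M = 0")
      case False
      then have "0 < sqrt M" using M by simp
      then have "R < Re (e * x)" using nx unfolding ex by linarith
      then show ?thesis by (simp only: T_def mem_Collect_eq simp_thms)
    qed (use nx ex in \<open>auto simp: T_def\<close>)
    ultimately have "tf_obstacle xs \<rho> x - tf_sol xs \<rho> x \<le> 0" using M1[of x] by auto
    then show False using x by (simp add: tf_set_def[OF tf])
  qed
qed

end

text \<open>Adding back the subharmonic term \<open>ln_mean\<close> of the removed nucleus turns the
  solution for \<open>xs\<close> into a minorant for the shorter list. Hence the gap between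
  obstacle and solution can only shrink when a nucleus is removed.\<close>

lemma tf_set_butlast:
  assumes tf: "0 < \<rho>" "pi * \<rho>\<^sup>2 < 1" and xs: "xs \<noteq> []"
  shows "tf_set (butlast xs) \<rho> \<subseteq> tf_set xs \<rho>"
proof -
  define ys a where "ys = butlast xs" and "a = last xs"
  have xs': "xs = ys @ [a]" using xs by (simp add: ys_def a_def)
  have pe: "tf_obstacle xs \<rho> x = tf_obstacle ys \<rho> x - ln_mean \<rho> (x - a)" for x
    by (simp add: tf_obstacle_def xs' nth_append)
  have c: "continuous_on UNIV (\<lambda>x. tf_sol xs \<rho> x + ln_mean \<rho> (x - a))"
    by (intro continuous_intros tf_sol_cont[OF tf] ln_mean_translate_cont[OF tf(1)])
  have "(\<lambda>x. tf_sol xs \<rho> x + ln_mean \<rho> (x - a)) \<in> minorants (tf_obstacle ys \<rho>)"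
    unfolding minorants_def
  proof (intro CollectI conjI allI impI c)
    show "tf_sol xs \<rho> x + ln_mean \<rho> (x - a) \<le> tf_obstacle ys \<rho> x" for x using tf_sol_le[OF tf, of xs x] pe[of x] by simp
    fix x and r :: real assume r: "0 < r"
    have "ball_mean r (\<lambda>x. tf_sol xs \<rho> x + ln_mean \<rho> (x - a)) x = ball_mean r (tf_sol xs \<rho>) x + ball_mean r (ln_mean \<rho>) (x - a)"
      by (subst ball_mean_add) (auto intro!: mean_integrable_cont tf_sol_cont[OF tf] ln_mean_translate_cont[OF tf(1)] simp: ball_mean_ln_mean_translate)
    then show "tf_sol xs \<rho> x + ln_mean \<rho> (x - a) \<le> ball_mean r (\<lambda>x. tf_sol xs \<rho> x + ln_mean \<rho> (x - a)) x + pi / 4 * r\<^sup>2"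
      using tf_sol_submean[OF tf r, of xs x] ln_mean_ball_mean(1)[OF tf(1) r, of "x - a"] by simp
  qed
  then have "tf_sol xs \<rho> x + ln_mean \<rho> (x - a) \<le> tf_sol ys \<rho> x" for x by (rule tf_sol_upper[OF tf])
  note le = this
  show ?thesis
  proof
    fix x assume "x \<in> tf_set (butlast xs) \<rho>"
    then have "tf_sol ys \<rho> x < tf_obstacle ys \<rho> x" by (simp add: tf_set_def[OF tf] ys_def)
    then show "x \<in> tf_set xs \<rho>" using le[of x] pe[of x] by (simp add: tf_set_def[OF tf])
  qed
qed

section \<open>Positive definiteness of the logarithmic energy\<close>

text \<open>Used with \<open>b = (norm (x - y))\<^sup>2\<close>. The term \<open>exp (- t)\<close>
  compensates the singularity of \<open>1 / t\<close> at 0; not depending on \<open>x\<close> and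
  \<open>y\<close>, it drops out for densities of total integral zero.\<close>

definition frullani_kernel :: "real \<Rightarrow> real \<Rightarrow> real" where
  "frullani_kernel b t = (exp (- (b * t)) - exp (- t)) / t"

lemma nn_integral_exp_tail:
  assumes "0 < u"
  shows "(\<integral>\<^sup>+t. ennreal (exp (- (u * t))) * indicator {0..} t \<partial>lborel) = ennreal (1 / u)"
proof -
  have "((\<lambda>t. exp (- (u * t))) \<longlongrightarrow> 0) at_top"
    by (intro filterlim_compose[OF exp_at_bot] filterlim_compose[OF filterlim_uminus_at_bot_at_top]
        filterlim_tendsto_pos_mult_at_top[OF tendsto_const assms] filterlim_ident)
  then have lim: "((\<lambda>t. - exp (- (u * t)) / u) \<longlongrightarrow> - 0 / u) at_top"
    by (intro tendsto_intros) (use assms in auto)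
  have "(\<integral>\<^sup>+t. ennreal (exp (- (u * t))) * indicator {0..} t \<partial>lborel) = ennreal (- 0 / u - (- exp (- (u * 0)) / u))"
    by (rule nn_integral_FTC_atLeast[where F="\<lambda>t. - exp (- (u * t)) / u"])
      (use lim assms in \<open>auto intro!: derivative_eq_intros\<close>)
  then show ?thesis by simp
qed

text \<open>Frullani's integral, by writing the integrand as an integral over the exponent.\<close>
lemma nn_frullani:
  assumes "0 < b" "b \<le> c"
  shows "(\<integral>\<^sup>+t. ennreal ((exp (- (b * t)) - exp (- (c * t))) / t) * indicator {0..} t \<partial>lborel) = ennreal (ln c - ln b)"
proof -
  have inner: "(\<integral>\<^sup>+u. ennreal (exp (- (u * t))) * indicator {b..c} u \<partial>lborel) = ennreal ((exp (- (b * t)) - exp (- (c * t))) / t)"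
    if t: "0 < t" for t
  proof -
    have "(\<integral>\<^sup>+u. ennreal (exp (- (u * t))) * indicator {b..c} u \<partial>lborel) = ennreal (- exp (- (c * t)) / t - (- exp (- (b * t)) / t))"
      by (rule nn_integral_FTC_Icc[where F="\<lambda>u. - exp (- (u * t)) / t"])
        (use t assms in \<open>auto intro!: derivative_eq_intros\<close>)
    then show ?thesis by (simp add: diff_divide_distrib)
  qed
  have "AE t in lborel. t \<noteq> (0::real)" by (rule AE_lborel_singleton)
  then have ae: "AE t in lborel. ennreal ((exp (- (b * t)) - exp (- (c * t))) / t) * indicator {0..} t
      = (\<integral>\<^sup>+u. ennreal (exp (- (u * t))) * indicator {b..c} u * indicator {0..} t \<partial>lborel)"
  proof eventually_elim
    case (elim t)
    then show ?case by (cases "0 < t") (simp_all add: inner)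
  qed
  have "(\<integral>\<^sup>+t. ennreal ((exp (- (b * t)) - exp (- (c * t))) / t) * indicator {0..} t \<partial>lborel)
      = (\<integral>\<^sup>+t. \<integral>\<^sup>+u. ennreal (exp (- (u * t))) * indicator {b..c} u * indicator {0..} t \<partial>lborel \<partial>lborel)"
    by (rule nn_integral_cong_AE[OF ae])
  also have "\<dots> = (\<integral>\<^sup>+u. \<integral>\<^sup>+t. ennreal (exp (- (u * t))) * indicator {b..c} u * indicator {0..} t \<partial>lborel \<partial>lborel)"
    by (rule lborel_pair.Fubini') measurable
  also have "\<dots> = (\<integral>\<^sup>+u. ennreal (1 / u) * indicator {b..c} u \<partial>lborel)"
  proof (rule nn_integral_cong)
    fix u :: real
    show "(\<integral>\<^sup>+t. ennreal (exp (- (u * t))) * indicator {b..c} u * indicator {0..} t \<partial>lborel) = ennreal (1 / u) * indicator {b..c} u"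
      using nn_integral_exp_tail[of u] assms by (auto split: split_indicator)
  qed
  also have "\<dots> = ennreal (ln c - ln b)"
    by (rule nn_integral_FTC_Icc) (use assms in \<open>auto intro!: derivative_eq_intros\<close>)
  finally show ?thesis .
qed

lemma frullani_kernel_measurable [measurable]: "(\<lambda>x. frullani_kernel (f x) (g x)) \<in> borel_measurable M"
  if [measurable]: "f \<in> borel_measurable M" "g \<in> borel_measurable M"
  unfolding frullani_kernel_def by measurable

text \<open>The kernel has a constant sign for each \<open>b\<close>, opposite cases being
  \<open>b \<le> 1\<close> and \<open>b > 1\<close>. Therefore its absolute integral is again a
  logarithm, which is what justifies the exchange of integrals in the energy.\<close>

lemma frullani:
  assumes b: "0 < b"
  shows "integrable lborel (\<lambda>t. indicator {0..} t * frullani_kernel b t)"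
    and "(LINT t|lborel. indicator {0..} t * frullani_kernel b t) = - ln b"
    and "(LINT t|lborel. \<bar>indicator {0..} t * frullani_kernel b t\<bar>) = \<bar>ln b\<bar>"
proof -
  have main: "has_bochner_integral lborel (\<lambda>t. indicator {0..} t * ((exp (- (p * t)) - exp (- (q * t))) / t)) (ln q - ln p)
      \<and> (\<forall>t. 0 \<le> indicator {0..} t * ((exp (- (p * t)) - exp (- (q * t))) / t))" if pq: "0 < p" "p \<le> q" for p q :: real
  proof -
    have nn: "0 \<le> indicator {0..} t * ((exp (- (p * t)) - exp (- (q * t))) / t)" for t :: real
      using pq by (auto split: split_indicator intro!: divide_nonneg_nonneg mult_right_mono)
    have "(\<integral>\<^sup>+t. ennreal (indicator {0..} t * ((exp (- (p * t)) - exp (- (q * t))) / t)) \<partial>lborel)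
        = (\<integral>\<^sup>+t. ennreal ((exp (- (p * t)) - exp (- (q * t))) / t) * indicator {0..} t \<partial>lborel)"
      by (intro nn_integral_cong) (auto split: split_indicator)
    also have "\<dots> = ennreal (ln q - ln p)" by (rule nn_frullani[OF pq])
    finally have "has_bochner_integral lborel (\<lambda>t. indicator {0..} t * ((exp (- (p * t)) - exp (- (q * t))) / t)) (ln q - ln p)"
      using nn pq by (intro has_bochner_integral_nn_integral) auto
    then show ?thesis using nn by blast
  qed
  have "has_bochner_integral lborel (\<lambda>t. indicator {0..} t * frullani_kernel b t) (- ln b)
      \<and> (LINT t|lborel. \<bar>indicator {0..} t * frullani_kernel b t\<bar>) = \<bar>ln b\<bar>"
  proof (cases "b \<le> 1")
    case True
    note m = main[OF b True]
    have h: "has_bochner_integral lborel (\<lambda>t. indicator {0..} t * frullani_kernel b t) (- ln b)" using m by (simp add: frullani_kernel_def)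
    have "0 \<le> indicator {0..} t * frullani_kernel b t" for t using m by (simp add: frullani_kernel_def)
    then have "\<bar>indicator {0..} t * frullani_kernel b t\<bar> = indicator {0..} t * frullani_kernel b t" for t by (rule abs_of_nonneg)
    then show ?thesis using h has_bochner_integral_integral_eq[OF h] True b by simp
  next
    case False
    then have "0 < (1::real)" "1 \<le> b" by auto
    note m = main[OF this]
    have e: "indicator {0..} t * ((exp (- (1 * t)) - exp (- (b * t))) / t) = - (indicator {0..} t * frullani_kernel b t)" for t
      by (simp add: frullani_kernel_def diff_divide_distrib algebra_simps)
    have h: "has_bochner_integral lborel (\<lambda>t. - (indicator {0..} t * frullani_kernel b t)) (ln b)" using m unfolding e by simp
    have h': "has_bochner_integral lborel (\<lambda>t. indicator {0..} t * frullani_kernel b t) (- ln b)"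
      using has_bochner_integral_minus[OF h] by simp
    have "0 \<le> - (indicator {0..} t * frullani_kernel b t)" for t using m unfolding e by blast
    then have "\<bar>indicator {0..} t * frullani_kernel b t\<bar> = - (indicator {0..} t * frullani_kernel b t)" for t by (metis abs_of_nonneg abs_minus_cancel)
    then show ?thesis using h' has_bochner_integral_integral_eq[OF h] False by (simp only:) auto
  qed
  then show "integrable lborel (\<lambda>t. indicator {0..} t * frullani_kernel b t)" "(LINT t|lborel. indicator {0..} t * frullani_kernel b t) = - ln b"
    "(LINT t|lborel. \<bar>indicator {0..} t * frullani_kernel b t\<bar>) = \<bar>ln b\<bar>"
    by (auto simp: has_bochner_integral_iff)
qed

lemma integral_gauss:
  assumes s: "0 < s"
  shows "integrable lborel (\<lambda>z::complex. exp (- (s * (norm z)\<^sup>2)))" "(LINT z|lborel. exp (- (s * (norm (z::complex))\<^sup>2))) = pi / s"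
proof -
  have "((\<lambda>t. exp (- (s * t\<^sup>2))) \<longlongrightarrow> (0::real)) at_top"
    by (intro filterlim_compose[OF exp_at_bot] filterlim_compose[OF filterlim_uminus_at_bot_at_top]
        filterlim_tendsto_pos_mult_at_top[OF tendsto_const s] filterlim_pow_at_top filterlim_ident) auto
  then have lim: "((\<lambda>t. - pi / s * exp (- (s * t\<^sup>2))) \<longlongrightarrow> - pi / s * 0) at_top" by (intro tendsto_intros)
  have d: "((\<lambda>t. - pi / s * exp (- (s * t\<^sup>2))) has_real_derivative 2 * pi * t * exp (- (s * t\<^sup>2))) (at t)" for t
    using s by (auto intro!: derivative_eq_intros)
  have "(\<integral>\<^sup>+t. ennreal (2 * pi * t * exp (- (s * t\<^sup>2))) * indicator {0..} t \<partial>lborel) = ennreal (- pi / s * 0 - (- pi / s * exp (- (s * 0\<^sup>2))))"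
    by (rule nn_integral_FTC_atLeast[OF _ d _ lim]) (auto intro!: mult_nonneg_nonneg)
  moreover have "(\<integral>\<^sup>+t. ennreal (indicator {0..} t * (2 * pi * t) * exp (- (s * t\<^sup>2))) \<partial>lborel) = (\<integral>\<^sup>+t. ennreal (2 * pi * t * exp (- (s * t\<^sup>2))) * indicator {0..} t \<partial>lborel)"
    by (intro nn_integral_cong) (auto split: split_indicator)
  ultimately have "has_bochner_integral lborel (\<lambda>t. indicator {0..} t * (2 * pi * t) * exp (- (s * t\<^sup>2))) (pi / s)"
    using s by (intro has_bochner_integral_nn_integral) (auto split: split_indicator)
  then show "integrable lborel (\<lambda>z::complex. exp (- (s * (norm z)\<^sup>2)))" "(LINT z|lborel. exp (- (s * (norm (z::complex))\<^sup>2))) = pi / s"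
    using integral_radial[of "\<lambda>t. exp (- (s * t\<^sup>2))"] by (auto simp: has_bochner_integral_iff)
qed

text \<open>Contains both the elements of \<open>M_TF\<close> and their differences, so the energy
  may be expanded around a density within a single class.\<close>

definition log_class :: "(complex \<Rightarrow> real) \<Rightarrow> bool" where
  "log_class f \<longleftrightarrow> f \<in> borel_measurable borel \<and> (\<forall>x. \<bar>f x\<bar> \<le> 1) \<and> integrable lborel (\<lambda>x. f x * ln (2 + norm x))"

lemma log_class_measurable: "log_class f \<Longrightarrow> f \<in> borel_measurable borel" by (simp add: log_class_def)

lemma log_class_integrable:
  assumes "log_class f"
  shows "integrable lborel f"
proof (rule Bochner_Integration.integrable_bound)
  show "integrable lborel (\<lambda>x. 1 / ln 2 * (f x * ln (2 + norm x)))" using assms by (simp add: log_class_def)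
  show "AE x in lborel. norm (f x) \<le> norm (1 / ln 2 * (f x * ln (2 + norm x)))"
  proof (rule AE_I2)
    fix x :: complex
    have "ln 2 \<le> ln (2 + norm x)" by (intro ln_mono) auto
    then have "1 \<le> ln (2 + norm x) / ln 2" by (simp add: le_divide_eq)
    then have "\<bar>f x\<bar> * 1 \<le> \<bar>f x\<bar> * (ln (2 + norm x) / ln 2)" by (intro mult_left_mono) auto
    moreover have "0 \<le> ln (2 + norm x)" by (intro ln_ge_zero) auto
    ultimately show "norm (f x) \<le> norm (1 / ln 2 * (f x * ln (2 + norm x)))" by (simp add: abs_mult)
  qed
qed (use assms in \<open>auto simp: log_class_def\<close>)

definition unit_kernel :: "complex \<Rightarrow> real" where "unit_kernel z = indicator (ball 0 1) z * (1 / norm z)"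

lemma unit_kernel: "integrable lborel unit_kernel" "integral\<^sup>L lborel unit_kernel = 2 * pi" "0 \<le> unit_kernel z" "unit_kernel \<in> borel_measurable borel"
  using integrable_inverse_norm_ball[of 1] unfolding unit_kernel_def[abs_def] by auto

text \<open>Near the diagonal the logarithm is below \<open>1 / norm (x - y)\<close>; far from it,
  \<open>norm (x - y) \<le> (2 + norm x) * (2 + norm y)\<close>. This is how the weight
  \<open>ln (2 + norm x)\<close> of \<open>M_TF\<close> makes the energy finite.\<close>

lemma abs_ln_norm_diff_le: "\<bar>ln (norm (x - y))\<bar> \<le> ln (2 + norm x) + ln (2 + norm y) + unit_kernel (x - y)" for x y :: complex
proof -
  have l: "0 \<le> ln (2 + norm x)" "0 \<le> ln (2 + norm y)" by (auto intro!: ln_ge_zero)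
  consider "x = y" | "x \<noteq> y" "norm (x - y) < 1" | "1 \<le> norm (x - y)" by fastforce
  then show ?thesis
  proof cases
    case 1 then show ?thesis using l unit_kernel(3)[of 0] by simp
  next
    case 2
    have "ln (1 / norm (x - y)) \<le> 1 / norm (x - y) - 1" using 2 by (intro ln_le_minus_one) auto
    moreover have "ln (norm (x - y)) \<le> 0" using 2 by simp
    ultimately have "\<bar>ln (norm (x - y))\<bar> \<le> 1 / norm (x - y)" using 2 by (simp add: ln_div)
    moreover have "unit_kernel (x - y) = 1 / norm (x - y)" using 2 by (simp add: unit_kernel_def)
    ultimately show ?thesis using l by linarith
  next
    case 3
    have "norm (x - y) \<le> norm x + norm y" by (rule norm_triangle_ineq4)
    also have "\<dots> \<le> (2 + norm x) * (2 + norm y)" by (simp add: algebra_simps)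
    finally have "ln (norm (x - y)) \<le> ln ((2 + norm x) * (2 + norm y))" using 3 by (intro ln_mono) auto
    also have "\<dots> = ln (2 + norm x) + ln (2 + norm y)" 
    proof -
      have "0 < 2 + norm x" "0 < 2 + norm y" by (auto intro: add_pos_nonneg)
      then show ?thesis by (simp add: ln_mult)
    qed
    finally show ?thesis using 3 unit_kernel(3)[of "x - y"] by simp
  qed
qed

lemma integrable_product:
  fixes f g :: "complex \<Rightarrow> real"
  assumes f: "integrable lborel f" and g: "integrable lborel g"
  shows "integrable (lborel \<Otimes>\<^sub>M lborel) (\<lambda>(x, y). f x * g y)"
    and "integral\<^sup>L (lborel \<Otimes>\<^sub>M lborel) (\<lambda>(x, y). f x * g y) = integral\<^sup>L lborel f * integral\<^sup>L lborel g"
proof -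
  have [measurable]: "f \<in> borel_measurable borel" "g \<in> borel_measurable borel" using f g by auto
  show i: "integrable (lborel \<Otimes>\<^sub>M lborel) (\<lambda>(x, y). f x * g y)"
  proof (rule lborel_pair.Fubini_integrable)
    show "integrable lborel (\<lambda>x. LINT y|lborel. norm (case (x, y) of (x, y) \<Rightarrow> f x * g y))"
      using f by (simp add: abs_mult)
    show "AE x in lborel. integrable lborel (\<lambda>y. case (x, y) of (x, y) \<Rightarrow> f x * g y)" using g by simp
  qed measurable
  show "integral\<^sup>L (lborel \<Otimes>\<^sub>M lborel) (\<lambda>(x, y). f x * g y) = integral\<^sup>L lborel f * integral\<^sup>L lborel g"
    using lborel_pair.integral_fst[OF i] by simp
qed

text \<open>Each logarithmic weight goes with the density in its own variable; in the local singular
  term \<open>g\<close> is bounded by 1 and the kernel is integrated over \<open>y\<close>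
  alone.\<close>

lemma log_integrable:
  assumes f: "log_class f" and g: "log_class g"
  shows "integrable (lborel \<Otimes>\<^sub>M lborel) (\<lambda>(x, y). f x * ln (norm (x - y)) * g y)"
proof -
  note [measurable] = log_class_measurable[OF f] log_class_measurable[OF g] unit_kernel(4)
  have fl: "integrable lborel (\<lambda>x. \<bar>f x * ln (2 + norm x)\<bar>)" "integrable lborel (\<lambda>x. \<bar>g x * ln (2 + norm x)\<bar>)"
    using f g by (auto simp: log_class_def)
  have fa: "integrable lborel (\<lambda>x. \<bar>f x\<bar>)" "integrable lborel (\<lambda>x. \<bar>g x\<bar>)"
    using log_class_integrable[OF f] log_class_integrable[OF g] by auto
  have k: "integrable (lborel \<Otimes>\<^sub>M lborel) (\<lambda>(x, y). \<bar>f x\<bar> * unit_kernel (x - y))"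
  proof (rule lborel_pair.Fubini_integrable)
    have kr: "(LINT y|lborel. unit_kernel (x - y)) = 2 * pi" for x unfolding unit_kernel(2)[symmetric] by (rule integral_lborel_reflect) (rule unit_kernel(4))
    show "integrable lborel (\<lambda>x. LINT y|lborel. norm (case (x, y) of (x, y) \<Rightarrow> \<bar>f x\<bar> * unit_kernel (x - y)))"
      using fa(1) by (simp add: abs_mult unit_kernel(3) kr)
    show "AE x in lborel. integrable lborel (\<lambda>y. case (x, y) of (x, y) \<Rightarrow> \<bar>f x\<bar> * unit_kernel (x - y))"
      using integrable_lborel_reflect[OF unit_kernel(1)] by simp
  qed measurable
  have "integrable (lborel \<Otimes>\<^sub>M lborel) (\<lambda>p. (case p of (x, y) \<Rightarrow> \<bar>f x * ln (2 + norm x)\<bar> * \<bar>g y\<bar>)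
      + (case p of (x, y) \<Rightarrow> \<bar>f x\<bar> * \<bar>g y * ln (2 + norm y)\<bar>) + (case p of (x, y) \<Rightarrow> \<bar>f x\<bar> * unit_kernel (x - y)))"
    by (intro Bochner_Integration.integrable_add integrable_product(1) fl fa k)
  then show ?thesis
  proof (rule Bochner_Integration.integrable_bound)
    show "AE p in lborel \<Otimes>\<^sub>M lborel. norm (case p of (x, y) \<Rightarrow> f x * ln (norm (x - y)) * g y) \<le>
      norm ((case p of (x, y) \<Rightarrow> \<bar>f x * ln (2 + norm x)\<bar> * \<bar>g y\<bar>)
      + (case p of (x, y) \<Rightarrow> \<bar>f x\<bar> * \<bar>g y * ln (2 + norm y)\<bar>) + (case p of (x, y) \<Rightarrow> \<bar>f x\<bar> * unit_kernel (x - y)))"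
    proof (rule AE_I2, clarify)
      fix x y :: complex
      have l: "0 \<le> ln (2 + norm x)" "0 \<le> ln (2 + norm y)" by (auto intro!: ln_ge_zero)
      have g1: "\<bar>g y\<bar> \<le> 1" using g by (simp add: log_class_def)
      have "\<bar>f x\<bar> * \<bar>ln (norm (x - y))\<bar> * \<bar>g y\<bar> \<le> \<bar>f x\<bar> * (ln (2 + norm x) + ln (2 + norm y) + unit_kernel (x - y)) * \<bar>g y\<bar>"
        by (intro mult_right_mono mult_left_mono abs_ln_norm_diff_le) auto
      also have "\<dots> = \<bar>f x\<bar> * ln (2 + norm x) * \<bar>g y\<bar> + \<bar>f x\<bar> * (\<bar>g y\<bar> * ln (2 + norm y)) + \<bar>f x\<bar> * unit_kernel (x - y) * \<bar>g y\<bar>"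
        by (simp add: algebra_simps)
      also have "\<bar>f x\<bar> * unit_kernel (x - y) * \<bar>g y\<bar> \<le> \<bar>f x\<bar> * unit_kernel (x - y) * 1"
        using g1 unit_kernel(3) by (intro mult_left_mono) auto
      finally have "\<bar>f x\<bar> * \<bar>ln (norm (x - y))\<bar> * \<bar>g y\<bar> \<le> \<bar>f x\<bar> * ln (2 + norm x) * \<bar>g y\<bar> + \<bar>f x\<bar> * (\<bar>g y\<bar> * ln (2 + norm y)) + \<bar>f x\<bar> * unit_kernel (x - y)"
        by simp
      moreover have "0 \<le> \<bar>f x\<bar> * ln (2 + norm x) * \<bar>g y\<bar> + \<bar>f x\<bar> * (\<bar>g y\<bar> * ln (2 + norm y)) + \<bar>f x\<bar> * unit_kernel (x - y)"
        using l unit_kernel(3) by (intro add_nonneg_nonneg mult_nonneg_nonneg) auto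
      ultimately show "norm (f x * ln (norm (x - y)) * g y) \<le> norm (\<bar>f x * ln (2 + norm x)\<bar> * \<bar>g y\<bar>
      + \<bar>f x\<bar> * \<bar>g y * ln (2 + norm y)\<bar> + \<bar>f x\<bar> * unit_kernel (x - y))"
        using l by (simp add: abs_mult)
    qed
  qed measurable
qed

text \<open>The Gaussian kernel is the convolution square of a narrower Gaussian, by the parallelogram law.\<close>
lemma gauss_positive:
  assumes f: "integrable lborel f" and t: "0 < t"
  shows "0 \<le> integral\<^sup>L (lborel \<Otimes>\<^sub>M lborel) (\<lambda>(x, y). f x * f y * exp (- (t * (norm (x - y :: complex))\<^sup>2)))"
proof -
  have [measurable]: "f \<in> borel_measurable borel" using f by auto
  define G where "G z = exp (- (2 * t * (norm z)\<^sup>2))" for z :: complex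
  have [measurable]: "G \<in> borel_measurable borel" unfolding G_def by measurable
  have G1: "0 \<le> G z" "G z \<le> 1" for z using t by (auto simp: G_def)
  define c where "c = pi / (4 * t)"
  have c: "0 < c" using t by (simp add: c_def)
  have GG: "G (x - z) * G (y - z) = exp (- (t * (norm (x - y))\<^sup>2)) * exp (- (4 * t * (norm ((x + y) / 2 - z))\<^sup>2))" for x y z
  proof -
    have "2 * (norm (x - z))\<^sup>2 + 2 * (norm (y - z))\<^sup>2 = (norm (x - y))\<^sup>2 + 4 * (norm ((x + y) / 2 - z))\<^sup>2"
      unfolding cmod_power2 by (simp add: power2_eq_square field_simps)
    then have "t * (2 * (norm (x - z))\<^sup>2 + 2 * (norm (y - z))\<^sup>2) = t * ((norm (x - y))\<^sup>2 + 4 * (norm ((x + y) / 2 - z))\<^sup>2)" by simp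
    then show ?thesis unfolding G_def exp_add[symmetric] by (simp add: algebra_simps)
  qed
  have iGG: "integrable lborel (\<lambda>z. G (x - z) * G (y - z))" and vGG: "(LINT z|lborel. G (x - z) * G (y - z)) = c * exp (- (t * (norm (x - y))\<^sup>2))" for x y
  proof -
    have t4: "0 < 4 * t" using t by simp
    show "integrable lborel (\<lambda>z. G (x - z) * G (y - z))"
      unfolding GG by (intro integrable_mult_right integrable_lborel_reflect[OF integral_gauss(1)[OF t4]])
    have "(LINT z|lborel. exp (- (4 * t * (norm ((x + y) / 2 - z))\<^sup>2))) = c"
      unfolding c_def integral_gauss(2)[OF t4, symmetric] by (rule integral_lborel_reflect) measurable
    then show "(LINT z|lborel. G (x - z) * G (y - z)) = c * exp (- (t * (norm (x - y))\<^sup>2))"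
      unfolding GG by (simp add: mult.commute)
  qed
  define F where "F p z = (case p of (x, y) \<Rightarrow> f x * f y * (G (x - z) * G (y - z)))" for p z
  have ff: "integrable lborel (\<lambda>p. case p of (x, y) \<Rightarrow> \<bar>f x\<bar> * \<bar>f y\<bar>)"
    using integrable_product(1)[OF integrable_abs[OF f] integrable_abs[OF f]] by (simp add: lborel_prod)
  have int: "integrable (lborel \<Otimes>\<^sub>M lborel) (case_prod F)"
  proof (rule lborel_pair.Fubini_integrable)
    show "case_prod F \<in> borel_measurable (lborel \<Otimes>\<^sub>M lborel)"
      unfolding F_def case_prod_beta lborel_prod[symmetric] by measurable
    show "AE p in lborel. integrable lborel (\<lambda>z. case (p, z) of (p, z) \<Rightarrow> F p z)"
      using iGG by (intro AE_I2) (auto simp: F_def)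
    show "integrable lborel (\<lambda>p. LINT z|lborel. norm (case (p, z) of (p, z) \<Rightarrow> F p z))"
    proof (rule Bochner_Integration.integrable_bound[OF integrable_mult_right[of c, OF ff]])
      show "(\<lambda>p. LINT z|lborel. norm (case (p, z) of (p, z) \<Rightarrow> F p z)) \<in> borel_measurable lborel"
        unfolding F_def case_prod_beta lborel_prod[symmetric] by measurable
      show "AE p in lborel. norm (LINT z|lborel. norm (case (p, z) of (p, z) \<Rightarrow> F p z)) \<le> norm (c * (case p of (x, y) \<Rightarrow> \<bar>f x\<bar> * \<bar>f y\<bar>))"
      proof (rule AE_I2)
        fix p :: "complex \<times> complex"
        obtain x y where p: "p = (x, y)" by (cases p)
        have "(LINT z|lborel. norm (F (x, y) z)) = \<bar>f x\<bar> * \<bar>f y\<bar> * (c * exp (- (t * (norm (x - y))\<^sup>2)))"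
          using G1 by (simp add: F_def abs_mult vGG)
        also have "\<dots> \<le> \<bar>f x\<bar> * \<bar>f y\<bar> * (c * 1)" using c t by (intro mult_left_mono) auto
        finally have "(LINT z|lborel. norm (F (x, y) z)) \<le> c * (\<bar>f x\<bar> * \<bar>f y\<bar>)" by (simp add: mult_ac)
        moreover have "0 \<le> (LINT z|lborel. norm (F (x, y) z))" by (rule integral_nonneg_AE) auto
        ultimately show "norm (LINT z|lborel. norm (case (p, z) of (p, z) \<Rightarrow> F p z)) \<le> norm (c * (case p of (x, y) \<Rightarrow> \<bar>f x\<bar> * \<bar>f y\<bar>))"
          using c by (simp add: p abs_mult)
      qed
    qed
  qed
  have "c * integral\<^sup>L (lborel \<Otimes>\<^sub>M lborel) (\<lambda>(x, y). f x * f y * exp (- (t * (norm (x - y))\<^sup>2))) = (LINT p|lborel. LINT z|lborel. F p z)"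
    unfolding lborel_prod Bochner_Integration.integral_mult_right_zero[symmetric]
    by (intro Bochner_Integration.integral_cong) (auto simp: F_def vGG)
  also have "\<dots> = (LINT z|lborel. LINT p|lborel. F p z)" by (rule lborel_pair.Fubini_integral[OF int, symmetric])
  also have "\<dots> = (LINT z|lborel. (LINT x|lborel. f x * G (x - z))\<^sup>2)"
  proof (intro Bochner_Integration.integral_cong refl)
    fix z
    have ig: "integrable lborel (\<lambda>x. f x * G (x - z))"
    proof (rule Bochner_Integration.integrable_bound[OF f])
      show "AE x in lborel. norm (f x * G (x - z)) \<le> norm (f x)"
        using G1 by (intro AE_I2) (simp add: abs_mult mult_left_le)
    qed measurable
    have "(LINT p|lborel. F p z) = integral\<^sup>L (lborel \<Otimes>\<^sub>M lborel) (\<lambda>(x, y). (f x * G (x - z)) * (f y * G (y - z)))"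
      unfolding lborel_prod by (intro Bochner_Integration.integral_cong) (auto simp: F_def mult_ac)
    also have "\<dots> = (LINT x|lborel. f x * G (x - z))\<^sup>2"
      unfolding integrable_product(2)[OF ig ig] by (simp add: power2_eq_square)
    finally show "(LINT p|lborel. F p z) = (LINT x|lborel. f x * G (x - z))\<^sup>2" .
  qed
  also have "0 \<le> \<dots>" by (rule integral_nonneg_AE) auto
  finally show ?thesis using c by (simp add: zero_le_mult_iff)
qed

text \<open>After exchanging the integrals, the compensating term contributes a multiple of the
  squared total integral of \<open>f\<close>, which is zero, and the Gaussian term is nonnegative
  for every \<open>t > 0\<close>.\<close>

lemma Dcoul_nonneg:
  assumes f: "log_class f" and f0: "integral\<^sup>L lborel f = 0"
  shows "0 \<le> Dcoul f"
proof -
  note [measurable] = log_class_measurable[OF f]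
  define F where "F p t = (case p of (x, y) \<Rightarrow> f x * f y * (indicator {0..} t * frullani_kernel ((norm (x - y))\<^sup>2) t))" for p :: "complex \<times> complex" and t :: real
  have fi: "integrable lborel f" by (rule log_class_integrable[OF f])
  have li: "integrable lborel (\<lambda>p. case p of (x, y) \<Rightarrow> f x * ln (norm (x - y)) * f y)"
    using log_integrable[OF f f] by (simp add: lborel_prod)
  have ln2: "ln ((norm z)\<^sup>2) = 2 * ln (norm z)" if "z \<noteq> 0" for z :: complex using that by (simp add: ln_realpow)
  have diag: "AE p in lborel. fst p \<noteq> (snd p :: complex)"
  proof -
    have "AE x in lborel. AE y in lborel. x \<noteq> (y :: complex)"
    proof (rule AE_I2)
      fix x :: complex
      show "AE y in lborel. x \<noteq> y" using AE_neq_complex[of x] by eventually_elim auto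
    qed
    then have "AE p in lborel \<Otimes>\<^sub>M lborel. fst p \<noteq> (snd p :: complex)"

    proof (intro lborel_pair.AE_pair_measure)
      show "{x \<in> space (lborel \<Otimes>\<^sub>M lborel). fst x \<noteq> (snd x :: complex)} \<in> sets (lborel \<Otimes>\<^sub>M lborel)" by measurable
    qed simp
    then show ?thesis unfolding lborel_prod .
  qed
  have int: "integrable (lborel \<Otimes>\<^sub>M lborel) (case_prod F)"
  proof (rule lborel_pair.Fubini_integrable)
    show "case_prod F \<in> borel_measurable (lborel \<Otimes>\<^sub>M lborel)"
      unfolding F_def case_prod_beta lborel_prod[symmetric] by measurable
    show "AE p in lborel. integrable lborel (\<lambda>t. case (p, t) of (p, t) \<Rightarrow> F p t)"
      using diag by eventually_elim (auto simp: F_def intro!: integrable_mult_right frullani(1))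
    show "integrable lborel (\<lambda>p. LINT t|lborel. norm (case (p, t) of (p, t) \<Rightarrow> F p t))"
    proof (rule Bochner_Integration.integrable_bound[OF integrable_mult_right[of 2, OF integrable_abs[OF li]]])
      show "(\<lambda>p. LINT t|lborel. norm (case (p, t) of (p, t) \<Rightarrow> F p t)) \<in> borel_measurable lborel"
        unfolding F_def case_prod_beta lborel_prod[symmetric] by measurable
      show "AE p in lborel. norm (LINT t|lborel. norm (case (p, t) of (p, t) \<Rightarrow> F p t)) \<le> norm (2 * \<bar>case p of (x, y) \<Rightarrow> f x * ln (norm (x - y)) * f y\<bar>)"
        using diag
      proof eventually_elim
        case (elim p)
        obtain x y where p: "p = (x, y)" by (cases p)
        have xy: "0 < (norm (x - y))\<^sup>2" "x - y \<noteq> 0" using elim p by auto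
        have "(LINT t|lborel. norm (F p t)) = \<bar>f x\<bar> * \<bar>f y\<bar> * (LINT t|lborel. \<bar>indicator {0..} t * frullani_kernel ((norm (x - y))\<^sup>2) t\<bar>)"
          by (simp add: F_def p abs_mult)
        also have "\<dots> = \<bar>f x\<bar> * \<bar>f y\<bar> * (2 * \<bar>ln (norm (x - y))\<bar>)"
          unfolding frullani(3)[OF xy(1)] ln2[OF xy(2)] by (simp add: abs_mult)
        finally show ?case by (simp add: p abs_mult)
      qed
    qed
  qed
  have "Dcoul f = - (1 / 2) * (LINT p|lborel. (case p of (x, y) \<Rightarrow> f x * ln (norm (x - y)) * f y))"
    by (simp add: Dcoul_def lborel_prod)
  also have "\<dots> = (LINT p|lborel. - (1 / 2) * (case p of (x, y) \<Rightarrow> f x * ln (norm (x - y)) * f y))"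
    by (rule Bochner_Integration.integral_mult_right_zero[symmetric])
  \<comment> \<open>The kernel is taken at the squared distance and integrates to
    \<open>- 2 * ln (norm (x - y))\<close>; together with the factor \<open>1 / 2\<close> of the
    energy this makes \<open>1 / 4\<close>.\<close>
  also have "\<dots> = (LINT p|lborel. 1 / 4 * (LINT t|lborel. F p t))"
  proof (rule integral_cong_AE)
    show "AE p in lborel. - (1 / 2) * (case p of (x, y) \<Rightarrow> f x * ln (norm (x - y)) * f y) = 1 / 4 * (LINT t|lborel. F p t)"
      using diag
    proof eventually_elim
      case (elim p)
      obtain x y where p: "p = (x, y)" by (cases p)
      have xy: "0 < (norm (x - y))\<^sup>2" "x - y \<noteq> 0" using elim p by auto
      have "(LINT t|lborel. F p t) = f x * f y * (LINT t|lborel. indicator {0..} t * frullani_kernel ((norm (x - y))\<^sup>2) t)"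
        by (simp add: F_def p)
      also have "\<dots> = - 2 * (f x * f y * ln (norm (x - y)))"
        unfolding frullani(2)[OF xy(1)] ln2[OF xy(2)] by simp
      finally show ?case by (simp add: p)
    qed
    show "(\<lambda>p. 1 / 4 * (LINT t|lborel. F p t)) \<in> borel_measurable lborel"
      unfolding F_def case_prod_beta lborel_prod[symmetric] by measurable
  qed (use li in auto)
  also have "\<dots> = 1 / 4 * (LINT t|lborel. LINT p|lborel. F p t)"
    using lborel_pair.Fubini_integral[OF int] by simp
  finally have "Dcoul f = 1 / 4 * (LINT t|lborel. LINT p|lborel. F p t)" .
  moreover have "0 \<le> (LINT t|lborel. LINT p|lborel. F p t)"
  proof (rule integral_nonneg_AE, rule AE_I2)
    fix t :: real
    show "0 \<le> (LINT p|lborel. F p t)"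
    proof (cases "0 < t")
      case False
      then have "F p t = 0" for p by (cases "t = 0") (auto simp: F_def frullani_kernel_def split: prod.split)
      then show ?thesis by simp
    next
      case True
      have i1: "integrable lborel (\<lambda>p. case p of (x, y) \<Rightarrow> f x * f y)" using integrable_product(1)[OF fi fi] by (simp add: lborel_prod)
      have i2: "integrable lborel (\<lambda>p. case p of (x, y) \<Rightarrow> f x * f y * exp (- (t * (norm (x - y))\<^sup>2)))"
      proof (rule Bochner_Integration.integrable_bound[OF i1])
        show "AE p in lborel. norm (case p of (x, y) \<Rightarrow> f x * f y * exp (- (t * (norm (x - y))\<^sup>2))) \<le> norm (case p of (x, y) \<Rightarrow> f x * f y)"
          using True by (intro AE_I2) (auto simp: abs_mult mult_left_le)
      qed (unfold case_prod_beta lborel_prod[symmetric], measurable)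
      have "F p t = 1 / t * ((case p of (x, y) \<Rightarrow> f x * f y * exp (- (t * (norm (x - y))\<^sup>2))) - exp (- t) * (case p of (x, y) \<Rightarrow> f x * f y))" for p
        using True by (auto simp: F_def frullani_kernel_def field_simps split: prod.split)
      then have "(LINT p|lborel. F p t) = 1 / t * ((LINT p|lborel. (case p of (x, y) \<Rightarrow> f x * f y * exp (- (t * (norm (x - y))\<^sup>2)))) - exp (- t) * (LINT p|lborel. (case p of (x, y) \<Rightarrow> f x * f y)))"
        using i1 i2 by simp
      also have "(LINT p|lborel. (case p of (x, y) \<Rightarrow> f x * f y)) = 0"
        using integrable_product(2)[OF fi fi] f0 by (simp add: lborel_prod)
      finally show ?thesis using gauss_positive[OF fi True] True by (simp add: lborel_prod)
    qed
  qed
  ultimately show ?thesis by simp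
qed

section \<open>Minimality\<close>

lemma log_class_M_TF: "\<tau> \<in> M_TF xs \<Longrightarrow> log_class \<tau>"
  by (auto simp: M_TF_def log_class_def)

lemma log_class_diff:
  assumes "\<sigma> \<in> M_TF xs" "\<tau> \<in> M_TF xs"
  shows "log_class (\<lambda>x. \<tau> x - \<sigma> x)"
  unfolding log_class_def
proof (intro conjI allI)
  show "\<bar>\<tau> x - \<sigma> x\<bar> \<le> 1" for x
  proof -
    have "0 \<le> \<tau> x" "\<tau> x \<le> 1" "0 \<le> \<sigma> x" "\<sigma> x \<le> 1" using assms by (auto simp: M_TF_def)
    then show ?thesis by linarith
  qed
qed (use assms in \<open>auto simp: M_TF_def left_diff_distrib\<close>)

lemma ln_log_class_integrable:
  assumes f: "log_class f"
  shows "integrable lborel (\<lambda>x. ln (norm (x - a)) * f x)"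
proof -
  note [measurable] = log_class_measurable[OF f] unit_kernel(4)
  have l: "integrable lborel (\<lambda>x. \<bar>f x * ln (2 + norm x)\<bar>)" "integrable lborel (\<lambda>x. ln (2 + norm a) * \<bar>f x\<bar>)"
    using f log_class_integrable[OF f] by (auto simp: log_class_def)
  have k: "integrable lborel (\<lambda>x. unit_kernel (x - a))"
    using integrable_lborel_translate[OF unit_kernel(1), of "- a"] by simp
  have "integrable lborel (\<lambda>x. \<bar>f x * ln (2 + norm x)\<bar> + ln (2 + norm a) * \<bar>f x\<bar> + unit_kernel (x - a))"
    by (intro Bochner_Integration.integrable_add l k)
  then show ?thesis
  proof (rule Bochner_Integration.integrable_bound)
    show "AE x in lborel. norm (ln (norm (x - a)) * f x) \<le> norm (\<bar>f x * ln (2 + norm x)\<bar> + ln (2 + norm a) * \<bar>f x\<bar> + unit_kernel (x - a))"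
    proof (rule AE_I2)
      fix x :: complex
      have n: "0 \<le> ln (2 + norm x)" "0 \<le> ln (2 + norm a)" by (auto intro!: ln_ge_zero)
      have f1: "\<bar>f x\<bar> \<le> 1" using f by (simp add: log_class_def)
      have "\<bar>ln (norm (x - a))\<bar> * \<bar>f x\<bar> \<le> (ln (2 + norm x) + ln (2 + norm a) + unit_kernel (x - a)) * \<bar>f x\<bar>"
        by (intro mult_right_mono abs_ln_norm_diff_le) auto
      also have "\<dots> = \<bar>f x\<bar> * ln (2 + norm x) + ln (2 + norm a) * \<bar>f x\<bar> + unit_kernel (x - a) * \<bar>f x\<bar>" by (simp add: algebra_simps)
      also have "unit_kernel (x - a) * \<bar>f x\<bar> \<le> unit_kernel (x - a) * 1" using f1 unit_kernel(3) by (intro mult_left_mono) auto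
      finally have "\<bar>ln (norm (x - a))\<bar> * \<bar>f x\<bar> \<le> \<bar>f x\<bar> * ln (2 + norm x) + ln (2 + norm a) * \<bar>f x\<bar> + unit_kernel (x - a)" by simp
      then show "norm (ln (norm (x - a)) * f x) \<le> norm (\<bar>f x * ln (2 + norm x)\<bar> + ln (2 + norm a) * \<bar>f x\<bar> + unit_kernel (x - a))"
        using n unit_kernel(3)[of "x - a"] by (simp add: abs_mult)
    qed
  qed measurable
qed

lemma Vnuc_log_class_integrable:
  assumes f: "log_class f"
  shows "integrable lborel (\<lambda>x. Vnuc xs x * f x)"
  unfolding Vnuc_def sum_negf[symmetric] sum_distrib_right
  by (intro Bochner_Integration.integrable_sum) (use ln_log_class_integrable[OF f] in simp)

text \<open>The two cross terms coincide by symmetry of the kernel, which cancels the factor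
  \<open>1 / 2\<close>; what remains is the pairing of \<open>f\<close> with the potential of
  \<open>\<sigma>\<close>.\<close>

lemma Dcoul_perturb:
  assumes s: "log_class \<sigma>" and f: "log_class f"
  shows "Dcoul (\<lambda>x. \<sigma> x + f x) = Dcoul \<sigma> + Dcoul f - (LINT x|lborel. f x * (LINT y|lborel. ln (norm (x - y)) * \<sigma> y))"
    and "integrable lborel (\<lambda>x. f x * (LINT y|lborel. ln (norm (x - y)) * \<sigma> y))"
proof -
  let ?P = "(lborel :: complex measure) \<Otimes>\<^sub>M (lborel :: complex measure)"
  let ?B = "\<lambda>g h. integral\<^sup>L ?P (\<lambda>(x, y). g x * ln (norm (x - y)) * h y)"
  note i = log_integrable[OF s s] log_integrable[OF s f] log_integrable[OF f s] log_integrable[OF f f]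
  have e: "(\<lambda>(x, y). (\<sigma> x + f x) * ln (norm (x - y)) * (\<sigma> y + f y)) =
    (\<lambda>p. ((case p of (x, y) \<Rightarrow> \<sigma> x * ln (norm (x - y)) * \<sigma> y) + (case p of (x, y) \<Rightarrow> \<sigma> x * ln (norm (x - y)) * f y))
      + ((case p of (x, y) \<Rightarrow> f x * ln (norm (x - y)) * \<sigma> y) + (case p of (x, y) \<Rightarrow> f x * ln (norm (x - y)) * f y)))"
    by (auto simp: fun_eq_iff algebra_simps)
  have B: "integral\<^sup>L ?P (\<lambda>(x, y). (\<sigma> x + f x) * ln (norm (x - y)) * (\<sigma> y + f y)) = (?B \<sigma> \<sigma> + ?B \<sigma> f) + (?B f \<sigma> + ?B f f)"
    unfolding e by (simp only: Bochner_Integration.integral_add Bochner_Integration.integrable_add i)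
  have sw: "?B \<sigma> f = ?B f \<sigma>"
  proof -
    have "?B \<sigma> f = integral\<^sup>L ?P (\<lambda>(x, y). case (y, x) of (x, y) \<Rightarrow> \<sigma> x * ln (norm (x - y)) * f y)"
      using lborel_pair.integral_product_swap[of "\<lambda>(x, y). \<sigma> x * ln (norm (x - y)) * f y"] i(2) by simp
    also have "\<dots> = ?B f \<sigma>"
      by (intro Bochner_Integration.integral_cong) (auto simp: norm_minus_commute)
    finally show ?thesis .
  qed
  have in_eq: "(LINT y|lborel. f x * ln (norm (x - y)) * \<sigma> y) = f x * (LINT y|lborel. ln (norm (x - y)) * \<sigma> y)" for x
    by (simp add: mult.assoc)
  have fs: "?B f \<sigma> = (LINT x|lborel. f x * (LINT y|lborel. ln (norm (x - y)) * \<sigma> y))"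
    using lborel_pair.integral_fst[OF i(3)] unfolding in_eq by simp
  show "integrable lborel (\<lambda>x. f x * (LINT y|lborel. ln (norm (x - y)) * \<sigma> y))"
    using lborel_pair.integrable_fst[OF i(3)] unfolding in_eq by simp
  show "Dcoul (\<lambda>x. \<sigma> x + f x) = Dcoul \<sigma> + Dcoul f - (LINT x|lborel. f x * (LINT y|lborel. ln (norm (x - y)) * \<sigma> y))"
    unfolding Dcoul_def B sw fs[symmetric] by (simp add: field_simps)
qed

text \<open>The variational equation is sufficient: the first variation of the energy at \<open>\<sigma>\<close> is
  \<open>- \<Phi>\<close>, which is negative only where \<open>\<sigma> = 1\<close>, and the second variation is nonnegative.\<close>
lemma variational_minimizer:
  fixes S :: "complex set"
  assumes S [measurable]: "S \<in> sets borel" and SR: "S \<subseteq> ball 0 R" and mass: "measure lborel S = real (length xs)"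
    and pos: "\<And>x. x \<notin> set xs \<Longrightarrow> x \<in> S \<Longrightarrow> 0 < Vnuc xs x + log_pot S x"
    and zero: "\<And>x. x \<notin> set xs \<Longrightarrow> x \<notin> S \<Longrightarrow> Vnuc xs x + log_pot S x = 0"
  shows "is_TF_min xs (indicator S)" and "is_TF_min xs \<tau> \<Longrightarrow> AE x in lborel. \<tau> x = indicator S x"
proof -
  let ?s = "indicator S :: complex \<Rightarrow> real"
  have iS: "integrable lborel ?s" by (rule G_integrable[OF S SR])
  have sM: "?s \<in> M_TF xs"
  proof -
    have "integrable lborel (\<lambda>x. ?s x *\<^sub>R ln (2 + norm x))"
    proof (rule G_bdd_integrable[OF S SR])
      fix y assume "y \<in> S"
      then have y: "norm y < R" using SR by auto
      have "0 < 2 + norm y" by (rule add_pos_nonneg) auto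
      then have "ln (2 + norm y) \<le> ln (2 + R)" using y by (intro ln_mono) auto
      moreover have "0 \<le> ln (2 + norm y)" by (intro ln_ge_zero) auto
      ultimately show "norm (ln (2 + norm y)) \<le> ln (2 + R)" by simp
    qed measurable
    then show ?thesis using mass by (auto simp: M_TF_def)
  qed
  have lns: "(LINT y|lborel. ln (norm (x - y)) * ?s y) = log_pot S x" for x by (simp add: log_pot_def mult.commute)
  define Phi where "Phi x = Vnuc xs x + log_pot S x" for x
  have nn: "AE x in lborel. x \<notin> set xs"
  proof (rule AE_not_in)
    show "set xs \<in> null_sets lborel" by (rule finite_imp_null_set_lborel) simp
  qed
  have main: "E_TF xs \<tau> = E_TF xs ?s + (LINT x|lborel. - (Phi x * (\<tau> x - ?s x))) + Dcoul (\<lambda>x. \<tau> x - ?s x)"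
    and ip: "integrable lborel (\<lambda>x. - (Phi x * (\<tau> x - ?s x)))"
    and sg: "AE x in lborel. 0 \<le> - (Phi x * (\<tau> x - ?s x))"
    and D0: "0 \<le> Dcoul (\<lambda>x. \<tau> x - ?s x)" if t: "\<tau> \<in> M_TF xs" for \<tau>
  proof -
    define f where "f x = \<tau> x - ?s x" for x
    have lf: "log_class f" unfolding f_def by (rule log_class_diff[OF sM t])
    have ls: "log_class ?s" "log_class \<tau>" using log_class_M_TF sM t by blast+
    have tf: "\<tau> = (\<lambda>x. ?s x + f x)" by (simp add: f_def)
    note P = Dcoul_perturb[OF ls(1) lf, unfolded lns]
    note V = Vnuc_log_class_integrable[OF ls(1), of xs] Vnuc_log_class_integrable[OF lf, of xs]
    have VV: "(LINT x|lborel. Vnuc xs x * \<tau> x) = (LINT x|lborel. Vnuc xs x * ?s x) + (LINT x|lborel. Vnuc xs x * f x)"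
      unfolding tf distrib_left by (rule Bochner_Integration.integral_add[OF V])
    have e: "- (Phi x * f x) = - (Vnuc xs x * f x) - f x * log_pot S x" for x by (simp add: Phi_def algebra_simps)
    have "integrable lborel (\<lambda>x. - (Phi x * f x))"
      unfolding e by (intro Bochner_Integration.integrable_diff Bochner_Integration.integrable_minus V P(2))
    then show "integrable lborel (\<lambda>x. - (Phi x * (\<tau> x - ?s x)))" by (simp add: f_def)
    have "(LINT x|lborel. - (Phi x * f x)) = - (LINT x|lborel. Vnuc xs x * f x) - (LINT x|lborel. f x * log_pot S x)"
      unfolding e by (subst Bochner_Integration.integral_diff[OF Bochner_Integration.integrable_minus[OF V(2)] P(2)]) simp
    then have "E_TF xs \<tau> = E_TF xs ?s + (LINT x|lborel. - (Phi x * f x)) + Dcoul f"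
      unfolding E_TF_def VV using P(1) tf by (simp only:)
    then show "E_TF xs \<tau> = E_TF xs ?s + (LINT x|lborel. - (Phi x * (\<tau> x - ?s x))) + Dcoul (\<lambda>x. \<tau> x - ?s x)"
      by (simp only: f_def[abs_def])
    have f0: "integral\<^sup>L lborel f = 0"
      unfolding f_def using log_class_integrable[OF ls(2)] iS t sM mass by (simp add: M_TF_def)
    show "0 \<le> Dcoul (\<lambda>x. \<tau> x - ?s x)" using Dcoul_nonneg[OF lf f0] by (simp add: f_def[abs_def])
    show "AE x in lborel. 0 \<le> - (Phi x * (\<tau> x - ?s x))"
      using nn
    proof eventually_elim
      case (elim x)
      have "\<tau> x \<le> 1" using t by (simp add: M_TF_def)
      then show ?case
        using pos[OF elim] zero[OF elim] by (cases "x \<in> S") (auto simp: Phi_def mult_le_0_iff)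
    qed
  qed
  show min: "is_TF_min xs ?s"
    unfolding is_TF_min_def
  proof (intro conjI sM ballI)
    fix \<tau> assume t: "\<tau> \<in> M_TF xs"
    show "E_TF xs ?s \<le> E_TF xs \<tau>"
      using main[OF t] D0[OF t] integral_nonneg_AE[OF sg[OF t]] by linarith
  qed
  show "AE x in lborel. \<tau> x = indicator S x" if min': "is_TF_min xs \<tau>"
  proof -
    have t: "\<tau> \<in> M_TF xs" using min' by (simp add: is_TF_min_def)
    have it: "integrable lborel \<tau>" by (rule log_class_integrable[OF log_class_M_TF[OF t]])
    have [measurable]: "\<tau> \<in> borel_measurable borel" by (rule log_class_measurable[OF log_class_M_TF[OF t]])
    have "E_TF xs \<tau> \<le> E_TF xs ?s" using min' sM by (simp add: is_TF_min_def)
    \<comment> \<open>First and second variation are both nonnegative, so equal energies make the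
      first one vanish. Strict positivity of \<open>Phi\<close> on \<open>S\<close> then forces
      \<open>\<tau> = 1\<close> there.\<close>
    then have "(LINT x|lborel. - (Phi x * (\<tau> x - ?s x))) = 0"
      using main[OF t] D0[OF t] integral_nonneg_AE[OF sg[OF t]] by linarith
    then have "AE x in lborel. - (Phi x * (\<tau> x - ?s x)) = 0"
      using integral_nonneg_eq_0_iff_AE[OF ip[OF t] sg[OF t]] by simp
    then have on: "AE x in lborel. x \<in> S \<longrightarrow> \<tau> x = 1"
      using nn
    proof eventually_elim
      case (elim x)
      then show ?case using pos[of x] by (auto simp: Phi_def)
    qed
    have g0: "AE x in lborel. 0 \<le> \<tau> x - ?s x"
      using on
    proof eventually_elim
      case (elim x)
      have "0 \<le> \<tau> x" using t by (simp add: M_TF_def)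
      then show ?case using elim by (cases "x \<in> S") auto
    qed
    \<comment> \<open>Having used up its whole mass on \<open>S\<close>, the density
      \<open>\<tau>\<close> must vanish elsewhere.\<close>
    have "(LINT x|lborel. \<tau> x - ?s x) = 0"
      using it iS t mass by (simp add: M_TF_def)
    then have "AE x in lborel. \<tau> x - ?s x = 0"
      using integral_nonneg_eq_0_iff_AE[OF Bochner_Integration.integrable_diff[OF it iS] g0] by simp
    then show ?thesis by eventually_elim simp
  qed
qed

section \<open>The Thomas-Fermi potential\<close>

lemma PhiR_indicator:
  assumes S [measurable]: "S \<in> sets borel" and \<tau> [measurable]: "\<tau> \<in> borel_measurable borel"
    and ae: "AE y in lborel. \<tau> y = indicator S y"
  shows "PhiR xs \<tau> x = Vnuc xs x + log_pot S x"
proof -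
  have "(LINT y|lborel. \<tau> y * ln (norm (x - y))) = log_pot S x"
    unfolding log_pot_def
  proof (rule integral_cong_AE)
    show "AE y in lborel. \<tau> y * ln (norm (x - y)) = indicator S y * ln (norm (x - y))"
      using ae by eventually_elim simp
  qed measurable
  then show ?thesis by (simp add: PhiR_def)
qed

lemma ln_norm_derivative:
  fixes x a :: complex
  assumes "x \<noteq> a"
  shows "((\<lambda>x. ln (norm (x - a))) has_derivative (\<lambda>h. ((x - a) /\<^sub>R (norm (x - a))\<^sup>2) \<bullet> h)) (at x)"
proof -
  have eq: "ln (norm (y - a)) = ln ((y - a) \<bullet> (y - a)) / 2" for y
    by (cases "y = a") (simp_all add: dot_square_norm ln_realpow)
  have pos: "0 < (x - a) \<bullet> (x - a)" using assms by simp
  have "((\<lambda>y. (y - a) \<bullet> (y - a)) has_derivative (\<lambda>h. (x - a) \<bullet> h + h \<bullet> (x - a))) (at x)"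
    by (auto intro!: derivative_eq_intros simp del: norm_eq_zero)
  with DERIV_ln[OF pos] have "((\<lambda>y. ln ((y - a) \<bullet> (y - a))) has_derivative (\<lambda>h. ((x - a) \<bullet> h + h \<bullet> (x - a)) * inverse ((x - a) \<bullet> (x - a)))) (at x)"
    by (rule DERIV_compose_FDERIV[where f = ln])
  then have "((\<lambda>y. ln ((y - a) \<bullet> (y - a)) / 2) has_derivative (\<lambda>h. ((x - a) \<bullet> h + h \<bullet> (x - a)) * inverse ((x - a) \<bullet> (x - a)) / 2)) (at x)"
    by (rule bounded_linear.has_derivative[OF bounded_linear_divide])
  moreover have "((x - a) \<bullet> h + h \<bullet> (x - a)) * inverse ((x - a) \<bullet> (x - a)) / 2 = ((x - a) /\<^sub>R (norm (x - a))\<^sup>2) \<bullet> h" for h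
    by (simp add: dot_square_norm inner_commute)
  ultimately show ?thesis by (simp only: eq)
qed

definition tf_grad :: "complex list \<Rightarrow> complex set \<Rightarrow> complex \<Rightarrow> complex" where
  "tf_grad xs S x = log_grad S x - (\<Sum>i<length xs. (x - xs ! i) /\<^sub>R (norm (x - xs ! i))\<^sup>2)"

lemma tf_potential_derivative:
  assumes S: "S \<in> sets borel" "S \<subseteq> ball 0 R" and x: "x \<notin> set xs"
  shows "((\<lambda>x. Vnuc xs x + log_pot S x) has_derivative (\<lambda>h. tf_grad xs S x \<bullet> h)) (at x)"
proof -
  have xi: "x \<noteq> xs ! i" if "i < length xs" for i using x that by auto
  have "((\<lambda>x. - (\<Sum>i<length xs. ln (norm (x - xs ! i))) + log_pot S x) has_derivative
      (\<lambda>h. - (\<Sum>i<length xs. ((x - xs ! i) /\<^sub>R (norm (x - xs ! i))\<^sup>2) \<bullet> h) + log_grad S x \<bullet> h)) (at x)"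
    by (intro has_derivative_add has_derivative_minus has_derivative_sum ln_norm_derivative log_pot_derivative[OF S]) (use xi in auto)
  then show ?thesis by (simp add: Vnuc_def tf_grad_def inner_diff_left inner_sum_left)
qed

lemma tf_grad_continuous:
  assumes S: "S \<in> sets borel" "S \<subseteq> ball 0 R"
  shows "continuous_on (- set xs) (tf_grad xs S)"
  unfolding tf_grad_def
  by (intro continuous_intros continuous_on_subset[OF log_grad_continuous[OF S]]) auto

text \<open>One occurrence of \<open>a\<close> in the list supplies the divergence. The other terms
  need only an upper bound on their logarithms, by \<open>ln t \<le> t\<close>, so repeated nuclei
  do no harm.\<close>

lemma tf_potential_blows_up:
  assumes S: "S \<in> sets borel" "S \<subseteq> ball 0 R" and a: "a \<in> set xs"
  shows "\<exists>d>0. \<forall>y. y \<noteq> a \<and> dist y a < d \<longrightarrow> r < Vnuc xs y + log_pot S y"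
proof -
  obtain i where i: "i < length xs" "xs ! i = a" using a by (auto simp: in_set_conv_nth)
  define C where "C = (\<Sum>j\<in>{..<length xs} - {i}. norm (a - xs ! j) + 1)"
  define L where "L = 2 * pi + measure lborel S"
  define c where "c = r + C + L - log_pot S a"
  show ?thesis
  proof (intro exI[of _ "min 1 (exp (- c))"] conjI allI impI)
    fix y assume y: "y \<noteq> a \<and> dist y a < min 1 (exp (- c))"
    then have n: "0 < norm (y - a)" "norm (y - a) < 1" "norm (y - a) < exp (- c)" by (auto simp: dist_norm)
    have "ln (norm (y - a)) < ln (exp (- c))" using n by (subst ln_less_cancel_iff) auto
    then have 1: "c < - ln (norm (y - a))" by simp
    have lt: "ln t \<le> t" if "0 \<le> t" for t :: real
      using that ln_le_minus_one[of t] by (cases "t = 0") auto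
    have "(\<Sum>j\<in>{..<length xs} - {i}. ln (norm (y - xs ! j))) \<le> C"
      unfolding C_def
    proof (intro sum_mono)
      fix j
      have "ln (norm (y - xs ! j)) \<le> norm (y - xs ! j)" by (rule lt) simp
      also have "\<dots> \<le> norm (y - a) + norm (a - xs ! j)" using norm_triangle_ineq[of "y - a" "a - xs ! j"] by simp
      finally show "ln (norm (y - xs ! j)) \<le> norm (a - xs ! j) + 1" using n by simp
    qed
    moreover have "Vnuc xs y = - ln (norm (y - a)) - (\<Sum>j\<in>{..<length xs} - {i}. ln (norm (y - xs ! j)))"
      unfolding Vnuc_def using i by (subst sum.remove[of _ i]) auto
    ultimately have 2: "- ln (norm (y - a)) - C \<le> Vnuc xs y" by simp
    have "L * norm (y - a) \<le> L * 1" using n by (intro mult_left_mono) (auto simp: L_def)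
    then have 3: "log_pot S a - L \<le> log_pot S y"
      using log_pot_lipschitz[OF S, of y a] unfolding L_def[symmetric] by (simp add: abs_le_iff)
    show "r < Vnuc xs y + log_pot S y" using 1 2 3 by (simp add: c_def)
  qed simp
qed

lemma PhiTF_continuous:
  assumes S: "S \<in> sets borel" "S \<subseteq> ball 0 R" and Phi: "\<And>x. PhiR xs \<tau> x = Vnuc xs x + log_pot S x"
  shows "continuous_on UNIV (PhiTF xs \<tau>)"
proof -
  have "(PhiTF xs \<tau> \<longlongrightarrow> PhiTF xs \<tau> x) (at x)" for x
  proof (cases "x \<in> set xs")
    case True
    have "\<forall>\<^sub>F y in at x. ereal r < PhiTF xs \<tau> y" for r
    proof -
      obtain d where d: "d > 0" "\<And>y. y \<noteq> x \<Longrightarrow> dist y x < d \<Longrightarrow> r < Vnuc xs y + log_pot S y"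
        using tf_potential_blows_up[OF S True, of r] by auto
      show ?thesis
        unfolding eventually_at by (intro exI[of _ d]) (use d in \<open>auto simp: PhiTF_def Phi\<close>)
    qed
    then show ?thesis using True by (simp add: PhiTF_def[of _ _ x] tendsto_PInfty)
  next
    case False
    have "isCont (\<lambda>x. Vnuc xs x + log_pot S x) x"
      using tf_potential_derivative[OF S False] by (rule has_derivative_continuous)
    then have "((\<lambda>y. ereal (Vnuc xs y + log_pot S y)) \<longlongrightarrow> ereal (Vnuc xs x + log_pot S x)) (at x)"
      by (intro tendsto_ereal) (simp add: isCont_def)
    then have "((\<lambda>y. ereal (Vnuc xs y + log_pot S y)) \<longlongrightarrow> PhiTF xs \<tau> x) (at x)" using False by (simp add: PhiTF_def Phi)
    then show ?thesis
    proof (rule Lim_transform_eventually)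
      have "open (- set xs)" by (simp add: finite_imp_closed open_Compl)
      then have "\<forall>\<^sub>F y in at x. y \<in> - set xs" using False by (intro eventually_at_in_open') auto
      then show "\<forall>\<^sub>F y in at x. ereal (Vnuc xs y + log_pot S y) = PhiTF xs \<tau> y"
        by eventually_elim (simp add: PhiTF_def Phi)
    qed
  qed
  then show ?thesis by (simp add: continuous_on_def)
qed

lemma SigmaTF_eq:
  assumes Phi: "\<And>x. PhiR xs \<tau> x = Vnuc xs x + log_pot S x" and nuc: "set xs \<subseteq> S"
    and pos: "\<And>x. x \<notin> set xs \<Longrightarrow> x \<in> S \<Longrightarrow> 0 < Vnuc xs x + log_pot S x"
    and zero: "\<And>x. x \<notin> set xs \<Longrightarrow> x \<notin> S \<Longrightarrow> Vnuc xs x + log_pot S x = 0"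
  shows "SigmaTF xs \<tau> = S"
proof (rule set_eqI)
  fix x
  show "x \<in> SigmaTF xs \<tau> \<longleftrightarrow> x \<in> S"
    using nuc pos[of x] zero[of x] by (cases "x \<in> set xs"; cases "x \<in> S") (auto simp: SigmaTF_def PhiTF_def Phi)
qed

lemma TF_min_measurable: "is_TF_min xs \<tau> \<Longrightarrow> \<tau> \<in> borel_measurable borel"
  by (auto simp: is_TF_min_def M_TF_def)

context
  fixes xs :: "complex list" and \<rho> :: real
  assumes tf: "0 < \<rho>" "pi * \<rho>\<^sup>2 < 1"
begin

lemmas tf_variational = tf_set_measurable[OF tf] tf_set_bounded[OF tf] measure_tf_set[OF tf] Phi_inside[OF tf] Phi_outside[OF tf]

lemma tf_set_min: "is_TF_min xs (indicator (tf_set xs \<rho>))"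
  by (rule variational_minimizer(1)[OF tf_variational(1-3)]) (use tf_variational(4-) in blast)+

lemma tf_set_unique: "is_TF_min xs \<tau> \<Longrightarrow> AE x in lborel. \<tau> x = indicator (tf_set xs \<rho>) x"
  by (rule variational_minimizer(2)[OF tf_variational(1-3)]) (use tf_variational(4-) in blast)+

lemma PhiR_tf_set: "is_TF_min xs \<tau> \<Longrightarrow> PhiR xs \<tau> x = Vnuc xs x + log_pot (tf_set xs \<rho>) x"
  by (rule PhiR_indicator[OF tf_set_measurable[OF tf] TF_min_measurable tf_set_unique])

text \<open>The left side does not mention \<open>\<rho>\<close>: all admissible radii give the same
  set, and the radius may be chosen to suit each claim.\<close>

lemma SigmaTF_tf_set: "is_TF_min xs \<tau> \<Longrightarrow> SigmaTF xs \<tau> = tf_set xs \<rho>"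
  by (rule SigmaTF_eq[OF PhiR_tf_set nuclei_in_tf_set[OF tf]]) (use Phi_inside[OF tf] Phi_outside[OF tf] in auto)

end

section \<open>Support bound, and the case of one nucleus\<close>

lemma TF_support_bound:
  assumes min: "is_TF_min xs \<sigma>" and R: "0 < R" "\<forall>y\<in>set xs. norm y < R"
  shows "AE x in lborel. 0 < \<sigma> x \<longrightarrow> x \<in> ball 0 (R + sqrt (Sup (PhiR xs \<sigma> ` sphere 0 R) / pi))"
proof -
  \<comment> \<open>With this radius the smeared nuclei lie within the closed disc of radius
    \<open>R\<close>, so on its boundary circle the obstacle is \<open>Vnuc\<close> and its gap to
    the solution is the potential itself. The entry \<open>1 / 2\<close> ensures
    \<open>pi * d\<^sup>2 < 1\<close>.\<close>
  define d where "d = Min (insert (1/2) ((\<lambda>y. R - norm y) ` set xs))"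
  have d: "0 < d" unfolding d_def using R(2) by (subst Min_gr_iff) auto
  have d2: "d \<le> 1 / 2" "\<And>y. y \<in> set xs \<Longrightarrow> d \<le> R - norm y" unfolding d_def by (rule Min_le; simp)+
  have "d\<^sup>2 \<le> (1 / 2)\<^sup>2" using d d2(1) by (intro power_mono) auto
  then have "pi * d\<^sup>2 \<le> pi * (1 / 4)" by (intro mult_left_mono) (auto simp: power2_eq_square)
  also have "\<dots> < 1" using pi_less_4 by simp
  finally have tf: "0 < d" "pi * d\<^sup>2 < 1" using d by auto
  define M where "M = Sup (PhiR xs \<sigma> ` sphere 0 R) / pi"
  note Phi = PhiR_tf_set[OF tf min]
  have sph: "x \<notin> set xs" if "norm x = R" for x using R(2) that by auto
  have nn: "0 \<le> PhiR xs \<sigma> x" if "norm x = R" for x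
    using Phi_inside[OF tf, of x xs] Phi_outside[OF tf, of x xs] sph[OF that] Phi[of x] by (cases "x \<in> tf_set xs d") auto
  have "isCont (PhiR xs \<sigma>) x" if "norm x = R" for x
    unfolding Phi using has_derivative_continuous[OF tf_potential_derivative[OF tf_set_measurable[OF tf] tf_set_bounded[OF tf] sph[OF that]]] .
  then have "continuous_on (sphere 0 R) (PhiR xs \<sigma>)" by (intro continuous_at_imp_continuous_on) auto
  then have bdd: "bdd_above (PhiR xs \<sigma> ` sphere 0 R)"
    by (intro bounded_imp_bdd_above compact_imp_bounded compact_continuous_image) auto
  have le: "PhiR xs \<sigma> x \<le> pi * M" if "norm x = R" for x
    unfolding M_def using that by (simp add: cSUP_upper[OF _ bdd])
  have "norm (of_real R :: complex) = R" using R(1) by simp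
  then have "0 \<le> pi * M" using le[of "of_real R"] nn[of "of_real R"] by simp
  then have M0: "0 \<le> M" using pi_gt_zero by (simp add: zero_le_mult_iff)
  have sub: "tf_set xs d \<subseteq> ball 0 (R + sqrt M)"
  proof (rule tf_set_in_disc[OF tf _ R(1) M0])
    show "norm (xs ! i) + d \<le> R" if "i < length xs" for i using d2(2)[OF nth_mem[OF that]] by simp
    fix x :: complex assume x: "norm x = R"
    have "tf_obstacle xs d x = Vnuc xs x"
    proof (rule tf_obstacle_eq_Vnuc[OF tf(1)])
      fix i assume i: "i < length xs"
      show "d \<le> norm (x - xs ! i)" using d2(2)[OF nth_mem[OF i]] norm_triangle_ineq2[of x "xs ! i"] x by simp
    qed
    then show "tf_obstacle xs d x - tf_sol xs d x \<le> pi * M" using le[OF x] tf_sol_eq[OF tf, of xs x] Phi[of x] by simp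
  qed
  show ?thesis
    unfolding M_def[symmetric] using tf_set_unique[OF tf min]
    by eventually_elim (use sub in \<open>auto split: split_indicator_asm\<close>)
qed

lemma log_pot_ball_translate: "log_pot (ball a r) x = log_pot (ball 0 r) (x - a)"
proof -
  have [measurable]: "ball a r \<in> sets borel" by simp
  have "log_pot (ball a r) x = (LINT y|lborel. indicator (ball a r) (a + y) * ln (norm (x - (a + y))))"
    unfolding log_pot_def by (rule integral_lborel_translate[symmetric]) measurable
  also have "\<dots> = log_pot (ball 0 r) (x - a)"
    unfolding log_pot_def by (intro Bochner_Integration.integral_cong) (auto simp: dist_norm algebra_simps split: split_indicator)
  finally show ?thesis .
qed

text \<open>A disc of area 1 about \<open>a\<close> neutralizes the nucleus, and the resulting
  potential is \<open>ln_defect r (x - a)\<close>: positive inside the disc, zero outside. The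
  variational criterion does the rest.\<close>

lemma TF_single:
  assumes "is_TF_min [a] \<tau>"
  shows "SigmaTF [a] \<tau> = ball a (1 / sqrt pi)"
proof -
  define r where "r = 1 / sqrt pi"
  have r: "0 < r" "pi * r\<^sup>2 = 1" by (auto simp: r_def power_divide)
  have S: "ball a r \<in> sets borel" "ball a r \<subseteq> ball 0 (norm a + r)"
  proof -
    show "ball a r \<subseteq> ball 0 (norm a + r)"
    proof
      fix x assume "x \<in> ball a r"
      then show "x \<in> ball 0 (norm a + r)" using norm_triangle_sub[of x a] by (simp add: dist_norm norm_minus_commute)
    qed
  qed simp
  have Phi: "Vnuc [a] x + log_pot (ball a r) x = ln_defect r (x - a)" for x
    using ln_mean_log_pot[OF r(1), of "x - a"] by (simp add: Vnuc_def log_pot_ball_translate[of a] ln_defect_def r(2))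
  have m: "measure lborel (ball a r) = real (length [a])" using r by (simp add: measure_ball_complex)
  have pos: "0 < Vnuc [a] x + log_pot (ball a r) x" if "x \<notin> set [a]" "x \<in> ball a r" for x
    unfolding Phi using that by (intro ln_defect_pos) (auto simp: dist_norm norm_minus_commute)
  have zero: "Vnuc [a] x + log_pot (ball a r) x = 0" if "x \<notin> set [a]" "x \<notin> ball a r" for x
    unfolding Phi using that by (intro ln_defect_outside) (auto simp: dist_norm norm_minus_commute)
  have ae: "AE x in lborel. \<tau> x = indicator (ball a r) x"
    by (rule variational_minimizer(2)[OF S m pos zero assms])
  have "SigmaTF [a] \<tau> = ball a r"
    by (rule SigmaTF_eq[OF PhiR_indicator[OF S(1) TF_min_measurable[OF assms] ae] _ pos zero]) (use r in auto)
  then show ?thesis by (simp add: r_def)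
qed

theorem theorem3p2:
  fixes xs :: "complex list" and K :: nat
  assumes "length xs = K" and "0 < K"
  shows
    \<comment> \<open>(1) existence and uniqueness (a.e.) of the minimizer\<close>
    "(\<exists>\<sigma>. is_TF_min xs \<sigma> \<and> (\<forall>\<tau>. is_TF_min xs \<tau> \<longrightarrow> (AE x in lborel. \<tau> x = \<sigma> x)))
     \<and> (\<forall>\<sigma>. is_TF_min xs \<sigma> \<longrightarrow>
        \<comment> \<open>(2) regularity, decay and variational inequalities\<close>
        continuous_on UNIV (PhiTF xs \<sigma>)
        \<and> (\<exists>D :: complex \<Rightarrow> complex \<Rightarrow>\<^sub>L real.
             (\<forall>x\<in>- set xs. (PhiR xs \<sigma> has_derivative blinfun_apply (D x)) (at x))
             \<and> continuous_on (- set xs) D)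
        \<and> (PhiR xs \<sigma> \<longlongrightarrow> 0) at_infinity
        \<and> (AE x in lborel. (0 < \<sigma> x \<longrightarrow> 0 < PhiTF xs \<sigma> x)
                           \<and> (\<sigma> x = 0 \<longrightarrow> PhiTF xs \<sigma> x = 0))
        \<comment> \<open>(3) values of the density\<close>
        \<and> {x. 0 < \<sigma> x \<and> \<sigma> x < 1} \<in> null_sets lborel
        \<and> (AE x in lborel. \<sigma> x = 0 \<or> \<sigma> x = 1)
        \<comment> \<open>(4)(i) support bound\<close>
        \<and> (\<forall>R::real. (\<forall>y\<in>set xs. norm y < R) \<longrightarrow>
             (AE x in lborel. 0 < \<sigma> x \<longrightarrow>
                x \<in> ball 0 (R + sqrt (Sup (PhiR xs \<sigma> ` sphere 0 R) / pi))))
        \<comment> \<open>(4)(ii) support equals Sigma up to null sets; Sigma open of area K\<close>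
        \<and> open (SigmaTF xs \<sigma>)
        \<and> (AE x in lborel. 0 < \<sigma> x \<longleftrightarrow> x \<in> SigmaTF xs \<sigma>)
        \<and> emeasure lborel (SigmaTF xs \<sigma>) = ennreal (real K)
        \<comment> \<open>(4)(iii) nuclei in Sigma; each component contains a nucleus\<close>
        \<and> set xs \<subseteq> SigmaTF xs \<sigma>
        \<and> (\<forall>C\<in>components (SigmaTF xs \<sigma>). C \<inter> set xs \<noteq> {})
        \<comment> \<open>(4)(iv) monotonicity when removing the last nucleus\<close>
        \<and> (\<forall>\<tau>. is_TF_min (butlast xs) \<tau> \<longrightarrow>
             SigmaTF (butlast xs) \<tau> \<subseteq> SigmaTF xs \<sigma>))
     \<comment> \<open>(4)(v) single nucleus\<close>
     \<and> (\<forall>a \<tau>. is_TF_min [a] \<tau> \<longrightarrow> SigmaTF [a] \<tau> = ball a (1 / sqrt pi))"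
proof -
  \<comment> \<open>Any admissible radius would do here; only the support bound chooses its
    own.\<close>
  have "pi * (1 / 2)\<^sup>2 < (1::real)" using pi_less_4 by (simp add: power2_eq_square)
  then have tf: "0 < (1 / 2 :: real)" "pi * (1 / 2)\<^sup>2 < (1::real)" by simp_all
  define S where "S = tf_set xs (1 / 2)"
  note S = tf_set_measurable[OF tf, of xs, folded S_def] tf_set_bounded[OF tf, of xs, folded S_def]
  note inside = Phi_inside[OF tf, of _ xs, folded S_def] and outside = Phi_outside[OF tf, of _ xs, folded S_def]
  show ?thesis
  proof (intro conjI allI impI)
    show "\<exists>\<sigma>. is_TF_min xs \<sigma> \<and> (\<forall>\<tau>. is_TF_min xs \<tau> \<longrightarrow> (AE x in lborel. \<tau> x = \<sigma> x))"
      using tf_set_min[OF tf] tf_set_unique[OF tf] by blast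
    show "SigmaTF [a] \<tau> = ball a (1 / sqrt pi)" if "is_TF_min [a] \<tau>" for a \<tau>
      by (rule TF_single[OF that])
  next
    fix \<sigma> assume min: "is_TF_min xs \<sigma>"
    note Phi = PhiR_tf_set[OF tf min, folded S_def] and Sig = SigmaTF_tf_set[OF tf min, folded S_def]
      and ae = tf_set_unique[OF tf min, folded S_def]
    have [measurable]: "\<sigma> \<in> borel_measurable borel" by (rule TF_min_measurable[OF min])
    show "continuous_on UNIV (PhiTF xs \<sigma>)" by (rule PhiTF_continuous[OF S Phi])
    show "\<exists>D :: complex \<Rightarrow> complex \<Rightarrow>\<^sub>L real.
             (\<forall>x\<in>- set xs. (PhiR xs \<sigma> has_derivative blinfun_apply (D x)) (at x))
             \<and> continuous_on (- set xs) D"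
    \<comment> \<open>The derivative is the gradient acting through the inner product. This passage
      from vectors to functionals is bounded linear, so it preserves the continuity of
      \<open>tf_grad\<close>.\<close>
    proof (intro exI[of _ "\<lambda>x. blinfun_inner_right (tf_grad xs S x)"] conjI ballI)
      fix x assume "x \<in> - set xs"
      then show "(PhiR xs \<sigma> has_derivative blinfun_apply (blinfun_inner_right (tf_grad xs S x))) (at x)"
        using tf_potential_derivative[OF S, of x xs] by (simp add: Phi[abs_def])
    next
      show "continuous_on (- set xs) (\<lambda>x. blinfun_inner_right (tf_grad xs S x))"
        by (rule bounded_linear.continuous_on[OF bounded_linear_blinfun_inner_right tf_grad_continuous[OF S]])
    qed
    \<comment> \<open>More than decay holds: the nuclei are fully screened, and the potential is
      identically zero outside a bounded set.\<close>
    show "(PhiR xs \<sigma> \<longlongrightarrow> 0) at_infinity"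
    proof (rule tendsto_eventually)
      show "\<forall>\<^sub>F x in at_infinity. PhiR xs \<sigma> x = 0"
        unfolding eventually_at_infinity
      proof (intro exI[of _ "tf_bound xs (1 / 2)"] allI impI)
        fix x :: complex assume "tf_bound xs (1 / 2) \<le> norm x"
        then have "x \<notin> ball 0 (tf_bound xs (1 / 2))" by simp
        then have "x \<notin> S" using S(2) by blast
        then show "PhiR xs \<sigma> x = 0" using Phi[of x] outside[of x] by simp
      qed
    qed
    have iff: "0 < PhiTF xs \<sigma> x \<longleftrightarrow> x \<in> S" for x using Sig by (auto simp: SigmaTF_def)
    show "AE x in lborel. (0 < \<sigma> x \<longrightarrow> 0 < PhiTF xs \<sigma> x) \<and> (\<sigma> x = 0 \<longrightarrow> PhiTF xs \<sigma> x = 0)"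
      using ae
    proof eventually_elim
      case (elim x)
      have "PhiTF xs \<sigma> x = 0" if "x \<notin> S"
        using that nuclei_in_tf_set[OF tf, of xs] Phi[of x] outside[OF that] by (auto simp: PhiTF_def S_def zero_ereal_def)
      then show ?case using elim iff[of x] by (cases "x \<in> S") auto
    qed
    show ae01: "AE x in lborel. \<sigma> x = 0 \<or> \<sigma> x = 1"
      using ae by eventually_elim (auto split: split_indicator)
    show "{x. 0 < \<sigma> x \<and> \<sigma> x < 1} \<in> null_sets lborel"
    proof (subst AE_iff_null_sets)
      show "{x. 0 < \<sigma> x \<and> \<sigma> x < 1} \<in> sets lborel" by measurable
      show "AE x in lborel. x \<notin> {x. 0 < \<sigma> x \<and> \<sigma> x < 1}" using ae01 by eventually_elim auto
    qed
    show "AE x in lborel. 0 < \<sigma> x \<longrightarrow> x \<in> ball 0 (R + sqrt (Sup (PhiR xs \<sigma> ` sphere 0 R) / pi))"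
      if R: "\<forall>y\<in>set xs. norm y < R" for R
    proof (rule TF_support_bound[OF min _ R])
      have "xs ! 0 \<in> set xs" using assms by (intro nth_mem) simp
      then show "0 < R" using R norm_ge_zero[of "xs ! 0"] by (meson order_le_less_trans)
    qed
    show "open (SigmaTF xs \<sigma>)" unfolding Sig S_def by (rule tf_set_open[OF tf])
    show "AE x in lborel. 0 < \<sigma> x \<longleftrightarrow> x \<in> SigmaTF xs \<sigma>"
      unfolding Sig using ae by eventually_elim (auto split: split_indicator)
    show "emeasure lborel (SigmaTF xs \<sigma>) = ennreal (real K)"
      unfolding Sig using measure_tf_set[OF tf, of xs] G_finite[OF S] assms(1)
      by (simp add: S_def emeasure_eq_ennreal_measure less_top)
    show "set xs \<subseteq> SigmaTF xs \<sigma>" unfolding Sig S_def by (rule nuclei_in_tf_set[OF tf])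
    show "\<forall>C\<in>components (SigmaTF xs \<sigma>). C \<inter> set xs \<noteq> {}"
      unfolding Sig S_def using tf_set_component_meets[OF tf] by blast
    \<comment> \<open>For \<open>K = 1\<close> the shorter list is empty; the obstacle construction
      covers this case as well.\<close>
    show "SigmaTF (butlast xs) \<tau> \<subseteq> SigmaTF xs \<sigma>" if "is_TF_min (butlast xs) \<tau>" for \<tau>
      unfolding Sig SigmaTF_tf_set[OF tf that] S_def
      by (rule tf_set_butlast[OF tf]) (use assms in auto)
  qed
qed

end
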